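(* Let $R=\bigoplus_{n\ge 0}R_n$ be a graded commutative Noetherian ring, where $R_0$ is a Noetherian local ring with maximal ideal $\mathfrak{m}_0$ and $R$ is generated as an $R_0$-algebra by finitely many elements of $R_1$. Let $R_+=\bigoplus_{n>0}R_n$ and let $M$ be a non-zero finitely generated graded $R$-module. Set $c=\mathrm{cd}(R_+,M)$ and $d=\dim(R_0)$. Then: (i) $H^{d}_{\mathfrak{m}_0R}(H^{c}_{R_+}(M))$ and $H^{d-1}_{\mathfrak{m}_0R}(H^{c}_{R_+}(M))$ are Artinian $R$-modules. (ii) If $H^{d-3}_{\mathfrak{m}_0R}(H^{c}_{R_+}(M))$ and $H^{d-2}_{\mathfrak{m}_0R}(H^{c-1}_{R_+}(M))$ are Artinian, then $H^{d}_{\mathfrak{m}_0R}(H^{c-2}_{R_+}(M))$ and $H^{d-1}_{\mathfrak{m}_0R}(H^{c-1}_{R_+}(M))$ are Artinian. (iii) If $H^{d-3}_{\mathfrak{m}_0R}(H^{c}_{R_+}(M))$ is Artinian, then $H^{d-1}_{\mathfrak{m}_0R}(H^{c-1}_{R_+}(M))$ is Artinian. (iv) If $H^{d}_{\mathfrak{m}_0R}(H^{c-2}_{R_+}(M))$ and $H^{d-1}_{\mathfrak{m}_0R}(H^{c-1}_{R_+}(M))$ are Artinian, then $H^{d-3}_{\mathfrak{m}_0R}(H^{c}_{R_+}(M))$ is Artinian. (v) $H^{d-2}_{\mathfrak{m}_0R}(H^{c}_{R_+}(M))$ is Artinian if and only if $H^{d}_{\mathfrak{m}_0R}(H^{c-1}_{R_+}(M))$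 is Artinian. (Throughout, "Artinian" means Artinian as an $R$-module.)
   Context: For an ideal $\mathfrak{b}$ of $R$ and an $R$-module $T$, $H^i_{\mathfrak{b}}(T)$ denotes the $i$-th local cohomology module of $T$ with respect to $\mathfrak{b}$; by convention it is $0$ for $i<0$. The cohomological dimension $\mathrm{cd}(R_+,M)$ is the largest non-negative integer $i$ such that $H^i_{R_+}(M)\neq 0$. $\dim(R_0)$ is the Krull dimension of $R_0$. *)

theory Defs
  imports "HOL-Algebra.Algebra" "HOL-Library.Extended_Nat"
begin

section \<open>Commutative rings\<close>

definition local_ring :: "('a, 'r) ring_scheme \<Rightarrow> 'a set \<Rightarrow> bool" where
  "local_ring R \<mm> \<longleftrightarrow> cring R \<and> maximalideal \<mm> R \<and> (\<forall>J. maximalideal J R \<longrightarrow> J = \<mm>)"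

definition krull_dim :: "('a, 'r) ring_scheme \<Rightarrow> enat" where
  "krull_dim R = Sup {enat n | n. \<exists>P :: nat \<Rightarrow> 'a set.
     (\<forall>i\<le>n. primeideal (P i) R) \<and> (\<forall>i<n. P i \<subset> P (Suc i))}"

section \<open>Modules\<close>

definition mod_hom ::
  "('a, 'r) ring_scheme \<Rightarrow> ('a, 'm, 'k) module_scheme \<Rightarrow> ('a, 'n, 'l) module_scheme \<Rightarrow> ('m \<Rightarrow> 'n) set"
  where
  "mod_hom R M N = {f \<in> hom (add_monoid M) (add_monoid N).
     \<forall>r\<in>carrier R. \<forall>x\<in>carrier M. f (r \<odot>\<^bsub>M\<^esub> x) = r \<odot>\<^bsub>N\<^esub> f x}"

definition finitely_generated_module ::
  "('a, 'r) ring_scheme \<Rightarrow> ('a, 'm, 'k) module_scheme \<Rightarrow> bool" where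
  "finitely_generated_module R M \<longleftrightarrow> module R M \<and>
     (\<exists>S. finite S \<and> S \<subseteq> carrier M \<and> (\<forall>N. submodule N R M \<and> S \<subseteq> N \<longrightarrow> N = carrier M))"

definition artinian_module ::
  "('a, 'r) ring_scheme \<Rightarrow> ('a, 'm, 'k) module_scheme \<Rightarrow> bool" where
  "artinian_module R M \<longleftrightarrow> module R M \<and>
     (\<forall>N :: nat \<Rightarrow> 'm set. (\<forall>i. submodule (N i) R M) \<and> (\<forall>i. N (Suc i) \<subseteq> N i)
        \<longrightarrow> (\<exists>n. \<forall>i\<ge>n. N i = N n))"

text \<open>The fields \<open>monoid.mult\<close> and \<open>one\<close> of a module record carry no meaning.
  \<open>N\<close> is meant to be a submodule of \<open>M\<close>.\<close>

definition module_quotient :: "('a, 'm, 'k) module_scheme \<Rightarrow> 'm set \<Rightarrow> ('a, 'm set) module" where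
  "module_quotient M N =
     \<lparr>carrier = a_rcosets\<^bsub>M\<^esub> N,
      monoid.mult = undefined, one = undefined, ring.zero = N, ring.add = set_add M,
      smult = (\<lambda>r C. \<Union>x\<in>C. N +>\<^bsub>M\<^esub> (r \<odot>\<^bsub>M\<^esub> x))\<rparr>"

text \<open>Modules of all types cannot be quantified over inside a formula; the test modules here
  are those carried by the type \<open>'a\<close> of ring elements, among them \<open>R\<close> and all its ideals.
  By Baer's criterion nothing is lost: lemma \<open>injective_module_extend\<close> below gives the
  extension property for test modules of every type.\<close>

definition injective_module ::
  "('a, 'r) ring_scheme \<Rightarrow> ('a, 'm, 'k) module_scheme \<Rightarrow> bool" where
  "injective_module R Q \<longleftrightarrow> module R Q \<and>
     (\<forall>(B :: ('a, 'a) module) N g.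
        module R B \<and> submodule N R B \<and> g \<in> mod_hom R (B\<lparr>carrier := N\<rparr>) Q
        \<longrightarrow> (\<exists>h\<in>mod_hom R B Q. \<forall>x\<in>N. h x = g x))"

section \<open>Graded rings and modules\<close>

definition internal_direct_sum :: "('b, 'm) ring_scheme \<Rightarrow> ('i \<Rightarrow> 'b set) \<Rightarrow> bool" where
  "internal_direct_sum M G \<longleftrightarrow> (\<forall>i. additive_subgroup (G i) M) \<and>
     (\<forall>x\<in>carrier M. \<exists>!f. (\<forall>i. f i \<in> G i) \<and> finite {i. f i \<noteq> \<zero>\<^bsub>M\<^esub>} \<and>
        x = finsum M f {i. f i \<noteq> \<zero>\<^bsub>M\<^esub>})"

definition graded_ring :: "('a, 'r) ring_scheme \<Rightarrow> (nat \<Rightarrow> 'a set) \<Rightarrow> bool" where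
  "graded_ring R A \<longleftrightarrow> cring R \<and> internal_direct_sum R A \<and> \<one>\<^bsub>R\<^esub> \<in> A 0 \<and>
     (\<forall>i j. \<forall>r\<in>A i. \<forall>s\<in>A j. r \<otimes>\<^bsub>R\<^esub> s \<in> A (i + j))"

definition graded_module ::
  "('a, 'r) ring_scheme \<Rightarrow> (nat \<Rightarrow> 'a set) \<Rightarrow> ('a, 'm, 'k) module_scheme \<Rightarrow> (int \<Rightarrow> 'm set) \<Rightarrow> bool"
  where
  "graded_module R A M G \<longleftrightarrow> module R M \<and> internal_direct_sum M G \<and>
     (\<forall>i j. \<forall>r\<in>A i. \<forall>x\<in>G j. r \<odot>\<^bsub>M\<^esub> x \<in> G (int i + j))"

definition irrelevant_ideal :: "('a, 'r) ring_scheme \<Rightarrow> (nat \<Rightarrow> 'a set) \<Rightarrow> 'a set" where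
  "irrelevant_ideal R A = {finsum R f I | f I. finite I \<and> 0 \<notin> I \<and> (\<forall>n\<in>I. f n \<in> A n)}"

section \<open>Local cohomology\<close>

record ('a, 'e) cochain_complex =
  cmod :: "nat \<Rightarrow> ('a, 'e) module"
  cdiff :: "nat \<Rightarrow> 'e \<Rightarrow> 'e"

definition cocycles :: "('a, 'e) cochain_complex \<Rightarrow> nat \<Rightarrow> 'e set" where
  "cocycles E n = a_kernel (cmod E n) (cmod E (Suc n)) (cdiff E n)"

fun coboundaries :: "('a, 'e) cochain_complex \<Rightarrow> nat \<Rightarrow> 'e set" where
  "coboundaries E 0 = {\<zero>\<^bsub>cmod E 0\<^esub>}"
| "coboundaries E (Suc n) = cdiff E n ` carrier (cmod E n)"

text \<open>In negative degrees this is the zero module.\<close>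

definition cohomology :: "('a, 'e) cochain_complex \<Rightarrow> int \<Rightarrow> ('a, 'e set) module" where
  "cohomology E i =
     (if i < 0 then module_quotient ((cmod E 0)\<lparr>carrier := {\<zero>\<^bsub>cmod E 0\<^esub>}\<rparr>) {\<zero>\<^bsub>cmod E 0\<^esub>}
      else module_quotient ((cmod E (nat i))\<lparr>carrier := cocycles E (nat i)\<rparr>)
             (coboundaries E (nat i)))"

definition injective_resolution ::
  "('a, 'r) ring_scheme \<Rightarrow> ('a, 'm, 'k) module_scheme \<Rightarrow> ('m \<Rightarrow> 'e) \<Rightarrow> ('a, 'e) cochain_complex \<Rightarrow> bool"
  where
  "injective_resolution R M \<eta> E \<longleftrightarrow> module R M \<and>
     (\<forall>n. injective_module R (cmod E n)) \<and>
     (\<forall>n. cdiff E n \<in> mod_hom R (cmod E n) (cmod E (Suc n))) \<and>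
     \<eta> \<in> mod_hom R M (cmod E 0) \<and> inj_on \<eta> (carrier M) \<and>
     \<eta> ` carrier M = cocycles E 0 \<and>
     (\<forall>n. coboundaries E (Suc n) = cocycles E (Suc n))"

text \<open>The \<open>\<bb>\<close>-torsion functor; on homomorphisms it acts by restriction. Powers of \<open>\<bb>\<close> are
  taken in the monoid of ideals, with \<open>\<bb>\<^sup>0 = R\<close>.\<close>

definition torsion_part ::
  "('a, 'r) ring_scheme \<Rightarrow> 'a set \<Rightarrow> ('a, 'm, 'k) module_scheme \<Rightarrow> 'm set" where
  "torsion_part R \<bb> M =
     {x \<in> carrier M. \<exists>n::nat. \<forall>r \<in> \<bb> [^]\<^bsub>ideals_set R\<^esub> n. r \<odot>\<^bsub>M\<^esub> x = \<zero>\<^bsub>M\<^esub>}"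

definition torsion_complex ::
  "('a, 'r) ring_scheme \<Rightarrow> 'a set \<Rightarrow> ('a, 'e) cochain_complex \<Rightarrow> ('a, 'e) cochain_complex" where
  "torsion_complex R \<bb> E =
     \<lparr>cmod = (\<lambda>n. (cmod E n)\<lparr>carrier := torsion_part R \<bb> (cmod E n)\<rparr>), cdiff = cdiff E\<rparr>"

text \<open>Local cohomology is the right derived functor of the torsion functor. If \<open>E\<close> is an injective
  resolution of \<open>T\<close>, then \<open>local_cohomology R \<bb> E i\<close> is the \<open>i\<close>-th local cohomology module of \<open>T\<close>
  with respect to \<open>\<bb>\<close>; up to isomorphism it does not depend on \<open>E\<close>. The resolution is an argument
  so that no choice of resolution, and no type to choose it from, is built into the definition.
  Over a Noetherian \<open>R\<close>, a module on a type \<open>'m\<close> has an injective resolution on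
  \<open>'a \<times> 'm \<times> nat\<close>, since it embeds into an injective module of no larger infinite cardinality
  than this type.\<close>

definition local_cohomology ::
  "('a, 'r) ring_scheme \<Rightarrow> 'a set \<Rightarrow> ('a, 'e) cochain_complex \<Rightarrow> int \<Rightarrow> ('a, 'e set) module" where
  "local_cohomology R \<bb> E i = cohomology (torsion_complex R \<bb> E) i"

definition cohomological_dim ::
  "('a, 'r) ring_scheme \<Rightarrow> 'a set \<Rightarrow> ('a, 'e) cochain_complex \<Rightarrow> nat" where
  "cohomological_dim R \<bb> E =
     (GREATEST i. carrier (local_cohomology R \<bb> E (int i)) \<noteq> {\<zero>\<^bsub>local_cohomology R \<bb> E (int i)\<^esub>})"

section \<open>Baer's criterion\<close>

definition regular_module :: "('a, 'r) ring_scheme \<Rightarrow> ('a, 'a) module" where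
  "regular_module R = \<lparr>carrier = carrier R, monoid.mult = monoid.mult R, one = \<one>\<^bsub>R\<^esub>,
     ring.zero = \<zero>\<^bsub>R\<^esub>,
     ring.add = ring.add R, smult = monoid.mult R\<rparr>"

lemma regular_module: "cring R \<Longrightarrow> module R (regular_module R)"
proof -
  assume R: "cring R"
  interpret cring R by fact
  have "abelian_group (regular_module R)"
    by (rule abelian_groupI)
       (auto simp: regular_module_def a_ac intro: bexI[of _ "\<ominus>\<^bsub>R\<^esub> _"] l_neg)
  then show ?thesis
    by (intro moduleI R) (auto simp: regular_module_def l_distr r_distr m_assoc)
qed

lemma mod_homI:
  assumes "\<And>x. x \<in> carrier M \<Longrightarrow> f x \<in> carrier N"
    and "\<And>x y. x \<in> carrier M \<Longrightarrow> y \<in> carrier M \<Longrightarrow> f (x \<oplus>\<^bsub>M\<^esub> y) = f x \<oplus>\<^bsub>N\<^esub> f y"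
    and "\<And>r x. r \<in> carrier R \<Longrightarrow> x \<in> carrier M \<Longrightarrow> f (r \<odot>\<^bsub>M\<^esub> x) = r \<odot>\<^bsub>N\<^esub> f x"
  shows "f \<in> mod_hom R M N"
  using assms by (auto simp: mod_hom_def hom_def)

lemma mod_homD:
  assumes "f \<in> mod_hom R M N"
  shows "x \<in> carrier M \<Longrightarrow> f x \<in> carrier N"
    and "x \<in> carrier M \<Longrightarrow> y \<in> carrier M \<Longrightarrow> f (x \<oplus>\<^bsub>M\<^esub> y) = f x \<oplus>\<^bsub>N\<^esub> f y"
    and "r \<in> carrier R \<Longrightarrow> x \<in> carrier M \<Longrightarrow> f (r \<odot>\<^bsub>M\<^esub> x) = r \<odot>\<^bsub>N\<^esub> f x"
  using assms by (auto simp: mod_hom_def hom_def)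

lemma injective_module_extend:
  fixes R :: "('a, 'r) ring_scheme" and B :: "('a, 'b, 'k) module_scheme"
    and Q :: "('a, 'q, 'l) module_scheme"
  assumes inj: "injective_module R Q" and B: "module R B" and N: "submodule N R B"
    and g: "g \<in> mod_hom R (B\<lparr>carrier := N\<rparr>) Q"
  shows "\<exists>h\<in>mod_hom R B Q. \<forall>x\<in>N. h x = g x"
proof -
  have Q: "module R Q" using inj by (simp add: injective_module_def)
  interpret B: module R B by fact
  interpret Q: module R Q by fact
  note NE = B.submoduleE[OF N]
  define good where "good G \<longleftrightarrow> G \<subseteq> carrier B \<times> carrier Q \<and> (\<forall>x\<in>N. (x, g x) \<in> G) \<and>
    (\<forall>x y x' y'. (x, y) \<in> G \<and> (x', y') \<in> G \<longrightarrow> (x \<oplus>\<^bsub>B\<^esub> x', y \<oplus>\<^bsub>Q\<^esub> y') \<in> G) \<and>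
    (\<forall>r\<in>carrier R. \<forall>x y. (x, y) \<in> G \<longrightarrow> (r \<odot>\<^bsub>B\<^esub> x, r \<odot>\<^bsub>Q\<^esub> y) \<in> G) \<and>
    (\<forall>y. (\<zero>\<^bsub>B\<^esub>, y) \<in> G \<longrightarrow> y = \<zero>\<^bsub>Q\<^esub>)" for G
  note gD = mod_homD[OF g, simplified]
  have N0: "\<zero>\<^bsub>B\<^esub> \<in> N" using N by (simp add: submodule_def subgroup_def)
  have g0: "g \<zero>\<^bsub>B\<^esub> = \<zero>\<^bsub>Q\<^esub>"
    using gD(3)[of "\<zero>\<^bsub>R\<^esub>" "\<zero>\<^bsub>B\<^esub>"] gD(1)[of "\<zero>\<^bsub>B\<^esub>"] N0 by simp
  have good0: "good ((\<lambda>x. (x, g x)) ` N)"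
    unfolding good_def using NE gD g0 by auto
  have "\<exists>G\<in>Collect good. \<forall>G'\<in>Collect good. G \<subseteq> G' \<longrightarrow> G' = G"
  proof (rule subset_Zorn_nonempty)
    show "Collect good \<noteq> {}" using good0 by auto
    fix C assume C: "C \<noteq> {}" "subset.chain (Collect good) C"
    then have Cg: "good G" if "G \<in> C" for G
      using that by (auto simp: subset.chain_def)
    have cmp: "G \<subseteq> G' \<or> G' \<subseteq> G" if "G \<in> C" "G' \<in> C" for G G'
      using C(2) that by (auto simp: subset_chain_def)
    have "\<forall>x y x' y'. (x, y) \<in> \<Union>C \<and> (x', y') \<in> \<Union>C \<longrightarrow> (x \<oplus>\<^bsub>B\<^esub> x', y \<oplus>\<^bsub>Q\<^esub> y') \<in> \<Union>C"
    proof (intro allI impI)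
      fix x y x' y' assume "(x, y) \<in> \<Union>C \<and> (x', y') \<in> \<Union>C"
      then obtain G G' where G: "G \<in> C" "(x, y) \<in> G" "G' \<in> C" "(x', y') \<in> G'" by auto
      then obtain H where H: "H \<in> C" "(x, y) \<in> H" "(x', y') \<in> H" using cmp[of G G'] by blast
      then have "(x \<oplus>\<^bsub>B\<^esub> x', y \<oplus>\<^bsub>Q\<^esub> y') \<in> H" using Cg[of H] unfolding good_def by blast
      then show "(x \<oplus>\<^bsub>B\<^esub> x', y \<oplus>\<^bsub>Q\<^esub> y') \<in> \<Union>C" using H by auto
    qed
    moreover have "\<Union>C \<subseteq> carrier B \<times> carrier Q" using Cg unfolding good_def by blast
    moreover have "\<forall>x\<in>N. (x, g x) \<in> \<Union>C" using C(1) Cg unfolding good_def by blast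
    moreover have "\<forall>r\<in>carrier R. \<forall>x y. (x, y) \<in> \<Union>C \<longrightarrow> (r \<odot>\<^bsub>B\<^esub> x, r \<odot>\<^bsub>Q\<^esub> y) \<in> \<Union>C"
      using Cg unfolding good_def by (meson UnionE UnionI)
    moreover have "\<forall>y. (\<zero>\<^bsub>B\<^esub>, y) \<in> \<Union>C \<longrightarrow> y = \<zero>\<^bsub>Q\<^esub>" using Cg unfolding good_def by blast
    ultimately show "\<Union>C \<in> Collect good" unfolding good_def by simp
  qed
  then obtain G where G: "good G" and max: "\<And>G'. good G' \<Longrightarrow> G \<subseteq> G' \<Longrightarrow> G' = G" by auto
  have Gc: "x \<in> carrier B" "y \<in> carrier Q" if "(x, y) \<in> G" for x y
    using G that unfolding good_def by auto
  have Gadd: "(x \<oplus>\<^bsub>B\<^esub> x', y \<oplus>\<^bsub>Q\<^esub> y') \<in> G" if "(x, y) \<in> G" "(x', y') \<in> G" for x y x' y'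
    using G that unfolding good_def by blast
  have Gsm: "(r \<odot>\<^bsub>B\<^esub> x, r \<odot>\<^bsub>Q\<^esub> y) \<in> G" if "r \<in> carrier R" "(x, y) \<in> G" for r x y
    using G that unfolding good_def by blast
  have G0: "y = \<zero>\<^bsub>Q\<^esub>" if "(\<zero>\<^bsub>B\<^esub>, y) \<in> G" for y
    using G that unfolding good_def by blast
  have G00: "(\<zero>\<^bsub>B\<^esub>, \<zero>\<^bsub>Q\<^esub>) \<in> G" using G N0 g0 unfolding good_def by metis
  have Gneg: "(\<ominus>\<^bsub>B\<^esub> x, \<ominus>\<^bsub>Q\<^esub> y) \<in> G" if "(x, y) \<in> G" for x y
    using Gsm[of "\<ominus>\<^bsub>R\<^esub> \<one>\<^bsub>R\<^esub>" x y] Gc[OF that] that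
    by (simp add: B.smult_l_minus Q.smult_l_minus)
  have Gfun: "y = y'" if "(x, y) \<in> G" "(x, y') \<in> G" for x y y'
  proof -
    have "(x \<oplus>\<^bsub>B\<^esub> \<ominus>\<^bsub>B\<^esub> x, y \<oplus>\<^bsub>Q\<^esub> \<ominus>\<^bsub>Q\<^esub> y') \<in> G" using Gadd Gneg that by blast
    then have "y \<oplus>\<^bsub>Q\<^esub> \<ominus>\<^bsub>Q\<^esub> y' = \<zero>\<^bsub>Q\<^esub>" using Gc[OF that(1)] by (auto simp: B.M.r_neg intro: G0)
    then show ?thesis using Gc that by (metis Q.M.minus_equality Q.M.minus_minus Q.M.a_inv_closed)
  qed
  have dom: "\<exists>y. (b, y) \<in> G" if b: "b \<in> carrier B" for b
  proof -
    define J where "J = {r \<in> carrier R. \<exists>y. (r \<odot>\<^bsub>B\<^esub> b, y) \<in> G}"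
    define \<phi> where "\<phi> r = (THE y. (r \<odot>\<^bsub>B\<^esub> b, y) \<in> G)" for r
    have phiG: "\<phi> r = y" if "(r \<odot>\<^bsub>B\<^esub> b, y) \<in> G" for r y
      unfolding \<phi>_def using that Gfun by blast
    have phi: "(r \<odot>\<^bsub>B\<^esub> b, \<phi> r) \<in> G" if "r \<in> J" for r
      using that phiG unfolding J_def by auto
    interpret RR: module R "regular_module R" by (rule regular_module) (rule B.R.is_cring)
    have Jadd: "(r \<oplus>\<^bsub>R\<^esub> s) \<odot>\<^bsub>B\<^esub> b = r \<odot>\<^bsub>B\<^esub> b \<oplus>\<^bsub>B\<^esub> s \<odot>\<^bsub>B\<^esub> b" if "r \<in> J" "s \<in> J" for r s
      using that b unfolding J_def by (simp add: B.smult_l_distr)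
    have Jsm: "(r \<otimes>\<^bsub>R\<^esub> s) \<odot>\<^bsub>B\<^esub> b = r \<odot>\<^bsub>B\<^esub> (s \<odot>\<^bsub>B\<^esub> b)" if "r \<in> carrier R" "s \<in> J" for r s
      using that b unfolding J_def by (simp add: B.smult_assoc1)
    have aJ: "r \<oplus>\<^bsub>R\<^esub> s \<in> J" "\<phi> (r \<oplus>\<^bsub>R\<^esub> s) = \<phi> r \<oplus>\<^bsub>Q\<^esub> \<phi> s" if "r \<in> J" "s \<in> J" for r s
    proof -
      have *: "((r \<oplus>\<^bsub>R\<^esub> s) \<odot>\<^bsub>B\<^esub> b, \<phi> r \<oplus>\<^bsub>Q\<^esub> \<phi> s) \<in> G"
        using Gadd[OF phi phi, OF that] Jadd[OF that] by simp
      show "r \<oplus>\<^bsub>R\<^esub> s \<in> J" using * that unfolding J_def by auto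
      show "\<phi> (r \<oplus>\<^bsub>R\<^esub> s) = \<phi> r \<oplus>\<^bsub>Q\<^esub> \<phi> s" using phiG[OF *] .
    qed
    have sJ: "r \<otimes>\<^bsub>R\<^esub> s \<in> J" "\<phi> (r \<otimes>\<^bsub>R\<^esub> s) = r \<odot>\<^bsub>Q\<^esub> \<phi> s" if "r \<in> carrier R" "s \<in> J" for r s
    proof -
      have *: "((r \<otimes>\<^bsub>R\<^esub> s) \<odot>\<^bsub>B\<^esub> b, r \<odot>\<^bsub>Q\<^esub> \<phi> s) \<in> G"
        using Gsm[OF that(1) phi[OF that(2)]] Jsm[OF that] by simp
      show "r \<otimes>\<^bsub>R\<^esub> s \<in> J" using * that unfolding J_def by auto
      show "\<phi> (r \<otimes>\<^bsub>R\<^esub> s) = r \<odot>\<^bsub>Q\<^esub> \<phi> s" using phiG[OF *] .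
    qed
    have J0: "\<zero>\<^bsub>R\<^esub> \<in> J" using G00 b unfolding J_def by auto
    have sub: "submodule J R (regular_module R)"
    proof (rule RR.module_incl_imp_submodule)
      show Jc: "J \<subseteq> carrier (regular_module R)" unfolding J_def regular_module_def by auto
      have inv: "\<exists>s\<in>J. s \<oplus>\<^bsub>R\<^esub> r = \<zero>\<^bsub>R\<^esub>" if "r \<in> J" for r
      proof
        have rc: "r \<in> carrier R" using that unfolding J_def by auto
        show "(\<ominus>\<^bsub>R\<^esub> \<one>\<^bsub>R\<^esub>) \<otimes>\<^bsub>R\<^esub> r \<oplus>\<^bsub>R\<^esub> r = \<zero>\<^bsub>R\<^esub>" using rc by (simp add: B.R.l_minus B.R.l_neg)
        show "(\<ominus>\<^bsub>R\<^esub> \<one>\<^bsub>R\<^esub>) \<otimes>\<^bsub>R\<^esub> r \<in> J" using sJ(1) that by simp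
      qed
      have Jc': "J \<subseteq> carrier R" unfolding J_def by auto
      have ag: "abelian_group ((regular_module R)\<lparr>carrier := J\<rparr>)"
        by (rule abelian_groupI)
           (use J0 aJ inv Jc' in \<open>auto simp: regular_module_def B.R.a_ac subset_iff\<close>)
      show "module R ((regular_module R)\<lparr>carrier := J\<rparr>)"
        by (intro moduleI B.R.is_cring ag)
           (use Jc' sJ in \<open>auto simp: regular_module_def B.R.l_distr B.R.r_distr B.R.m_assoc subset_iff\<close>)
    qed
    have "\<phi> \<in> mod_hom R ((regular_module R)\<lparr>carrier := J\<rparr>) Q"
      by (rule mod_homI) (use Gc(2)[OF phi] aJ sJ in \<open>auto simp: regular_module_def\<close>)
    then obtain \<psi> where \<psi>: "\<psi> \<in> mod_hom R (regular_module R) Q" "\<And>r. r \<in> J \<Longrightarrow> \<psi> r = \<phi> r"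
      using inj RR.module_axioms sub unfolding injective_module_def by metis
    define e where "e = \<psi> \<one>\<^bsub>R\<^esub>"
    have e: "e \<in> carrier Q"
      using mod_homD(1)[OF \<psi>(1), of "\<one>\<^bsub>R\<^esub>"] by (simp add: e_def regular_module_def)
    have psi: "\<psi> r = r \<odot>\<^bsub>Q\<^esub> e" if "r \<in> carrier R" for r
      using mod_homD(3)[OF \<psi>(1), of r "\<one>\<^bsub>R\<^esub>"] that by (simp add: e_def regular_module_def)
    define G' where "G' = {(x \<oplus>\<^bsub>B\<^esub> r \<odot>\<^bsub>B\<^esub> b, y \<oplus>\<^bsub>Q\<^esub> r \<odot>\<^bsub>Q\<^esub> e) | x y r. (x, y) \<in> G \<and> r \<in> carrier R}"
    have G'I: "(x \<oplus>\<^bsub>B\<^esub> r \<odot>\<^bsub>B\<^esub> b, y \<oplus>\<^bsub>Q\<^esub> r \<odot>\<^bsub>Q\<^esub> e) \<in> G'"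
      if "(x, y) \<in> G" "r \<in> carrier R" for x y r
      using that unfolding G'_def by auto
    have GG': "G \<subseteq> G'"
    proof
      fix p assume p: "p \<in> G"
      obtain x y where xy: "p = (x, y)" by (cases p)
      show "p \<in> G'" using G'I[of x y "\<zero>\<^bsub>R\<^esub>"] p xy Gc[of x y] b e by simp
    qed
    have "good G'" unfolding good_def
    proof (intro conjI allI impI ballI)
      show "G' \<subseteq> carrier B \<times> carrier Q" using Gc b e unfolding G'_def by auto
      show "(x, g x) \<in> G'" if "x \<in> N" for x using that G GG' unfolding good_def by blast
      show "(x \<oplus>\<^bsub>B\<^esub> x', y \<oplus>\<^bsub>Q\<^esub> y') \<in> G'" if asm: "(x, y) \<in> G' \<and> (x', y') \<in> G'" for x y x' y'
      proof -
        obtain u v r u' v' r' where uv: "(u, v) \<in> G" "r \<in> carrier R" "x = u \<oplus>\<^bsub>B\<^esub> r \<odot>\<^bsub>B\<^esub> b"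
          "y = v \<oplus>\<^bsub>Q\<^esub> r \<odot>\<^bsub>Q\<^esub> e" "(u', v') \<in> G" "r' \<in> carrier R" "x' = u' \<oplus>\<^bsub>B\<^esub> r' \<odot>\<^bsub>B\<^esub> b"
          "y' = v' \<oplus>\<^bsub>Q\<^esub> r' \<odot>\<^bsub>Q\<^esub> e" using asm unfolding G'_def by auto
        have "x \<oplus>\<^bsub>B\<^esub> x' = (u \<oplus>\<^bsub>B\<^esub> u') \<oplus>\<^bsub>B\<^esub> (r \<oplus>\<^bsub>R\<^esub> r') \<odot>\<^bsub>B\<^esub> b"
          using uv Gc b by (simp add: B.smult_l_distr B.M.a_ac)
        moreover have "y \<oplus>\<^bsub>Q\<^esub> y' = (v \<oplus>\<^bsub>Q\<^esub> v') \<oplus>\<^bsub>Q\<^esub> (r \<oplus>\<^bsub>R\<^esub> r') \<odot>\<^bsub>Q\<^esub> e"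
          using uv Gc e by (simp add: Q.smult_l_distr Q.M.a_ac)
        moreover have "r \<oplus>\<^bsub>R\<^esub> r' \<in> carrier R" using uv by simp
        ultimately show ?thesis using G'I[OF Gadd[OF uv(1,5)]] by simp
      qed
      show "(s \<odot>\<^bsub>B\<^esub> x, s \<odot>\<^bsub>Q\<^esub> y) \<in> G'" if s: "s \<in> carrier R" and xy: "(x, y) \<in> G'" for s x y
      proof -
        obtain u v r where uv: "(u, v) \<in> G" "r \<in> carrier R" "x = u \<oplus>\<^bsub>B\<^esub> r \<odot>\<^bsub>B\<^esub> b"
          "y = v \<oplus>\<^bsub>Q\<^esub> r \<odot>\<^bsub>Q\<^esub> e" using xy unfolding G'_def by auto
        have "s \<odot>\<^bsub>B\<^esub> x = s \<odot>\<^bsub>B\<^esub> u \<oplus>\<^bsub>B\<^esub> (s \<otimes>\<^bsub>R\<^esub> r) \<odot>\<^bsub>B\<^esub> b"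
          using uv s Gc b by (simp add: B.smult_r_distr B.smult_assoc1)
        moreover have "s \<odot>\<^bsub>Q\<^esub> y = s \<odot>\<^bsub>Q\<^esub> v \<oplus>\<^bsub>Q\<^esub> (s \<otimes>\<^bsub>R\<^esub> r) \<odot>\<^bsub>Q\<^esub> e"
          using uv s Gc e by (simp add: Q.smult_r_distr Q.smult_assoc1)
        moreover have "s \<otimes>\<^bsub>R\<^esub> r \<in> carrier R" using uv s by simp
        ultimately show ?thesis using G'I[OF Gsm[OF s uv(1)]] by simp
      qed
      show "y = \<zero>\<^bsub>Q\<^esub>" if y0: "(\<zero>\<^bsub>B\<^esub>, y) \<in> G'" for y
      proof -
        obtain u v r where uv: "(u, v) \<in> G" "r \<in> carrier R" "\<zero>\<^bsub>B\<^esub> = u \<oplus>\<^bsub>B\<^esub> r \<odot>\<^bsub>B\<^esub> b"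
          "y = v \<oplus>\<^bsub>Q\<^esub> r \<odot>\<^bsub>Q\<^esub> e" using y0 unfolding G'_def by blast
        have "r \<odot>\<^bsub>B\<^esub> b = \<ominus>\<^bsub>B\<^esub> u"
          using uv Gc b by (metis B.M.a_comm B.M.minus_equality B.smult_closed)
        then have rG: "(r \<odot>\<^bsub>B\<^esub> b, \<ominus>\<^bsub>Q\<^esub> v) \<in> G" using Gneg uv by metis
        then have "r \<in> J" using uv unfolding J_def by auto
        then have "r \<odot>\<^bsub>Q\<^esub> e = \<ominus>\<^bsub>Q\<^esub> v" using \<psi>(2) psi uv phiG[OF rG] by metis
        then show ?thesis using uv Gc by (simp add: Q.M.r_neg)
      qed
    qed
    then have "G' = G" using max GG' by blast
    moreover have "(\<zero>\<^bsub>B\<^esub> \<oplus>\<^bsub>B\<^esub> \<one>\<^bsub>R\<^esub> \<odot>\<^bsub>B\<^esub> b, \<zero>\<^bsub>Q\<^esub> \<oplus>\<^bsub>Q\<^esub> \<one>\<^bsub>R\<^esub> \<odot>\<^bsub>Q\<^esub> e) \<in> G'"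
      using G'I[OF G00] by simp
    ultimately show ?thesis using b by auto
  qed
  define h where "h x = (THE y. (x, y) \<in> G)" for x
  have hG: "h x = y" if "(x, y) \<in> G" for x y
    unfolding h_def using that Gfun by blast
  have h: "(x, h x) \<in> G" if "x \<in> carrier B" for x
    using dom[OF that] hG by auto
  have "h \<in> mod_hom R B Q"
  proof (rule mod_homI)
    fix x y assume xy: "x \<in> carrier B" "y \<in> carrier B"
    show "h x \<in> carrier Q" using Gc(2)[OF h[OF xy(1)]] .
    show "h (x \<oplus>\<^bsub>B\<^esub> y) = h x \<oplus>\<^bsub>Q\<^esub> h y" using hG[OF Gadd[OF h[OF xy(1)] h[OF xy(2)]]] .
  next
    fix r x assume "r \<in> carrier R" "x \<in> carrier B"
    then show "h (r \<odot>\<^bsub>B\<^esub> x) = r \<odot>\<^bsub>Q\<^esub> h x" using hG[OF Gsm[OF _ h]] by blast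
  qed
  moreover have "h x = g x" if "x \<in> N" for x
    using G that hG unfolding good_def by blast
  ultimately show ?thesis by blast
qed

end

(* The composite of the torsion functors of m_0 R and R_+ is the torsion functor of the maximal ideal
   m_0 R + R_+, so the statements concern the second page of a Grothendieck spectral sequence with
   Artinian abutment, concentrated in p <= d and q <= c. Instead of the spectral sequence, let P be the
   R_+-torsion of the resolution E. Its cohomology modules are split off one at a time from the top:
   the resolution F of the top one receives a chain map from P, and the mapping cone has the same
   cohomology except that one. After m_0 R-torsion each splitting gives a long exact sequence, and three
   splittings suffice, because the torsion of a complex with no cohomology above degree e has none
   above e + d when m_0 is the radical of an ideal with d generators (Krull, prime avoidance).
   The abutment is Artinian because the generators x of the maximal ideal can be removed one by one
   through the cone of multiplication by x, and a module on which every element is killed by a power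
   of x is Artinian as soon as its submodule killed by x is. *)

theory Submission
  imports Defs
begin

section \<open>Chain conditions between two submodules\<close>

text \<open>The indices come from the differentials of that second page. In the strip p <= d, q <= c
  no differential touches the entries (d, c) and (d-1, c). The entries (d-2, c) and (d, c-1) are
  joined by d_2 to each other and to nothing else. The other statements concern d_2 : (d-3, c) ->
  (d-1, c-1), d_2 : (d-2, c-1) -> (d, c-2) and d_3 : (d-3, c) -> (d, c-2). Artinian modules are
  closed under submodules, quotients and extensions, so long exact sequences compare these entries
  up to Artinian modules and no differential has to be constructed. Two obstacles shape the
  encoding. Quotients change the type of a module, so chain conditions are stated for pairs of
  submodules inside the modules of a complex. Cones change it as well: this is harmless for three
  splittings, but the induction over the generators of the maximal ideal needs one fixed type, hence
  the encoded pairs and the passage to sequences.\<close>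

lemma submodule_memD:
  assumes "submodule H R V"
  shows "H \<subseteq> carrier V" "x \<in> H \<Longrightarrow> x \<in> carrier V" "\<zero>\<^bsub>V\<^esub> \<in> H"
    "x \<in> H \<Longrightarrow> y \<in> H \<Longrightarrow> x \<oplus>\<^bsub>V\<^esub> y \<in> H" "a \<in> carrier R \<Longrightarrow> x \<in> H \<Longrightarrow> a \<odot>\<^bsub>V\<^esub> x \<in> H"
    "x \<in> H \<Longrightarrow> \<ominus>\<^bsub>V\<^esub> x \<in> H"
proof -
  interpret submodule H R V by fact
  show "H \<subseteq> carrier V" "x \<in> H \<Longrightarrow> x \<in> carrier V" "\<zero>\<^bsub>V\<^esub> \<in> H"
    "x \<in> H \<Longrightarrow> y \<in> H \<Longrightarrow> x \<oplus>\<^bsub>V\<^esub> y \<in> H" "a \<in> carrier R \<Longrightarrow> x \<in> H \<Longrightarrow> a \<odot>\<^bsub>V\<^esub> x \<in> H"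
    "x \<in> H \<Longrightarrow> \<ominus>\<^bsub>V\<^esub> x \<in> H"
    using subset one_closed m_closed m_inv_closed by (auto simp: a_inv_def)
qed

context module
begin

lemma submodule_minusD:
  assumes "submodule H R M" "x \<in> H" "y \<in> H"
  shows "x \<ominus>\<^bsub>M\<^esub> y \<in> H"
  using submodule_memD[OF assms(1)] assms by (simp add: a_minus_def)

lemma neg_one_smult: "x \<in> carrier M \<Longrightarrow> (\<ominus> \<one>) \<odot>\<^bsub>M\<^esub> x = \<ominus>\<^bsub>M\<^esub> x"
  by (simp add: smult_l_minus)

lemma submoduleI':
  assumes "H \<subseteq> carrier M" "\<zero>\<^bsub>M\<^esub> \<in> H"
    and "\<And>a b. \<lbrakk>a \<in> H; b \<in> H\<rbrakk> \<Longrightarrow> a \<oplus>\<^bsub>M\<^esub> b \<in> H"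
    and "\<And>a x. \<lbrakk>a \<in> carrier R; x \<in> H\<rbrakk> \<Longrightarrow> a \<odot>\<^bsub>M\<^esub> x \<in> H"
  shows "submodule H R M"
proof (rule submoduleI)
  fix a assume "a \<in> H"
  then show "\<ominus>\<^bsub>M\<^esub> a \<in> H" using assms(4)[of "\<ominus> \<one>" a] assms(1) neg_one_smult by auto
qed (use assms in auto)

lemma zero_submodule: "submodule {\<zero>\<^bsub>M\<^esub>} R M"
  by (rule submoduleI') auto

end

lemma mod_hom_zero:
  assumes "module R V" "module R Y" "f \<in> mod_hom R V Y"
  shows "f \<zero>\<^bsub>V\<^esub> = \<zero>\<^bsub>Y\<^esub>"
proof -
  interpret V: module R V by fact
  interpret Y: module R Y by fact
  have "f (\<zero>\<^bsub>R\<^esub> \<odot>\<^bsub>V\<^esub> \<zero>\<^bsub>V\<^esub>) = \<zero>\<^bsub>R\<^esub> \<odot>\<^bsub>Y\<^esub> f \<zero>\<^bsub>V\<^esub>" by (rule mod_homD(3)[OF assms(3)]) auto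
  then show ?thesis using mod_homD(1)[OF assms(3)] by simp
qed

lemma mod_hom_minus:
  assumes "module R V" "module R Y" "f \<in> mod_hom R V Y" "x \<in> carrier V"
  shows "f (\<ominus>\<^bsub>V\<^esub> x) = \<ominus>\<^bsub>Y\<^esub> f x"
proof -
  interpret V: module R V by fact
  interpret Y: module R Y by fact
  have "f ((\<ominus>\<^bsub>R\<^esub> \<one>\<^bsub>R\<^esub>) \<odot>\<^bsub>V\<^esub> x) = (\<ominus>\<^bsub>R\<^esub> \<one>\<^bsub>R\<^esub>) \<odot>\<^bsub>Y\<^esub> f x"
    by (rule mod_homD(3)[OF assms(3)]) (use assms in auto)
  then show ?thesis using mod_homD(1)[OF assms(3)] assms(4)
    by (simp add: V.neg_one_smult Y.neg_one_smult)
qed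

lemma mod_hom_diff:
  assumes "module R V" "module R Y" "f \<in> mod_hom R V Y" "x \<in> carrier V" "y \<in> carrier V"
  shows "f (x \<ominus>\<^bsub>V\<^esub> y) = f x \<ominus>\<^bsub>Y\<^esub> f y"
proof -
  interpret V: module R V by fact
  show ?thesis using assms mod_homD(2)[OF assms(3)] mod_hom_minus[OF assms(1-3)]
    by (simp add: a_minus_def)
qed

text \<open>By the correspondence theorem these stand for the submodules of Z / B, so that chain
  conditions on cohomology can be tested inside the modules of the complex.\<close>

definition submodules_between :: "('a, 'r) ring_scheme \<Rightarrow> ('a, 'm, 'k) module_scheme \<Rightarrow> 'm set \<Rightarrow> 'm set \<Rightarrow> 'm set set"
  where "submodules_between R V B Z = {N. submodule N R V \<and> B \<subseteq> N \<and> N \<subseteq> Z}"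

text \<open>With \<open>asc\<close> this is the ascending, otherwise the descending chain condition for \<open>Z / B\<close>.\<close>

definition chain_cond :: "bool \<Rightarrow> ('a, 'r) ring_scheme \<Rightarrow> ('a, 'm, 'k) module_scheme \<Rightarrow> 'm set \<Rightarrow> 'm set \<Rightarrow> bool"
  where "chain_cond asc R V B Z \<longleftrightarrow> (\<forall>N :: nat \<Rightarrow> 'm set.
    (\<forall>i. N i \<in> submodules_between R V B Z) \<and> (\<forall>i. if asc then N i \<subseteq> N (Suc i) else N (Suc i) \<subseteq> N i)
    \<longrightarrow> (\<exists>n. \<forall>i\<ge>n. N i = N n))"

lemma chain_condD:
  assumes "chain_cond asc R V B Z" "\<And>i. N i \<in> submodules_between R V B Z"
    "\<And>i. if asc then N i \<subseteq> N (Suc i) else N (Suc i) \<subseteq> N i"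
  shows "\<exists>n. \<forall>i\<ge>n. N i = N n"
  using assms unfolding chain_cond_def by blast

lemma chain_step_mono:
  fixes N :: "nat \<Rightarrow> 'b set"
  assumes "\<And>i. if asc then N i \<subseteq> N (Suc i) else N (Suc i) \<subseteq> N i" "n \<le> i"
  shows "if asc then N n \<subseteq> N i else N i \<subseteq> N n"
  using assms lift_Suc_mono_le[of N n i] lift_Suc_antimono_le[of N n i] by (auto split: if_splits)

lemma chain_cond_trivial: "Z \<subseteq> B \<Longrightarrow> chain_cond asc R V B Z"
  unfolding chain_cond_def submodules_between_def by blast

text \<open>Of two comparable members of the chain, both are equal once they have the same preimage
  in \<open>Z1\<close> and the same image in \<open>Z3\<close> modulo \<open>B3\<close>; both traces
  become stationary. The condition \<open>ex\<close> is exactness at the middle of Z1/B1 -> Z2/B2 ->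
  Z3/B3, so every stretch of a long exact sequence qualifies.\<close>

lemma chain_cond_exact:
  assumes X1: "module R X1" and X2: "module R X2" and X3: "module R X3"
    and f: "f \<in> mod_hom R X1 X2" and g: "g \<in> mod_hom R X2 X3"
    and Z1: "submodule Z1 R X1" and Z3: "submodule Z3 R X3" and B3: "submodule B3 R X3"
    and BZ: "B1 \<subseteq> Z1" "B3 \<subseteq> Z3" and fB: "\<And>x. x \<in> B1 \<Longrightarrow> f x \<in> B2" and gZ: "\<And>z. z \<in> Z2 \<Longrightarrow> g z \<in> Z3"
    and ex: "\<And>z. z \<in> Z2 \<Longrightarrow> z \<in> carrier X2 \<Longrightarrow> g z \<in> B3 \<Longrightarrow> \<exists>y\<in>Z1. \<exists>b\<in>B2. z = f y \<oplus>\<^bsub>X2\<^esub> b"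
    and c1: "chain_cond asc R X1 B1 Z1" and c3: "chain_cond asc R X3 B3 Z3"
  shows "chain_cond asc R X2 B2 Z2"
  unfolding chain_cond_def
proof (intro allI impI)
  interpret X1: module R X1 by fact
  interpret X2: module R X2 by fact
  interpret X3: module R X3 by fact
  note fD = mod_homD[OF f] and gD = mod_homD[OF g]
  note f0 = mod_hom_zero[OF X1 X2 f] and g0 = mod_hom_zero[OF X2 X3 g]
  fix N assume N: "(\<forall>i. N i \<in> submodules_between R X2 B2 Z2) \<and> (\<forall>i. if asc then N i \<subseteq> N (Suc i) else N (Suc i) \<subseteq> N i)"
  then have Ns: "submodule (N i) R X2" and NB: "B2 \<subseteq> N i" and NZ: "N i \<subseteq> Z2"
    and Nc: "if asc then N i \<subseteq> N (Suc i) else N (Suc i) \<subseteq> N i" for i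
    unfolding submodules_between_def by auto
  note ND = submodule_memD[OF Ns]
  define K where "K i = {y \<in> Z1. f y \<in> N i}" for i
  define L where "L i = {g z \<oplus>\<^bsub>X3\<^esub> b | z b. z \<in> N i \<and> b \<in> B3}" for i
  have "K i \<in> submodules_between R X1 B1 Z1" for i
  proof -
    have "submodule (K i) R X1"
      unfolding K_def by (rule X1.submoduleI')
        (use submodule_memD[OF Z1] ND fD f0 in \<open>auto\<close>)
    then show ?thesis using fB NB BZ unfolding submodules_between_def K_def by blast
  qed
  moreover have "if asc then K i \<subseteq> K (Suc i) else K (Suc i) \<subseteq> K i" for i
    using Nc[of i] unfolding K_def by (auto split: if_splits)
  ultimately obtain n1 where n1: "\<And>i. i \<ge> n1 \<Longrightarrow> K i = K n1"
    using chain_condD[OF c1, of K] by blast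
  have LI: "g z \<oplus>\<^bsub>X3\<^esub> b \<in> L i" if "z \<in> N i" "b \<in> B3" for z b i using that unfolding L_def by blast
  have "L i \<in> submodules_between R X3 B3 Z3" for i
  proof -
    have "submodule (L i) R X3"
    proof (rule X3.submoduleI')
      show "L i \<subseteq> carrier X3" using ND gD submodule_memD[OF B3] unfolding L_def by auto
      show "\<zero>\<^bsub>X3\<^esub> \<in> L i" using LI[OF ND(3) submodule_memD(3)[OF B3]] g0 by simp
    next
      fix a b assume "a \<in> L i" "b \<in> L i"
      then obtain z b1 z' b1' where *: "z \<in> N i" "b1 \<in> B3" "z' \<in> N i" "b1' \<in> B3"
        "a = g z \<oplus>\<^bsub>X3\<^esub> b1" "b = g z' \<oplus>\<^bsub>X3\<^esub> b1'" unfolding L_def by blast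
      then have "a \<oplus>\<^bsub>X3\<^esub> b = g (z \<oplus>\<^bsub>X2\<^esub> z') \<oplus>\<^bsub>X3\<^esub> (b1 \<oplus>\<^bsub>X3\<^esub> b1')"
        using ND gD submodule_memD[OF B3] by (simp add: X3.M.a_ac)
      then show "a \<oplus>\<^bsub>X3\<^esub> b \<in> L i" using LI * ND submodule_memD[OF B3] by simp
    next
      fix a x assume a: "a \<in> carrier R" and "x \<in> L i"
      then obtain z b1 where *: "z \<in> N i" "b1 \<in> B3" "x = g z \<oplus>\<^bsub>X3\<^esub> b1" unfolding L_def by blast
      then have "a \<odot>\<^bsub>X3\<^esub> x = g (a \<odot>\<^bsub>X2\<^esub> z) \<oplus>\<^bsub>X3\<^esub> (a \<odot>\<^bsub>X3\<^esub> b1)"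
        using ND gD submodule_memD[OF B3] a by (simp add: X3.smult_r_distr)
      then show "a \<odot>\<^bsub>X3\<^esub> x \<in> L i" using LI * ND submodule_memD[OF B3] a by simp
    qed
    moreover have "B3 \<subseteq> L i" using LI[OF ND(3)] g0 submodule_memD[OF B3] by force
    moreover have "L i \<subseteq> Z3" using NZ gZ BZ submodule_memD[OF Z3] unfolding L_def by blast
    ultimately show ?thesis unfolding submodules_between_def by blast
  qed
  moreover have "if asc then L i \<subseteq> L (Suc i) else L (Suc i) \<subseteq> L i" for i
    using Nc[of i] unfolding L_def by (auto split: if_splits)
  ultimately obtain n2 where n2: "\<And>i. i \<ge> n2 \<Longrightarrow> L i = L n2"
    using chain_condD[OF c3, of L] by blast
  \<comment> \<open>Modular law for two comparable members, valid for ascending and descending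
    chains alike: z in the larger one differs from some w in the smaller one by an element that
    \<open>g\<close> sends into \<open>B3\<close>. By \<open>ex\<close> that element is f y up to
    \<open>B2\<close>, and y lies in the common preimage.\<close>
  have key: "N j \<subseteq> N i" if ij: "N i \<subseteq> N j" "K i = K j" "L i = L j" for i j
  proof
    fix z assume z: "z \<in> N j"
    have "g z \<in> L j" using LI[OF z submodule_memD(3)[OF B3]] gD ND z by simp
    then have "g z \<in> L i" using ij by simp
    then obtain w b where w: "w \<in> N i" "b \<in> B3" "g z = g w \<oplus>\<^bsub>X3\<^esub> b" unfolding L_def by blast
    have c: "z \<in> carrier X2" "w \<in> carrier X2" "b \<in> carrier X3" using z w ND submodule_memD[OF B3] by auto
    have zw: "z \<ominus>\<^bsub>X2\<^esub> w \<in> N j" using X2.submodule_minusD[OF Ns z] w ij by blast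
    have "g (z \<ominus>\<^bsub>X2\<^esub> w) = b"
      using mod_hom_diff[OF X2 X3 g c(1,2)] w(3) gD c by (simp add: X3.M.minus_eq X3.M.a_ac X3.M.r_neg)
    then obtain y b' where y: "y \<in> Z1" "b' \<in> B2" "z \<ominus>\<^bsub>X2\<^esub> w = f y \<oplus>\<^bsub>X2\<^esub> b'"
      using ex[of "z \<ominus>\<^bsub>X2\<^esub> w"] zw NZ w(2) ND by blast
    have b': "b' \<in> N i" "b' \<in> N j" using y NB by auto
    have fy: "f y \<in> carrier X2" using fD y submodule_memD[OF Z1] by blast
    have "f y = (z \<ominus>\<^bsub>X2\<^esub> w) \<ominus>\<^bsub>X2\<^esub> b'" using y(3) fy ND(2)[OF b'(1)]
      by (simp add: X2.M.minus_eq X2.M.a_assoc X2.M.r_neg)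
    then have "f y \<in> N j" using X2.submodule_minusD[OF Ns zw b'(2)] by simp
    then have "f y \<in> N i" using y(1) ij(2) unfolding K_def by blast
    then have "z \<ominus>\<^bsub>X2\<^esub> w \<in> N i" using y b' ND by simp
    then have "(z \<ominus>\<^bsub>X2\<^esub> w) \<oplus>\<^bsub>X2\<^esub> w \<in> N i" using w ND by simp
    then show "z \<in> N i" using c by (simp add: X2.M.minus_eq X2.M.a_assoc X2.M.l_neg)
  qed
  show "\<exists>n. \<forall>i\<ge>n. N i = N n"
  proof (intro exI allI impI)
    fix i assume i: "i \<ge> max n1 n2"
    then have "K i = K (max n1 n2)" "L i = L (max n1 n2)" using n1 n2 by (metis max.bounded_iff order_refl)+
    then show "N i = N (max n1 n2)"
      using key[of i "max n1 n2"] key[of "max n1 n2" i] chain_step_mono[of asc N, OF Nc i] by (auto split: if_splits)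
  qed
qed

section \<open>Extensions, images and embeddings of subquotients\<close>

lemma mod_hom_id: "(\<lambda>x. x) \<in> mod_hom R V V"
  by (rule mod_homI) auto

text \<open>The exact sequence N/B -> Z/B -> Z/N with identity maps.\<close>

lemma chain_cond_trans:
  assumes "module R V" "submodule N R V" "submodule Z R V" "B \<subseteq> N" "N \<subseteq> Z"
    "chain_cond asc R V B N" "chain_cond asc R V N Z" "\<zero>\<^bsub>V\<^esub> \<in> B"
  shows "chain_cond asc R V B Z"
proof -
  interpret V: module R V by fact
  show ?thesis
  proof (rule chain_cond_exact[of R V V V "\<lambda>x. x" "\<lambda>x. x" N Z N B])
    fix z assume "z \<in> carrier V" "z \<in> N"
    then have "z = z \<oplus>\<^bsub>V\<^esub> \<zero>\<^bsub>V\<^esub>" by simp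
    then show "\<exists>y\<in>N. \<exists>b\<in>B. z = y \<oplus>\<^bsub>V\<^esub> b" using \<open>z \<in> N\<close> assms by metis
  qed (use assms mod_hom_id in auto)
qed

text \<open>The third subquotient is taken to be Z2/Z2 = 0, so exactness says that the first one
  maps onto Z2/B2.\<close>

lemma chain_cond_image:
  assumes "module R X1" "module R X2" "f \<in> mod_hom R X1 X2" "submodule Z1 R X1" "submodule Z2 R X2"
    "B1 \<subseteq> Z1" "\<And>x. x \<in> B1 \<Longrightarrow> f x \<in> B2"
    "\<And>z. z \<in> Z2 \<Longrightarrow> \<exists>y\<in>Z1. \<exists>b\<in>B2. z = f y \<oplus>\<^bsub>X2\<^esub> b"
    "chain_cond asc R X1 B1 Z1"
  shows "chain_cond asc R X2 B2 Z2"
  by (rule chain_cond_exact[of R X1 X2 X2 f "\<lambda>x. x" Z1 Z2 Z2 B1])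
    (use assms in \<open>auto intro: mod_hom_id chain_cond_trivial\<close>)

text \<open>The first subquotient is taken to be 0, so exactness says that Z2/B2 embeds into
  Z3/B3.\<close>

lemma chain_cond_inj:
  assumes X2: "module R X2" and "module R X3" "g \<in> mod_hom R X2 X3" "submodule Z3 R X3" "submodule B3 R X3"
    "B3 \<subseteq> Z3" "\<And>z. z \<in> Z2 \<Longrightarrow> g z \<in> Z3"
    "\<And>z. z \<in> Z2 \<Longrightarrow> z \<in> carrier X2 \<Longrightarrow> g z \<in> B3 \<Longrightarrow> z \<in> B2"
    "chain_cond asc R X3 B3 Z3" "\<zero>\<^bsub>X2\<^esub> \<in> B2"
  shows "chain_cond asc R X2 B2 Z2"
proof -
  interpret X2: module R X2 by fact
  show ?thesis
  proof (rule chain_cond_exact[of R X2 X2 X3 "\<lambda>x. x" g "{\<zero>\<^bsub>X2\<^esub>}" Z3 B3 "{\<zero>\<^bsub>X2\<^esub>}"])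
    fix z assume z: "z \<in> Z2" "z \<in> carrier X2" "g z \<in> B3"
    then have "z = \<zero>\<^bsub>X2\<^esub> \<oplus>\<^bsub>X2\<^esub> z" by simp
    then show "\<exists>y\<in>{\<zero>\<^bsub>X2\<^esub>}. \<exists>b\<in>B2. z = y \<oplus>\<^bsub>X2\<^esub> b" using z assms(8) by blast
  qed (use assms X2.zero_submodule in \<open>auto intro: mod_hom_id chain_cond_trivial\<close>)
qed

lemma chain_cond_maximal:
  assumes cc: "chain_cond True R V B Z" and N0: "N0 \<in> submodules_between R V B Z" "Q N0"
  shows "\<exists>N \<in> submodules_between R V B Z. Q N \<and> (\<forall>N' \<in> submodules_between R V B Z. Q N' \<longrightarrow> N \<subseteq> N' \<longrightarrow> N' = N)"
proof (rule ccontr)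
  assume "\<not> ?thesis"
  then have "\<And>N. N \<in> submodules_between R V B Z \<and> Q N \<Longrightarrow>
    \<exists>N'. (N' \<in> submodules_between R V B Z \<and> Q N') \<and> N \<subset> N'" by blast
  then have "\<exists>f. \<forall>n::nat. (f n \<in> submodules_between R V B Z \<and> Q (f n)) \<and> f n \<subset> f (Suc n)"
    using N0 dependent_nat_choice[of "\<lambda>n N. N \<in> submodules_between R V B Z \<and> Q N" "\<lambda>n N N'. N \<subset> N'"] by blast
  then obtain f :: "nat \<Rightarrow> 'c set" where f: "\<And>n. f n \<in> submodules_between R V B Z" "\<And>n. f n \<subset> f (Suc n)" by blast
  then obtain n where "\<forall>i\<ge>n. f i = f n" using chain_condD[OF cc, of f] by auto
  then show False using f(2)[of n] by (metis le_SucI less_irrefl order_refl)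
qed

section \<open>Chain conditions for Noetherian rings and their modules\<close>

lemma submodule_regular_module_iff:
  fixes R (structure)
  assumes "cring R"
  shows "submodule I R (regular_module R) \<longleftrightarrow> ideal I R"
proof -
  interpret cring R by fact
  interpret RR: module R "regular_module R" by (rule regular_module) fact
  show ?thesis
  proof
    assume I: "submodule I R (regular_module R)"
    note ID = submodule_memD[OF I, unfolded regular_module_def, simplified]
    show "ideal I R"
    proof (rule idealI)
      show "ring R" by unfold_locales
      have "\<ominus> x \<in> I" if "x \<in> I" for x
        using ID(5)[of "\<ominus> \<one>" x] ID(2) that by (simp add: l_minus)
      then show "subgroup I (add_monoid R)"
        using ID by (auto simp: subgroup_def a_inv_def)
    qed (use ID(2,5) m_comm in force)+
  next
    assume I: "ideal I R"
    interpret ideal I R by fact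
    show "submodule I R (regular_module R)"
      by (rule RR.submoduleI') (auto simp: regular_module_def I_l_closed)
  qed
qed

lemma noetherian_regular_module:
  fixes R (structure)
  assumes "cring R" "noetherian_ring R"
  shows "chain_cond True R (regular_module R) {\<zero>\<^bsub>R\<^esub>} (carrier R)"
  unfolding chain_cond_def
proof (intro allI impI)
  interpret cring R by fact
  interpret noetherian_ring R by fact
  fix N assume "(\<forall>i. N i \<in> submodules_between R (regular_module R) {\<zero>} (carrier R)) \<and>
    (\<forall>i. if True then N i \<subseteq> N (Suc i) else N (Suc i) \<subseteq> N i)"
  then have id: "ideal (N i) R" and mono: "N i \<subseteq> N (Suc i)" for i
    unfolding submodules_between_def by (auto simp: submodule_regular_module_iff[OF assms(1)])
  have le: "N i \<subseteq> N j" if "i \<le> j" for i j using mono that by (rule lift_Suc_mono_le)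
  then have "subset.chain {I. ideal I R} (range N)"
    using id unfolding subset_chain_def by (auto, meson nat_le_linear subsetD)
  then have "\<Union>(range N) \<in> range N" using ideal_chain_is_trivial by blast
  then obtain n where "\<Union>(range N) = N n" by auto
  then have "N i = N n" if "n \<le> i" for i using le[OF that] by blast
  then show "\<exists>n. \<forall>i\<ge>n. N i = N n" by blast
qed

context module
begin

lemma minus_zero_right [simp]: "x \<in> carrier M \<Longrightarrow> x \<ominus>\<^bsub>M\<^esub> \<zero>\<^bsub>M\<^esub> = x"
  using M.minus_equality[of "\<zero>\<^bsub>M\<^esub>" "\<zero>\<^bsub>M\<^esub>"] by (simp add: M.minus_eq)

lemma minus_self [simp]: "x \<in> carrier M \<Longrightarrow> x \<ominus>\<^bsub>M\<^esub> x = \<zero>\<^bsub>M\<^esub>"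
  by (simp add: M.minus_eq M.r_neg)

lemma minus_eq_zero_iff:
  assumes "x \<in> carrier M" "y \<in> carrier M"
  shows "x \<ominus>\<^bsub>M\<^esub> y = \<zero>\<^bsub>M\<^esub> \<longleftrightarrow> x = y"
proof
  assume "x \<ominus>\<^bsub>M\<^esub> y = \<zero>\<^bsub>M\<^esub>"
  then have "(x \<ominus>\<^bsub>M\<^esub> y) \<oplus>\<^bsub>M\<^esub> y = y" using assms by simp
  then show "x = y" using assms by (simp add: M.minus_eq M.a_assoc M.l_neg)
qed (use assms in simp)

definition line_sum :: "'c set \<Rightarrow> 'c \<Rightarrow> 'c set" where
  "line_sum N v = {n \<oplus>\<^bsub>M\<^esub> r \<odot>\<^bsub>M\<^esub> v | n r. n \<in> N \<and> r \<in> carrier R}"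

lemma line_sum:
  assumes N: "submodule N R M" and v: "v \<in> carrier M"
  shows "submodule (line_sum N v) R M" "N \<subseteq> line_sum N v" "v \<in> line_sum N v"
    "submodule L R M \<Longrightarrow> N \<subseteq> L \<Longrightarrow> v \<in> L \<Longrightarrow> line_sum N v \<subseteq> L"
proof -
  note ND = submodule_memD[OF N]
  have I: "n \<oplus>\<^bsub>M\<^esub> r \<odot>\<^bsub>M\<^esub> v \<in> line_sum N v" if "n \<in> N" "r \<in> carrier R" for n r
    using that unfolding line_sum_def by blast
  show "N \<subseteq> line_sum N v"
  proof
    fix n assume "n \<in> N"
    then show "n \<in> line_sum N v" using I[of n \<zero>] v ND by simp
  qed
  show "v \<in> line_sum N v" using I[of "\<zero>\<^bsub>M\<^esub>" \<one>] v ND by simp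
  show "submodule (line_sum N v) R M"
  proof (rule submoduleI')
    show "line_sum N v \<subseteq> carrier M" using ND v unfolding line_sum_def by auto
    show "\<zero>\<^bsub>M\<^esub> \<in> line_sum N v" using I[of "\<zero>\<^bsub>M\<^esub>" \<zero>] v ND by simp
  next
    fix a b assume "a \<in> line_sum N v" "b \<in> line_sum N v"
    then obtain n r n' r' where *: "n \<in> N" "r \<in> carrier R" "a = n \<oplus>\<^bsub>M\<^esub> r \<odot>\<^bsub>M\<^esub> v"
      "n' \<in> N" "r' \<in> carrier R" "b = n' \<oplus>\<^bsub>M\<^esub> r' \<odot>\<^bsub>M\<^esub> v" unfolding line_sum_def by auto
    then have "a \<oplus>\<^bsub>M\<^esub> b = (n \<oplus>\<^bsub>M\<^esub> n') \<oplus>\<^bsub>M\<^esub> (r \<oplus> r') \<odot>\<^bsub>M\<^esub> v"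
      using ND v by (simp add: smult_l_distr M.a_ac)
    then show "a \<oplus>\<^bsub>M\<^esub> b \<in> line_sum N v" using I * ND by simp
  next
    fix a x assume a: "a \<in> carrier R" and "x \<in> line_sum N v"
    then obtain n r where *: "n \<in> N" "r \<in> carrier R" "x = n \<oplus>\<^bsub>M\<^esub> r \<odot>\<^bsub>M\<^esub> v"
      unfolding line_sum_def by auto
    then have "a \<odot>\<^bsub>M\<^esub> x = (a \<odot>\<^bsub>M\<^esub> n) \<oplus>\<^bsub>M\<^esub> (a \<otimes> r) \<odot>\<^bsub>M\<^esub> v"
      using ND v a by (simp add: smult_r_distr smult_assoc1)
    then show "a \<odot>\<^bsub>M\<^esub> x \<in> line_sum N v" using I * ND a by simp
  qed
  show "line_sum N v \<subseteq> L" if "submodule L R M" "N \<subseteq> L" "v \<in> L"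
    using submodule_memD[OF that(1)] that(2,3) unfolding line_sum_def by auto
qed

lemma smult_pow_Suc:
  "s \<in> carrier R \<Longrightarrow> x \<in> carrier M \<Longrightarrow> (s [^] Suc n) \<odot>\<^bsub>M\<^esub> x = (s [^] n) \<odot>\<^bsub>M\<^esub> (s \<odot>\<^bsub>M\<^esub> x)"
  "s \<in> carrier R \<Longrightarrow> x \<in> carrier M \<Longrightarrow> (s [^] Suc n) \<odot>\<^bsub>M\<^esub> x = s \<odot>\<^bsub>M\<^esub> ((s [^] n) \<odot>\<^bsub>M\<^esub> x)"
  by (simp_all add: smult_assoc1 [symmetric] R.m_comm)

lemma smult_comm:
  "r \<in> carrier R \<Longrightarrow> s \<in> carrier R \<Longrightarrow> x \<in> carrier M \<Longrightarrow> r \<odot>\<^bsub>M\<^esub> (s \<odot>\<^bsub>M\<^esub> x) = s \<odot>\<^bsub>M\<^esub> (r \<odot>\<^bsub>M\<^esub> x)"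
  by (simp add: smult_assoc1 [symmetric] R.m_comm)

lemma mod_hom_ev: "v \<in> carrier M \<Longrightarrow> (\<lambda>r. r \<odot>\<^bsub>M\<^esub> v) \<in> mod_hom R (regular_module R) M"
  by (rule mod_homI) (auto simp: regular_module_def smult_l_distr smult_assoc1)

lemma mod_hom_smult: "s \<in> carrier R \<Longrightarrow> (\<lambda>x. s \<odot>\<^bsub>M\<^esub> x) \<in> mod_hom R M M"
  by (rule mod_homI) (auto simp: smult_r_distr smult_comm)

lemma submodule_preimage:
  assumes "f \<in> mod_hom R M V" "module R V" "submodule Z R M" "submodule B R V"
  shows "submodule {z \<in> Z. f z \<in> B} R M"
  by (rule submoduleI')
    (use submodule_memD[OF assms(3)] submodule_memD[OF assms(4)] mod_homD[OF assms(1)]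
      mod_hom_zero[OF module_axioms assms(2,1)] in auto)

lemma submodule_image:
  assumes "f \<in> mod_hom R M V" "module R V" "submodule Z R M"
  shows "submodule (f ` Z) R V"
proof -
  interpret V: module R V by fact
  note fD = mod_homD[OF assms(1)] and ZD = submodule_memD[OF assms(3)]
  show ?thesis
  proof (rule V.submoduleI')
    show "\<zero>\<^bsub>V\<^esub> \<in> f ` Z" using mod_hom_zero[OF module_axioms assms(2,1)] ZD by force
    show "f ` Z \<subseteq> carrier V" using fD ZD by auto
  next
    fix a b assume "a \<in> f ` Z" "b \<in> f ` Z"
    then obtain x y where "a = f x" "b = f y" "x \<in> Z" "y \<in> Z" by blast
    then show "a \<oplus>\<^bsub>V\<^esub> b \<in> f ` Z" using fD(2)[of x y] ZD(2,4) by (metis imageI)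
  next
    fix a x assume "a \<in> carrier R" "x \<in> f ` Z"
    then obtain z where z: "x = f z" "z \<in> Z" by blast
    then show "a \<odot>\<^bsub>V\<^esub> x \<in> f ` Z" using fD(3)[OF \<open>a \<in> carrier R\<close> ZD(2)[OF z(2)]]
        ZD(5)[OF \<open>a \<in> carrier R\<close> z(2)] by (metis imageI)
  qed
qed

lemma ideal_colon:
  assumes N: "submodule N R M" and v: "v \<in> carrier M"
  shows "ideal {r \<in> carrier R. r \<odot>\<^bsub>M\<^esub> v \<in> N} R"
proof -
  interpret RR: module R "regular_module R" by (rule regular_module) (rule is_cring)
  have "submodule (carrier R) R (regular_module R)"
    using RR.carrier_is_submodule by (simp add: regular_module_def)
  then show ?thesis
    using RR.submodule_preimage[OF mod_hom_ev[OF v] module_axioms _ N]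
      submodule_regular_module_iff[OF is_cring] by metis
qed

text \<open>Generators are adjoined one at a time: (N + R v) / N is an image of R, and extensions
  preserve the ascending condition.\<close>

lemma finitely_generated_noetherian:
  assumes noeth: "noetherian_ring R" and fg: "finitely_generated_module R M"
  shows "chain_cond True R M {\<zero>\<^bsub>M\<^esub>} (carrier M)"
proof -
  obtain S where S: "finite S" "S \<subseteq> carrier M" "\<And>N. submodule N R M \<Longrightarrow> S \<subseteq> N \<Longrightarrow> N = carrier M"
    using fg unfolding finitely_generated_module_def by blast
  interpret RR: module R "regular_module R" by (rule regular_module) (rule is_cring)
  have "\<exists>N. submodule N R M \<and> S \<subseteq> N \<and> chain_cond True R M {\<zero>\<^bsub>M\<^esub>} N"
    using S(1,2)
  proof (induction S rule: finite_induct)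
    case empty
    then show ?case using zero_submodule chain_cond_trivial by blast
  next
    case (insert v S)
    then obtain N where N: "submodule N R M" "S \<subseteq> N" "chain_cond True R M {\<zero>\<^bsub>M\<^esub>} N" by auto
    have v: "v \<in> carrier M" using insert by auto
    note L = line_sum[OF N(1) v]
    have "chain_cond True R M N (line_sum N v)"
    proof (rule chain_cond_image[OF RR.module_axioms module_axioms mod_hom_ev[OF v] _ L(1)
          _ _ _ noetherian_regular_module[OF is_cring noeth]])
      show "submodule (carrier R) R (regular_module R)"
        using RR.carrier_is_submodule by (simp add: regular_module_def)
      show "r \<odot>\<^bsub>M\<^esub> v \<in> N" if "r \<in> {\<zero>}" for r using that v submodule_memD[OF N(1)] by auto
      fix z assume "z \<in> line_sum N v"
      then obtain n r where "n \<in> N" "r \<in> carrier R" "z = n \<oplus>\<^bsub>M\<^esub> r \<odot>\<^bsub>M\<^esub> v" unfolding line_sum_def by auto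
      then show "\<exists>r\<in>carrier R. \<exists>n\<in>N. z = r \<odot>\<^bsub>M\<^esub> v \<oplus>\<^bsub>M\<^esub> n"
        using v submodule_memD[OF N(1)] M.a_comm by (metis smult_closed)
    qed simp
    then have "chain_cond True R M {\<zero>\<^bsub>M\<^esub>} (line_sum N v)"
      using chain_cond_trans[OF module_axioms N(1) L(1) _ L(2) N(3)] submodule_memD[OF N(1)] by simp
    then show ?case using L N(2) by blast
  qed
  then show ?thesis using S(3) by metis
qed

text \<open>Each s in turn is multiplied onto the current vector as long as the result stays outside
  \<open>N\<close>; one more factor s then leads into \<open>N\<close>. Elements treated earlier
  still lead into \<open>N\<close> because scalars commute.\<close>

lemma exists_annihilated_mod:
  assumes N: "submodule N R M" and Z: "submodule Z R M" and v0: "v0 \<in> Z" "v0 \<notin> N"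
    and S: "finite S" "S \<subseteq> carrier R"
    and tors: "\<And>s z. s \<in> S \<Longrightarrow> z \<in> Z \<Longrightarrow> \<exists>n::nat. (s [^] n) \<odot>\<^bsub>M\<^esub> z \<in> N"
  shows "\<exists>v\<in>Z. v \<notin> N \<and> (\<forall>s\<in>S. s \<odot>\<^bsub>M\<^esub> v \<in> N)"
proof -
  note ZD = submodule_memD[OF Z] and ND = submodule_memD[OF N]
  have "\<exists>v\<in>Z. v \<notin> N \<and> (\<forall>s\<in>T. s \<odot>\<^bsub>M\<^esub> v \<in> N)" if "T \<subseteq> S" for T
    using finite_subset[OF that S(1)] that
  proof (induction T rule: finite_induct)
    case empty then show ?case using v0 by auto
  next
    case (insert s T)
    then obtain v where v: "v \<in> Z" "v \<notin> N" "\<And>t. t \<in> T \<Longrightarrow> t \<odot>\<^bsub>M\<^esub> v \<in> N" by auto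
    have s: "s \<in> carrier R" "T \<subseteq> carrier R" using insert S by auto
    \<comment> \<open>Since v lies outside \<open>N\<close>, this least exponent is positive, and
      s^(k-1) v is the last multiple outside \<open>N\<close>.\<close>
    define k where "k = (LEAST k::nat. (s [^] k) \<odot>\<^bsub>M\<^esub> v \<in> N)"
    obtain n :: nat where "(s [^] n) \<odot>\<^bsub>M\<^esub> v \<in> N" using tors[of s v] insert v by blast
    then have k: "(s [^] k) \<odot>\<^bsub>M\<^esub> v \<in> N" unfolding k_def by (rule LeastI)
    have "k \<noteq> 0" using k v ZD by (metis nat_pow_0 smult_one)
    then obtain j where j: "k = Suc j" by (cases k) auto
    have "(s [^] j) \<odot>\<^bsub>M\<^esub> v \<notin> N" using not_less_Least[of j "\<lambda>k. (s [^] k) \<odot>\<^bsub>M\<^esub> v \<in> N"] j k_def by auto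
    moreover have "(s [^] j) \<odot>\<^bsub>M\<^esub> v \<in> Z" using v ZD s by simp
    moreover have "t \<odot>\<^bsub>M\<^esub> ((s [^] j) \<odot>\<^bsub>M\<^esub> v) \<in> N" if "t \<in> insert s T" for t
    proof (cases "t = s")
      case True
      then show ?thesis using k j smult_pow_Suc(2)[OF s(1), of v j] v ZD by simp
    next
      case False
      then have "(s [^] j) \<odot>\<^bsub>M\<^esub> (t \<odot>\<^bsub>M\<^esub> v) \<in> N" using v that ND s by simp
      then show ?thesis using smult_comm[of t "s [^] j" v] that False s v ZD by auto
    qed
    ultimately show ?case by blast
  qed
  then show ?thesis by blast
qed

text \<open>By the ascending condition there is a maximal \<open>N\<close> with N/B Artinian. If it
  were not \<open>Z\<close>, a vector v outside \<open>N\<close> that \<open>S\<close> sends into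
  \<open>N\<close> would yield N + R v, simple over \<open>N\<close> and hence again Artinian over
  \<open>B\<close>. The hypothesis \<open>field\<close> says that R modulo \<open>Idl S\<close> is a
  field or zero, which makes this layer simple.\<close>

lemma noetherian_torsion_artinian:
  assumes B: "submodule B R M" and Z: "submodule Z R M" and BZ: "B \<subseteq> Z" and acc: "chain_cond True R M B Z"
    and S: "finite S" "S \<subseteq> carrier R"
    and field: "\<And>r. r \<in> carrier R \<Longrightarrow> r \<in> Idl S \<or> (\<exists>u\<in>carrier R. u \<otimes> r \<ominus> \<one> \<in> Idl S)"
    and tors: "\<And>s z. s \<in> S \<Longrightarrow> z \<in> Z \<Longrightarrow> \<exists>n::nat. (s [^] n) \<odot>\<^bsub>M\<^esub> z \<in> B"
  shows "chain_cond False R M B Z"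
proof -
  have "B \<in> submodules_between R M B Z" using B BZ by (simp add: submodules_between_def)
  then obtain N where N: "N \<in> submodules_between R M B Z" "chain_cond False R M B N"
    and max: "\<And>N'. N' \<in> submodules_between R M B Z \<Longrightarrow> chain_cond False R M B N' \<Longrightarrow> N \<subseteq> N' \<Longrightarrow> N' = N"
    using chain_cond_maximal[OF acc, of B "chain_cond False R M B"] chain_cond_trivial[of B B False R M]
    by auto
  from N have Ns: "submodule N R M" "B \<subseteq> N" "N \<subseteq> Z" by (auto simp: submodules_between_def)
  note ZD = submodule_memD[OF Z] and ND = submodule_memD[OF Ns(1)]
  have "N = Z"
  proof (rule ccontr)
    assume "N \<noteq> Z"
    then obtain v0 where v0: "v0 \<in> Z" "v0 \<notin> N" using Ns by blast
    have "\<exists>n::nat. (s [^] n) \<odot>\<^bsub>M\<^esub> z \<in> N" if "s \<in> S" "z \<in> Z" for s z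
      using tors[OF that] Ns(2) by blast
    from exists_annihilated_mod[OF Ns(1) Z v0 S this]
    obtain v where v: "v \<in> Z" "v \<notin> N" "\<And>s. s \<in> S \<Longrightarrow> s \<odot>\<^bsub>M\<^esub> v \<in> N" by blast
    have vc: "v \<in> carrier M" using v ZD by simp
    note L = line_sum[OF Ns(1) vc]
    have "Idl S \<subseteq> {r \<in> carrier R. r \<odot>\<^bsub>M\<^esub> v \<in> N}"
      using ideal_colon[OF Ns(1) vc] v(3) S by (intro genideal_minimal) auto
    then have kill: "r \<odot>\<^bsub>M\<^esub> v \<in> N" if "r \<in> Idl S" for r using that by auto
    \<comment> \<open>An element of \<open>K\<close> outside \<open>N\<close> involves r v with r
      outside \<open>Idl S\<close>. Such an r is invertible modulo \<open>Idl S\<close>, and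
      \<open>Idl S\<close> sends v into \<open>N\<close>, so v itself lies in
      \<open>K\<close>.\<close>
    have simple: "K = line_sum N v" if K: "K \<in> submodules_between R M N (line_sum N v)" "K \<noteq> N" for K
    proof -
      have Ks: "submodule K R M" "N \<subseteq> K" "K \<subseteq> line_sum N v" using K by (auto simp: submodules_between_def)
      note KD = submodule_memD[OF Ks(1)]
      obtain l where l: "l \<in> K" "l \<notin> N" using K Ks by auto
      then obtain n r where nr: "n \<in> N" "r \<in> carrier R" "l = n \<oplus>\<^bsub>M\<^esub> r \<odot>\<^bsub>M\<^esub> v"
        using Ks unfolding line_sum_def by blast
      then have "r \<notin> Idl S" using kill l ND by auto
      then obtain u where u: "u \<in> carrier R" "u \<otimes> r \<ominus> \<one> \<in> Idl S" using field nr by blast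
      have "r \<odot>\<^bsub>M\<^esub> v = l \<ominus>\<^bsub>M\<^esub> n"
        using nr vc ND by (simp add: M.minus_eq M.a_ac M.r_neg M.r_neg1 M.r_neg2)
      then have "r \<odot>\<^bsub>M\<^esub> v \<in> K" using submodule_minusD[OF Ks(1) l(1), of n] nr(1) Ks(2) by (metis subsetD)
      then have ur: "(u \<otimes> r) \<odot>\<^bsub>M\<^esub> v \<in> K" using KD u nr vc by (simp add: smult_assoc1)
      have "(u \<otimes> r \<ominus> \<one>) \<odot>\<^bsub>M\<^esub> v \<in> K" using kill u Ks by auto
      then have "(u \<otimes> r) \<odot>\<^bsub>M\<^esub> v \<ominus>\<^bsub>M\<^esub> v \<in> K"
        using u nr vc by (simp add: R.minus_eq M.minus_eq smult_l_distr smult_l_minus)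
      then have "(u \<otimes> r) \<odot>\<^bsub>M\<^esub> v \<ominus>\<^bsub>M\<^esub> ((u \<otimes> r) \<odot>\<^bsub>M\<^esub> v \<ominus>\<^bsub>M\<^esub> v) \<in> K"
        using submodule_minusD[OF Ks(1) ur] by simp
      moreover have "(u \<otimes> r) \<odot>\<^bsub>M\<^esub> v \<ominus>\<^bsub>M\<^esub> ((u \<otimes> r) \<odot>\<^bsub>M\<^esub> v \<ominus>\<^bsub>M\<^esub> v) = v"
        using u nr vc by (simp add: M.minus_eq M.minus_add M.a_assoc[symmetric] M.r_neg)
      ultimately show ?thesis using L(4)[OF Ks(1,2)] Ks by auto
    qed
    have "chain_cond False R M N (line_sum N v)"
      unfolding chain_cond_def
    proof (intro allI impI)
      fix K :: "nat \<Rightarrow> 'c set"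
      assume "(\<forall>i. K i \<in> submodules_between R M N (line_sum N v)) \<and>
        (\<forall>i. if False then K i \<subseteq> K (Suc i) else K (Suc i) \<subseteq> K i)"
      then have K: "K i \<in> submodules_between R M N (line_sum N v)" and dec: "K (Suc i) \<subseteq> K i" for i by auto
      have NK: "N \<subseteq> K i" for i using K by (simp add: submodules_between_def)
      show "\<exists>n. \<forall>i\<ge>n. K i = K n"
      proof (cases "\<exists>n. K n = N")
        case True
        then obtain n where n: "K n = N" ..
        have "K i = K n" if "i \<ge> n" for i using lift_Suc_antimono_le[of K, OF dec that] NK[of i] n by blast
        then show ?thesis by blast
      next
        case False
        then have "K i = line_sum N v" for i using simple[OF K] by blast
        then show ?thesis by auto
      qed
    qed
    then have "chain_cond False R M B (line_sum N v)"
      using chain_cond_trans[OF module_axioms Ns(1) L(1) Ns(2) L(2) N(2)] submodule_memD[OF B] by simp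
    moreover have "line_sum N v \<in> submodules_between R M B Z"
      using L Ns v(1) Z by (auto simp: submodules_between_def)
    ultimately show False using max[of "line_sum N v"] L v by auto
  qed
  then show ?thesis using N by simp
qed

text \<open>Melkersson's criterion, for one ring element: the submodules \<open>L i k\<close> of the socle record the
  chain \<open>N\<close> along the filtration of \<open>Z\<close> by the kernels of the powers of \<open>x\<close>.\<close>

lemma artinian_if_socle_artinian:
  assumes x: "x \<in> carrier R" and B: "submodule B R M" and Z: "submodule Z R M" and BZ: "B \<subseteq> Z"
    and tors: "\<And>z. z \<in> Z \<Longrightarrow> \<exists>n::nat. (x [^] n) \<odot>\<^bsub>M\<^esub> z \<in> B"
    and socle: "chain_cond False R M B {z \<in> Z. x \<odot>\<^bsub>M\<^esub> z \<in> B}"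
  shows "chain_cond False R M B Z"
  unfolding chain_cond_def
proof (intro allI impI)
  fix N :: "nat \<Rightarrow> 'c set"
  assume "(\<forall>i. N i \<in> submodules_between R M B Z) \<and> (\<forall>i. if False then N i \<subseteq> N (Suc i) else N (Suc i) \<subseteq> N i)"
  then have Ns: "submodule (N i) R M" and NB: "B \<subseteq> N i" and NZ: "N i \<subseteq> Z" and dec: "N (Suc i) \<subseteq> N i" for i
    by (auto simp: submodules_between_def)
  note ZD = submodule_memD[OF Z] and BD = submodule_memD[OF B] and ND = submodule_memD[OF Ns]
  define Soc where "Soc = {z \<in> Z. x \<odot>\<^bsub>M\<^esub> z \<in> B}"
  have Soc: "submodule Soc R M" unfolding Soc_def
    by (rule submodule_preimage[OF mod_hom_smult[OF x] module_axioms Z B])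
  \<comment> \<open>This is the intersection of \<open>Soc\<close> with x^k N_i + B. Multiplication
    by x^k maps the elements of N_i killed by x^(k+1) modulo \<open>B\<close> onto it modulo
    \<open>B\<close>, and sends into \<open>B\<close> exactly those killed by x^k modulo
    \<open>B\<close>; so it is one layer of the filtration.\<close>
  define L where "L i k = {l \<in> Soc. \<exists>y\<in>N i. l \<ominus>\<^bsub>M\<^esub> (x [^] k) \<odot>\<^bsub>M\<^esub> y \<in> B}" for i and k :: nat
  have LB: "L i k \<in> submodules_between R M B Soc" for i k
  proof -
    have "submodule (L i k) R M"
    proof (rule submoduleI')
      show "L i k \<subseteq> carrier M" using submodule_memD[OF Soc] unfolding L_def by auto
      show "\<zero>\<^bsub>M\<^esub> \<in> L i k" using submodule_memD[OF Soc] ND(3)[of i] BD x unfolding L_def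
        by (auto intro!: bexI[of _ "\<zero>\<^bsub>M\<^esub>"])
    next
      fix a b assume "a \<in> L i k" "b \<in> L i k"
      then obtain y y' where *: "a \<in> Soc" "b \<in> Soc" "y \<in> N i" "y' \<in> N i"
        "a \<ominus>\<^bsub>M\<^esub> (x [^] k) \<odot>\<^bsub>M\<^esub> y \<in> B" "b \<ominus>\<^bsub>M\<^esub> (x [^] k) \<odot>\<^bsub>M\<^esub> y' \<in> B" unfolding L_def by blast
      have "(a \<oplus>\<^bsub>M\<^esub> b) \<ominus>\<^bsub>M\<^esub> (x [^] k) \<odot>\<^bsub>M\<^esub> (y \<oplus>\<^bsub>M\<^esub> y')
        = (a \<ominus>\<^bsub>M\<^esub> (x [^] k) \<odot>\<^bsub>M\<^esub> y) \<oplus>\<^bsub>M\<^esub> (b \<ominus>\<^bsub>M\<^esub> (x [^] k) \<odot>\<^bsub>M\<^esub> y')"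
        using * submodule_memD(2)[OF Soc] ND(2) x by (simp add: M.minus_eq M.a_ac M.minus_add smult_r_distr)
      then have "(a \<oplus>\<^bsub>M\<^esub> b) \<ominus>\<^bsub>M\<^esub> (x [^] k) \<odot>\<^bsub>M\<^esub> (y \<oplus>\<^bsub>M\<^esub> y') \<in> B" using BD(4) * by simp
      then show "a \<oplus>\<^bsub>M\<^esub> b \<in> L i k" using * ND(4) submodule_memD(4)[OF Soc] unfolding L_def by blast
    next
      fix r a assume r: "r \<in> carrier R" and "a \<in> L i k"
      then obtain y where *: "a \<in> Soc" "y \<in> N i" "a \<ominus>\<^bsub>M\<^esub> (x [^] k) \<odot>\<^bsub>M\<^esub> y \<in> B" unfolding L_def by blast
      have "r \<odot>\<^bsub>M\<^esub> a \<ominus>\<^bsub>M\<^esub> (x [^] k) \<odot>\<^bsub>M\<^esub> (r \<odot>\<^bsub>M\<^esub> y) = r \<odot>\<^bsub>M\<^esub> (a \<ominus>\<^bsub>M\<^esub> (x [^] k) \<odot>\<^bsub>M\<^esub> y)"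
        using * submodule_memD(2)[OF Soc] ND(2) x r smult_comm[of r "x [^] k" y]
        by (simp add: M.minus_eq smult_r_distr smult_r_minus)
      then have "r \<odot>\<^bsub>M\<^esub> a \<ominus>\<^bsub>M\<^esub> (x [^] k) \<odot>\<^bsub>M\<^esub> (r \<odot>\<^bsub>M\<^esub> y) \<in> B" using BD(5) * r by simp
      then show "r \<odot>\<^bsub>M\<^esub> a \<in> L i k" using * r ND(5) submodule_memD(5)[OF Soc] unfolding L_def by blast
    qed
    moreover have "B \<subseteq> L i k"
    proof
      fix b assume b: "b \<in> B"
      then have "b \<in> Soc" using BZ BD(5) x unfolding Soc_def by auto
      then show "b \<in> L i k" using ND(3)[of i] b BD(2) x unfolding L_def
        by (auto intro!: bexI[of _ "\<zero>\<^bsub>M\<^esub>"])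
    qed
    ultimately show ?thesis unfolding submodules_between_def L_def by blast
  qed
  have L1: "L (Suc i) k \<subseteq> L i k" for i k using dec[of i] unfolding L_def by blast
  have L2: "L i (Suc k) \<subseteq> L i k" for i k
  proof
    fix l assume "l \<in> L i (Suc k)"
    then obtain y where y: "l \<in> Soc" "y \<in> N i" "l \<ominus>\<^bsub>M\<^esub> (x [^] Suc k) \<odot>\<^bsub>M\<^esub> y \<in> B" unfolding L_def by blast
    then show "l \<in> L i k" using smult_pow_Suc(1)[OF x ND(2), of y i k] ND(5)[OF x] unfolding L_def
      by (metis (mono_tags, lifting) mem_Collect_eq)
  qed
  have L1': "L j k \<subseteq> L i k" if "i \<le> j" for i j k
    using lift_Suc_antimono_le[of "\<lambda>i. L i k", OF L1 that] .
  have L2': "L i k \<subseteq> L i j" if "j \<le> k" for i j k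
    using lift_Suc_antimono_le[of "L i", OF L2 that] .
  have stable: "\<exists>n. \<forall>i\<ge>n. f i = f n" if "\<And>i. f i \<in> submodules_between R M B Soc" "\<And>i. f (Suc i) \<subseteq> f i" for f
    using chain_condD[OF socle, of f] that unfolding Soc_def by auto
  \<comment> \<open>\<open>L\<close> decreases in both indices, so its diagonal becomes stationary
    at some n. Any \<open>L i k\<close> with both indices at least n is squeezed between two
    diagonal terms. The finitely many columns k <= n stabilise one by one, and \<open>n'\<close>
    below bounds all the indices involved.\<close>
  obtain n where n: "\<And>i. i \<ge> n \<Longrightarrow> L i i = L n n"
    using stable[of "\<lambda>i. L i i"] LB L1 L2 by (metis (full_types) subset_trans)
  have "\<forall>k. \<exists>m. \<forall>i\<ge>m. L i k = L m k" using stable[of "\<lambda>i. L i _"] LB L1 by blast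
  then obtain m where m: "\<And>k i. i \<ge> m k \<Longrightarrow> L i k = L (m k) k" by metis
  define n' where "n' = Max (insert n (m ` {..n}))"
  have n': "n \<le> n'" "k \<le> n \<Longrightarrow> m k \<le> n'" for k unfolding n'_def by (rule Max_ge; simp)+
  have const: "L i k = L n' k" if i: "i \<ge> n'" for i k
  proof (cases "k \<le> n")
    case True
    then show ?thesis using m[of k i] m[of k n'] n' i by (metis le_trans)
  next
    case False
    have "L j k = L n n" if "j \<ge> n'" for j
    proof -
      have "L (max j k) (max j k) \<subseteq> L j k" using L1'[of j "max j k"] L2'[of k "max j k"] by fastforce
      moreover have "L j k \<subseteq> L n n" using L1'[of n j n] L2'[of n k j] False that n' by force
      ultimately show ?thesis using n[of "max j k"] False by auto
    qed
    then show ?thesis using i by simp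
  qed
  show "\<exists>n. \<forall>i\<ge>n. N i = N n"
  proof (intro exI allI impI)
    fix i assume i: "n' \<le> i"
    have sub: "N i \<subseteq> N n'" using lift_Suc_antimono_le[of N, OF dec i] .
    \<comment> \<open>Induction on the power of x that takes z into \<open>B\<close>: stability of
      \<open>L\<close> replaces x^k z by x^k y with y in \<open>N i\<close>, modulo
      \<open>B\<close>, and then z - y is taken into \<open>B\<close> by a smaller power.\<close>
    have "(x [^] k) \<odot>\<^bsub>M\<^esub> z \<in> B \<longrightarrow> z \<in> N i" if "z \<in> N n'" for k :: nat and z
      using that
    proof (induction k arbitrary: z)
      case 0
      then show ?case using NB ND(2) by auto
    next
      case (Suc k)
      show ?case
      proof
        assume xz: "(x [^] Suc k) \<odot>\<^bsub>M\<^esub> z \<in> B"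
        have zc: "z \<in> carrier M" using Suc.prems ND by blast
        let ?l = "(x [^] k) \<odot>\<^bsub>M\<^esub> z"
        have "?l \<in> Soc" unfolding Soc_def
          using xz smult_pow_Suc(2)[OF x zc, of k] subsetD[OF NZ Suc.prems] ZD(5) x by auto
        then have "?l \<in> L n' k" unfolding L_def using Suc.prems zc x BD(3)
          by (auto intro!: bexI[of _ z] simp: M.r_neg M.minus_eq)
        then obtain y where y: "y \<in> N i" "?l \<ominus>\<^bsub>M\<^esub> (x [^] k) \<odot>\<^bsub>M\<^esub> y \<in> B"
          using const[OF i, of k] unfolding L_def by blast
        have yc: "y \<in> carrier M" using y ND by blast
        have zy: "z \<ominus>\<^bsub>M\<^esub> y \<in> N n'" using submodule_minusD[OF Ns Suc.prems] y sub by blast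
        have "(x [^] k) \<odot>\<^bsub>M\<^esub> (z \<ominus>\<^bsub>M\<^esub> y) \<in> B"
          using y(2) x zc yc by (simp add: M.minus_eq smult_r_distr smult_r_minus)
        then have "z \<ominus>\<^bsub>M\<^esub> y \<in> N i" using Suc.IH[OF zy] by blast
        then have "(z \<ominus>\<^bsub>M\<^esub> y) \<oplus>\<^bsub>M\<^esub> y \<in> N i" using y ND(4) by blast
        then show "z \<in> N i" using zc yc by (simp add: M.minus_eq M.a_assoc M.l_neg)
      qed
    qed
    then have "N n' \<subseteq> N i" using tors NZ by blast
    then show "N i = N n'" using sub by blast
  qed
qed

section \<open>Quotient modules\<close>

lemma coset_eq_iff:
  assumes B: "submodule B R M" and "x \<in> carrier M" "y \<in> carrier M"
  shows "B +>\<^bsub>M\<^esub> x = B +>\<^bsub>M\<^esub> y \<longleftrightarrow> x \<ominus>\<^bsub>M\<^esub> y \<in> B"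
proof -
  note BD = submodule_memD[OF B]
  show ?thesis
  proof
    assume "B +>\<^bsub>M\<^esub> x = B +>\<^bsub>M\<^esub> y"
    moreover have "x \<in> B +>\<^bsub>M\<^esub> x" using BD(3) assms by (force simp: a_r_coset_def')
    ultimately obtain b where b: "b \<in> B" "x = b \<oplus>\<^bsub>M\<^esub> y" by (auto simp: a_r_coset_def')
    then have "x \<ominus>\<^bsub>M\<^esub> y = b" using assms BD(2) by (simp add: M.minus_eq M.a_assoc M.r_neg)
    then show "x \<ominus>\<^bsub>M\<^esub> y \<in> B" using b by simp
  next
    have *: "B +>\<^bsub>M\<^esub> u \<subseteq> B +>\<^bsub>M\<^esub> v" if "u \<ominus>\<^bsub>M\<^esub> v \<in> B" "u \<in> carrier M" "v \<in> carrier M" for u v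
    proof
      fix w assume "w \<in> B +>\<^bsub>M\<^esub> u"
      then obtain b where b: "b \<in> B" "w = b \<oplus>\<^bsub>M\<^esub> u" by (auto simp: a_r_coset_def')
      have "w = (b \<oplus>\<^bsub>M\<^esub> (u \<ominus>\<^bsub>M\<^esub> v)) \<oplus>\<^bsub>M\<^esub> v"
        using b that BD(2) by (simp add: M.minus_eq M.a_assoc M.l_neg)
      then show "w \<in> B +>\<^bsub>M\<^esub> v" using BD(4)[OF b(1) that(1)] by (auto simp: a_r_coset_def')
    qed
    assume xy: "x \<ominus>\<^bsub>M\<^esub> y \<in> B"
    have "y \<ominus>\<^bsub>M\<^esub> x = \<ominus>\<^bsub>M\<^esub> (x \<ominus>\<^bsub>M\<^esub> y)" using assms by (simp add: M.minus_eq M.minus_add M.a_ac)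
    then have "y \<ominus>\<^bsub>M\<^esub> x \<in> B" using BD(6)[OF xy] by simp
    then show "B +>\<^bsub>M\<^esub> x = B +>\<^bsub>M\<^esub> y" using * assms xy by blast
  qed
qed

lemma
  assumes B: "submodule B R M"
  shows module_module_quotient: "module R (module_quotient M B)"
    and mod_hom_coset: "(\<lambda>x. B +>\<^bsub>M\<^esub> x) \<in> mod_hom R M (module_quotient M B)"
proof -
  note BD = submodule_memD[OF B]
  let ?Q = "module_quotient M B"
  have car: "carrier ?Q = (\<lambda>x. B +>\<^bsub>M\<^esub> x) ` carrier M"
    by (auto simp: module_quotient_def A_RCOSETS_def')
  have add: "(B +>\<^bsub>M\<^esub> x) \<oplus>\<^bsub>?Q\<^esub> (B +>\<^bsub>M\<^esub> y) = B +>\<^bsub>M\<^esub> (x \<oplus>\<^bsub>M\<^esub> y)" if "x \<in> carrier M" "y \<in> carrier M" for x y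
  proof -
    have 1: "(b \<oplus>\<^bsub>M\<^esub> x) \<oplus>\<^bsub>M\<^esub> (b' \<oplus>\<^bsub>M\<^esub> y) = (b \<oplus>\<^bsub>M\<^esub> b') \<oplus>\<^bsub>M\<^esub> (x \<oplus>\<^bsub>M\<^esub> y)" if "b \<in> B" "b' \<in> B" for b b'
      using that BD(2) \<open>x \<in> carrier M\<close> \<open>y \<in> carrier M\<close> by (simp add: M.a_ac)
    have 2: "b \<oplus>\<^bsub>M\<^esub> (x \<oplus>\<^bsub>M\<^esub> y) = (b \<oplus>\<^bsub>M\<^esub> x) \<oplus>\<^bsub>M\<^esub> (\<zero>\<^bsub>M\<^esub> \<oplus>\<^bsub>M\<^esub> y)" if "b \<in> B" for b
      using that BD(2) \<open>x \<in> carrier M\<close> \<open>y \<in> carrier M\<close> by (simp add: M.a_ac)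
    have "(B +>\<^bsub>M\<^esub> x) <+>\<^bsub>M\<^esub> (B +>\<^bsub>M\<^esub> y) = B +>\<^bsub>M\<^esub> (x \<oplus>\<^bsub>M\<^esub> y)" (is "?l = ?r")
    proof
      show "?l \<subseteq> ?r" using 1 BD(4) by (fastforce simp: set_add_def' a_r_coset_def')
      show "?r \<subseteq> ?l"
      proof
        fix w assume "w \<in> ?r"
        then obtain b where "b \<in> B" "w = b \<oplus>\<^bsub>M\<^esub> (x \<oplus>\<^bsub>M\<^esub> y)" by (auto simp: a_r_coset_def')
        then show "w \<in> ?l" using 2 BD(3) unfolding set_add_def' a_r_coset_def' by blast
      qed
    qed
    then show ?thesis by (simp add: module_quotient_def)
  qed
  have smult: "r \<odot>\<^bsub>?Q\<^esub> (B +>\<^bsub>M\<^esub> x) = B +>\<^bsub>M\<^esub> (r \<odot>\<^bsub>M\<^esub> x)" if "r \<in> carrier R" "x \<in> carrier M" for r x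
  proof -
    have "B +>\<^bsub>M\<^esub> (r \<odot>\<^bsub>M\<^esub> y) = B +>\<^bsub>M\<^esub> (r \<odot>\<^bsub>M\<^esub> x)" if y: "y \<in> B +>\<^bsub>M\<^esub> x" for y
    proof -
      obtain b where b: "b \<in> B" "y = b \<oplus>\<^bsub>M\<^esub> x" using y by (auto simp: a_r_coset_def')
      then have "r \<odot>\<^bsub>M\<^esub> y \<ominus>\<^bsub>M\<^esub> r \<odot>\<^bsub>M\<^esub> x = r \<odot>\<^bsub>M\<^esub> b"
        using BD(2) \<open>r \<in> carrier R\<close> \<open>x \<in> carrier M\<close>
        by (simp add: M.minus_eq smult_r_distr M.a_assoc M.r_neg)
      then show ?thesis using b BD(2,5) \<open>r \<in> carrier R\<close> \<open>x \<in> carrier M\<close> by (subst coset_eq_iff[OF B]) auto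
    qed
    moreover have "x \<in> B +>\<^bsub>M\<^esub> x" using BD(3) that by (force simp: a_r_coset_def')
    ultimately have "(\<Union>y\<in>B +>\<^bsub>M\<^esub> x. B +>\<^bsub>M\<^esub> (r \<odot>\<^bsub>M\<^esub> y)) = B +>\<^bsub>M\<^esub> (r \<odot>\<^bsub>M\<^esub> x)" by blast
    then show ?thesis by (simp add: module_quotient_def)
  qed
  have zero: "\<zero>\<^bsub>?Q\<^esub> = B +>\<^bsub>M\<^esub> \<zero>\<^bsub>M\<^esub>"
    using BD(2) by (auto simp: module_quotient_def a_r_coset_def')
  have ag: "abelian_group ?Q"
  proof (rule abelian_groupI)
    fix a assume "a \<in> carrier ?Q"
    then obtain x where x: "a = B +>\<^bsub>M\<^esub> x" "x \<in> carrier M" using car by auto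
    then have "(B +>\<^bsub>M\<^esub> (\<ominus>\<^bsub>M\<^esub> x)) \<oplus>\<^bsub>?Q\<^esub> a = \<zero>\<^bsub>?Q\<^esub>"
      using add[of "\<ominus>\<^bsub>M\<^esub> x" x] by (simp add: zero M.l_neg)
    then show "\<exists>y\<in>carrier ?Q. y \<oplus>\<^bsub>?Q\<^esub> a = \<zero>\<^bsub>?Q\<^esub>" using car x by auto
  qed (auto simp: car add zero M.a_ac)
  show "module R ?Q"
    by (rule moduleI) (auto simp: ag is_cring car add smult smult_l_distr smult_r_distr smult_assoc1)
  show "(\<lambda>x. B +>\<^bsub>M\<^esub> x) \<in> mod_hom R M ?Q"
    by (rule mod_homI) (auto simp: car add smult)
qed

text \<open>The bridge from the coset modules in the definition of cohomology to conditions on pairs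
  of submodules.\<close>

lemma artinian_module_quotient_iff:
  assumes B: "submodule B R M"
  shows "artinian_module R (module_quotient M B) \<longleftrightarrow> chain_cond False R M B (carrier M)"
proof -
  let ?Q = "module_quotient M B"
  note Q = module_module_quotient[OF B] and pi = mod_hom_coset[OF B] and BD = submodule_memD[OF B]
  interpret Q: module R ?Q by fact
  have zero: "\<zero>\<^bsub>?Q\<^esub> = B +>\<^bsub>M\<^esub> \<zero>\<^bsub>M\<^esub>"
    using mod_hom_zero[OF module_axioms Q pi] by simp
  have B0: "B +>\<^bsub>M\<^esub> z = \<zero>\<^bsub>?Q\<^esub> \<longleftrightarrow> z \<in> B" if "z \<in> carrier M" for z
    using coset_eq_iff[OF B that, of "\<zero>\<^bsub>M\<^esub>"] that by (simp add: zero)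
  have "N \<in> submodules_between R ?Q {\<zero>\<^bsub>?Q\<^esub>} (carrier ?Q) \<longleftrightarrow> submodule N R ?Q" for N
    using submodule_memD(1,3)[of N R ?Q] by (auto simp: submodules_between_def)
  then have "artinian_module R ?Q \<longleftrightarrow> chain_cond False R ?Q {\<zero>\<^bsub>?Q\<^esub>} (carrier ?Q)"
    using Q by (simp add: artinian_module_def chain_cond_def)
  moreover have "chain_cond False R ?Q {\<zero>\<^bsub>?Q\<^esub>} (carrier ?Q)" if "chain_cond False R M B (carrier M)"
  proof (rule chain_cond_image[OF module_axioms Q pi carrier_is_submodule Q.carrier_is_submodule BD(1) _ _ that])
    show "B +>\<^bsub>M\<^esub> x \<in> {\<zero>\<^bsub>?Q\<^esub>}" if "x \<in> B" for x using B0 that BD by simp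
    fix z assume z: "z \<in> carrier ?Q"
    then obtain y where "y \<in> carrier M" "z = B +>\<^bsub>M\<^esub> y"
      by (auto simp: module_quotient_def A_RCOSETS_def')
    then show "\<exists>y\<in>carrier M. \<exists>b\<in>{\<zero>\<^bsub>?Q\<^esub>}. z = (B +>\<^bsub>M\<^esub> y) \<oplus>\<^bsub>?Q\<^esub> b" using z by force
  qed
  moreover have "chain_cond False R M B (carrier M)" if "chain_cond False R ?Q {\<zero>\<^bsub>?Q\<^esub>} (carrier ?Q)"
    by (rule chain_cond_inj[OF module_axioms Q pi Q.carrier_is_submodule Q.zero_submodule _ _ _ that])
      (use BD B0 mod_homD(1)[OF pi] in auto)
  ultimately show ?thesis by blast
qed

lemma submodule_restrict:
  assumes "submodule Z R M" "submodule N R M" "N \<subseteq> Z"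
  shows "submodule N R (M\<lparr>carrier := Z\<rparr>)"
proof -
  have "module R (M\<lparr>carrier := Z\<rparr>)" using submodule.submodule_is_module[OF assms(1) module_axioms] .
  from module.submoduleI'[OF this] show ?thesis using submodule_memD[OF assms(2)] assms(3) by simp
qed

lemma chain_cond_restrict_iff:
  assumes Z: "submodule Z R M" and B: "submodule B R M" "B \<subseteq> Z"
  shows "chain_cond asc R (M\<lparr>carrier := Z\<rparr>) B Z \<longleftrightarrow> chain_cond asc R M B Z"
proof -
  have "submodule N R (M\<lparr>carrier := Z\<rparr>) \<longleftrightarrow> submodule N R M" if "N \<subseteq> Z" for N
  proof
    assume "submodule N R (M\<lparr>carrier := Z\<rparr>)"
    from submodule_memD[OF this, simplified] show "submodule N R M"
      using that submodule_memD(1)[OF Z] by (intro submoduleI') auto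
  qed (rule submodule_restrict[OF Z _ that])
  then have "submodules_between R (M\<lparr>carrier := Z\<rparr>) B Z = submodules_between R M B Z"
    unfolding submodules_between_def by blast
  then show ?thesis by (simp add: chain_cond_def)
qed

end

section \<open>Torsion submodules\<close>

text \<open>The exponent may depend on s. For finite \<open>S\<close> this is the torsion with
  respect to the ideal generated by \<open>S\<close> (\<open>torsion_part_eq_tors\<close>). In this
  form composing torsion functors amounts to taking unions of sets, which suits inductions that
  adjoin one element at a time.\<close>

definition tors :: "('a, 'r) ring_scheme \<Rightarrow> 'a set \<Rightarrow> ('a, 'm, 'k) module_scheme \<Rightarrow> 'm set" where
  "tors R S V = {x \<in> carrier V. \<forall>s\<in>S. \<exists>n::nat. (s [^]\<^bsub>R\<^esub> n) \<odot>\<^bsub>V\<^esub> x = \<zero>\<^bsub>V\<^esub>}"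

definition tors_mod :: "('a, 'r) ring_scheme \<Rightarrow> 'a set \<Rightarrow> ('a, 'm, 'k) module_scheme \<Rightarrow> ('a, 'm, 'k) module_scheme"
  where "tors_mod R S V = V\<lparr>carrier := tors R S V\<rparr>"

lemma tors_mod_simps [simp]:
  "carrier (tors_mod R S V) = tors R S V" "\<zero>\<^bsub>tors_mod R S V\<^esub> = \<zero>\<^bsub>V\<^esub>"
  "x \<oplus>\<^bsub>tors_mod R S V\<^esub> y = x \<oplus>\<^bsub>V\<^esub> y" "r \<odot>\<^bsub>tors_mod R S V\<^esub> x = r \<odot>\<^bsub>V\<^esub> x"
  by (simp_all add: tors_mod_def)

lemma tors_empty [simp]: "tors R {} V = carrier V" "tors_mod R {} V = V"
  by (simp_all add: tors_def tors_mod_def)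

lemma tors_Un: "tors R S (tors_mod R T V) = tors R (S \<union> T) V" "tors_mod R S (tors_mod R T V) = tors_mod R (S \<union> T) V"
proof -
  show "tors R S (tors_mod R T V) = tors R (S \<union> T) V" by (auto simp: tors_def)
  then show "tors_mod R S (tors_mod R T V) = tors_mod R (S \<union> T) V" by (simp add: tors_mod_def)
qed

lemma tors_subset: "tors R S V \<subseteq> carrier V"
  by (auto simp: tors_def)

context module
begin

lemma smult_pow_add:
  "s \<in> carrier R \<Longrightarrow> x \<in> carrier M \<Longrightarrow> (s [^] (m + n :: nat)) \<odot>\<^bsub>M\<^esub> x = (s [^] m) \<odot>\<^bsub>M\<^esub> ((s [^] n) \<odot>\<^bsub>M\<^esub> x)"
  by (simp add: R.nat_pow_mult[symmetric] smult_assoc1)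

lemma pow_annihilates_mono:
  assumes "(s [^] (n::nat)) \<odot>\<^bsub>M\<^esub> x = \<zero>\<^bsub>M\<^esub>" "n \<le> m" "s \<in> carrier R" "x \<in> carrier M"
  shows "(s [^] m) \<odot>\<^bsub>M\<^esub> x = \<zero>\<^bsub>M\<^esub>"
  using smult_pow_add[OF assms(3,4), of "m - n" n] assms by simp

lemma tors_submodule: "S \<subseteq> carrier R \<Longrightarrow> submodule (tors R S M) R M"
proof (rule submoduleI')
  assume S: "S \<subseteq> carrier R"
  show "tors R S M \<subseteq> carrier M" by (rule tors_subset)
  show "\<zero>\<^bsub>M\<^esub> \<in> tors R S M" using S by (auto simp: tors_def)
  fix a b assume a: "a \<in> tors R S M" and b: "b \<in> tors R S M"
  have c: "a \<in> carrier M" "b \<in> carrier M" using a b by (auto simp: tors_def)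
  have "\<exists>n::nat. (s [^] n) \<odot>\<^bsub>M\<^esub> (a \<oplus>\<^bsub>M\<^esub> b) = \<zero>\<^bsub>M\<^esub>" if sS: "s \<in> S" for s
  proof -
    have s: "s \<in> carrier R" using S sS by auto
    obtain m n :: nat where "(s [^] m) \<odot>\<^bsub>M\<^esub> a = \<zero>\<^bsub>M\<^esub>" "(s [^] n) \<odot>\<^bsub>M\<^esub> b = \<zero>\<^bsub>M\<^esub>"
      using a b sS unfolding tors_def by blast
    then have "(s [^] max m n) \<odot>\<^bsub>M\<^esub> a = \<zero>\<^bsub>M\<^esub>" "(s [^] max m n) \<odot>\<^bsub>M\<^esub> b = \<zero>\<^bsub>M\<^esub>"
      using pow_annihilates_mono s c by (meson max.cobounded1 max.cobounded2)+
    then show ?thesis using s c by (intro exI[of _ "max m n"]) (simp add: smult_r_distr)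
  qed
  then show "a \<oplus>\<^bsub>M\<^esub> b \<in> tors R S M" using c by (auto simp: tors_def)
next
  assume S: "S \<subseteq> carrier R"
  fix r x assume r: "r \<in> carrier R" and x: "x \<in> tors R S M"
  have c: "x \<in> carrier M" using x by (auto simp: tors_def)
  have "\<exists>n::nat. (s [^] n) \<odot>\<^bsub>M\<^esub> (r \<odot>\<^bsub>M\<^esub> x) = \<zero>\<^bsub>M\<^esub>" if sS: "s \<in> S" for s
  proof -
    have s: "s \<in> carrier R" using S sS by auto
    obtain n :: nat where "(s [^] n) \<odot>\<^bsub>M\<^esub> x = \<zero>\<^bsub>M\<^esub>" using x sS by (auto simp: tors_def)
    then show ?thesis using smult_comm[of "s [^] n" r x] s r c by (intro exI[of _ n]) simp
  qed
  then show "r \<odot>\<^bsub>M\<^esub> x \<in> tors R S M" using c r by (auto simp: tors_def)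
qed

lemma tors_module: "S \<subseteq> carrier R \<Longrightarrow> module R (tors_mod R S M)"
  unfolding tors_mod_def using submodule.submodule_is_module[OF tors_submodule module_axioms] .

end

lemma tors_hom:
  assumes V: "module R V" and W: "module R W" and f: "f \<in> mod_hom R V W" and S: "S \<subseteq> carrier R"
  shows "x \<in> tors R S V \<Longrightarrow> f x \<in> tors R S W" "f \<in> mod_hom R (tors_mod R S V) (tors_mod R S W)"
proof -
  interpret V: module R V by fact
  note fD = mod_homD[OF f]
  show *: "f x \<in> tors R S W" if "x \<in> tors R S V" for x
  proof -
    have "\<exists>n::nat. (s [^]\<^bsub>R\<^esub> n) \<odot>\<^bsub>W\<^esub> f x = \<zero>\<^bsub>W\<^esub>" if s: "s \<in> S" for s
    proof -
      obtain n :: nat where "(s [^]\<^bsub>R\<^esub> n) \<odot>\<^bsub>V\<^esub> x = \<zero>\<^bsub>V\<^esub>" using s \<open>x \<in> tors R S V\<close> by (auto simp: tors_def)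
      then show ?thesis using fD(3)[of "s [^]\<^bsub>R\<^esub> n" x] s S mod_hom_zero[OF V W f] \<open>x \<in> tors R S V\<close>
        by (auto simp: tors_def subset_iff intro!: exI[of _ n])
    qed
    then show ?thesis using that fD(1) by (auto simp: tors_def)
  qed
  show "f \<in> mod_hom R (tors_mod R S V) (tors_mod R S W)"
    by (rule mod_homI) (use * fD subsetD[OF tors_subset[of R S V]] in auto)
qed

section \<open>Modules satisfying Baer's condition\<close>

text \<open>Baer's condition rather than injectivity: over a Noetherian ring it passes to torsion submodules
  without a further use of Zorn's lemma, and the modules in the complexes below need no more.\<close>

definition baer_module :: "('a, 'r) ring_scheme \<Rightarrow> ('a, 'm, 'k) module_scheme \<Rightarrow> bool" where
  "baer_module R V \<longleftrightarrow> module R V \<and> (\<forall>I g. ideal I R \<and> (\<forall>r\<in>I. g r \<in> carrier V) \<and>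
     (\<forall>r\<in>I. \<forall>s\<in>I. g (r \<oplus>\<^bsub>R\<^esub> s) = g r \<oplus>\<^bsub>V\<^esub> g s) \<and> (\<forall>r\<in>carrier R. \<forall>s\<in>I. g (r \<otimes>\<^bsub>R\<^esub> s) = r \<odot>\<^bsub>V\<^esub> g s)
     \<longrightarrow> (\<exists>e\<in>carrier V. \<forall>r\<in>I. g r = r \<odot>\<^bsub>V\<^esub> e))"

lemma baer_moduleD:
  assumes "baer_module R V" "ideal I R" "\<And>r. r \<in> I \<Longrightarrow> g r \<in> carrier V"
    "\<And>r s. r \<in> I \<Longrightarrow> s \<in> I \<Longrightarrow> g (r \<oplus>\<^bsub>R\<^esub> s) = g r \<oplus>\<^bsub>V\<^esub> g s"
    "\<And>r s. r \<in> carrier R \<Longrightarrow> s \<in> I \<Longrightarrow> g (r \<otimes>\<^bsub>R\<^esub> s) = r \<odot>\<^bsub>V\<^esub> g s"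
  obtains e where "e \<in> carrier V" "\<And>r. r \<in> I \<Longrightarrow> g r = r \<odot>\<^bsub>V\<^esub> e"
  using assms unfolding baer_module_def by blast

lemma injective_imp_baer_module:
  assumes "injective_module R V"
  shows "baer_module R V"
  unfolding baer_module_def
proof (intro conjI allI impI)
  show V: "module R V" using assms by (simp add: injective_module_def)
  interpret V: module R V by fact
  interpret RR: module R "regular_module R" by (rule regular_module) (rule V.R.is_cring)
  fix I g assume g: "ideal I R \<and> (\<forall>r\<in>I. g r \<in> carrier V) \<and>
     (\<forall>r\<in>I. \<forall>s\<in>I. g (r \<oplus>\<^bsub>R\<^esub> s) = g r \<oplus>\<^bsub>V\<^esub> g s) \<and> (\<forall>r\<in>carrier R. \<forall>s\<in>I. g (r \<otimes>\<^bsub>R\<^esub> s) = r \<odot>\<^bsub>V\<^esub> g s)"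
  have "g \<in> mod_hom R ((regular_module R)\<lparr>carrier := I\<rparr>) V"
    by (rule mod_homI) (use g in \<open>auto simp: regular_module_def\<close>)
  moreover have "submodule I R (regular_module R)"
    using g submodule_regular_module_iff[OF V.R.is_cring] by blast
  ultimately obtain h where h: "h \<in> mod_hom R (regular_module R) V" "\<And>r. r \<in> I \<Longrightarrow> h r = g r"
    using assms RR.module_axioms unfolding injective_module_def by metis
  have hD: "h \<one>\<^bsub>R\<^esub> \<in> carrier V" "r \<in> carrier R \<Longrightarrow> h r = r \<odot>\<^bsub>V\<^esub> h \<one>\<^bsub>R\<^esub>" for r
    using mod_homD(1)[OF h(1), of "\<one>\<^bsub>R\<^esub>"] mod_homD(3)[OF h(1), of r "\<one>\<^bsub>R\<^esub>"]
    by (auto simp: regular_module_def)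
  then show "\<exists>e\<in>carrier V. \<forall>r\<in>I. g r = r \<odot>\<^bsub>V\<^esub> e"
    using h(2) ideal.Icarr[of I R] g by (metis)
qed

text \<open>The ideals (I : s^n) ascend with n and become stationary at some k.\<close>

lemma ideal_colon_stable:
  fixes R (structure)
  assumes R: "cring R" "noetherian_ring R" and I: "ideal I R" and s: "s \<in> carrier R"
  shows "\<exists>k::nat. \<forall>n::nat. \<forall>r\<in>carrier R. s [^] n \<otimes> r \<in> I \<longrightarrow> s [^] k \<otimes> r \<in> I"
proof -
  interpret cring R by fact
  interpret RR: module R "regular_module R" by (rule regular_module) fact
  interpret ideal I R by fact
  define N where "N n = {r \<in> carrier R. s [^] n \<otimes> r \<in> I}" for n :: nat
  have "ideal (N n) R" for n
    using RR.ideal_colon[of I "s [^] n"] s submodule_regular_module_iff[OF R(1)] I m_comm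
    by (simp add: N_def regular_module_def cong: conj_cong)
  then have "N n \<in> submodules_between R (regular_module R) {\<zero>} (carrier R)" for n
    using submodule_regular_module_iff[OF R(1), of "N n"] s
    unfolding submodules_between_def by (auto simp: N_def)
  moreover have step: "N n \<subseteq> N (Suc n)" for n
  proof
    fix r assume "r \<in> N n"
    moreover have "s [^] Suc n \<otimes> r = s \<otimes> (s [^] n \<otimes> r)" if "r \<in> carrier R" using s that by (simp add: m_ac)
    ultimately show "r \<in> N (Suc n)" using I_l_closed[of "s [^] n \<otimes> r" s] s by (simp add: N_def)
  qed
  ultimately obtain k where k: "\<And>n. n \<ge> k \<Longrightarrow> N n = N k"
    using chain_condD[OF noetherian_regular_module[OF R], of N] by auto
  have "N n \<subseteq> N k" for n
    using k[of "max n k"] lift_Suc_mono_le[of N n "max n k", OF step] by auto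
  then show ?thesis by (intro exI[of _ k]) (auto simp: N_def)
qed

lemma ideal_add_multiples:
  fixes R (structure)
  assumes R: "cring R" and I: "ideal I R" and v: "v \<in> carrier R"
  shows "ideal {i \<oplus> r \<otimes> v | i r. i \<in> I \<and> r \<in> carrier R} R"
proof -
  interpret RR: module R "regular_module R" by (rule regular_module) fact
  show ?thesis
    using RR.line_sum(1)[of I v] I v submodule_regular_module_iff[OF R]
    by (simp add: RR.line_sum_def) (simp add: regular_module_def)
qed

text \<open>A map g from a finitely generated ideal \<open>I\<close> into the s-torsion is killed by
  a single power s^n. Extended by zero to the multiples of a higher power v of s, it is
  multiplication of some e in \<open>V\<close> by Baer's condition. Its value 0 at v forces v e = 0,
  so e is itself s-torsion.\<close>

lemma baer_module_tors_single:
  fixes R (structure)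
  assumes noeth: "noetherian_ring R" and V: "baer_module R V" and s: "s \<in> carrier R"
  shows "baer_module R (tors_mod R {s} V)"
  unfolding baer_module_def
proof (intro conjI allI impI)
  interpret V: module R V using V by (simp add: baer_module_def)
  interpret noetherian_ring R by fact
  show "module R (tors_mod R {s} V)" using V.tors_module s by simp
  fix I g assume "ideal I R \<and> (\<forall>r\<in>I. g r \<in> carrier (tors_mod R {s} V)) \<and>
     (\<forall>r\<in>I. \<forall>s'\<in>I. g (r \<oplus> s') = g r \<oplus>\<^bsub>tors_mod R {s} V\<^esub> g s') \<and>
     (\<forall>r\<in>carrier R. \<forall>s'\<in>I. g (r \<otimes> s') = r \<odot>\<^bsub>tors_mod R {s} V\<^esub> g s')"
  then have I: "ideal I R" and gt: "\<And>r. r \<in> I \<Longrightarrow> g r \<in> tors R {s} V"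
    and gadd: "\<And>r s. r \<in> I \<Longrightarrow> s \<in> I \<Longrightarrow> g (r \<oplus> s) = g r \<oplus>\<^bsub>V\<^esub> g s"
    and gsm: "\<And>r s. r \<in> carrier R \<Longrightarrow> s \<in> I \<Longrightarrow> g (r \<otimes> s) = r \<odot>\<^bsub>V\<^esub> g s" by auto
  interpret ideal I R by fact
  have gc: "g r \<in> carrier V" if "r \<in> I" for r using gt[OF that] by (simp add: tors_def)
  have g0: "g \<zero> = \<zero>\<^bsub>V\<^esub>" using gsm[of \<zero> \<zero>] gc by simp
  obtain A where A: "A \<subseteq> carrier R" "finite A" "I = Idl A" using finetely_gen[OF I] by blast
  then have AI: "A \<subseteq> I" using V.R.genideal_self by blast
  have "\<forall>a\<in>A. \<exists>n::nat. (s [^] n) \<odot>\<^bsub>V\<^esub> g a = \<zero>\<^bsub>V\<^esub>" using gt AI by (auto simp: tors_def)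
  then obtain f where f: "\<And>a. a \<in> A \<Longrightarrow> (s [^] (f a :: nat)) \<odot>\<^bsub>V\<^esub> g a = \<zero>\<^bsub>V\<^esub>" by metis
  define n where "n = (\<Sum>a\<in>A. f a)"
  have fn: "(s [^] n) \<odot>\<^bsub>V\<^esub> g a = \<zero>\<^bsub>V\<^esub>" if "a \<in> A" for a
    using V.pow_annihilates_mono[OF f[OF that] _ s gc] AI that A(2) member_le_sum[of a A f] unfolding n_def by auto
  have "ideal {r \<in> I. (s [^] n) \<odot>\<^bsub>V\<^esub> g r = \<zero>\<^bsub>V\<^esub>} R"
  proof (rule submodule_regular_module_iff[OF V.R.is_cring, THEN iffD1])
    interpret RR: module R "regular_module R" by (rule regular_module) (rule V.R.is_cring)
    show "submodule {r \<in> I. (s [^] n) \<odot>\<^bsub>V\<^esub> g r = \<zero>\<^bsub>V\<^esub>} R (regular_module R)"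
    proof (rule RR.submoduleI')
      fix a x assume "a \<in> carrier R" "x \<in> {r \<in> I. (s [^] n) \<odot>\<^bsub>V\<^esub> g r = \<zero>\<^bsub>V\<^esub>}"
      then show "a \<odot>\<^bsub>regular_module R\<^esub> x \<in> {r \<in> I. (s [^] n) \<odot>\<^bsub>V\<^esub> g r = \<zero>\<^bsub>V\<^esub>}"
        using gsm[of a x] gc[of x] V.smult_comm[of "s [^] n" a "g x"] s
        by (simp add: regular_module_def I_l_closed)
    qed (use s g0 gc gadd in \<open>auto simp: regular_module_def V.smult_r_distr\<close>)
  qed
  then have "Idl A \<subseteq> {r \<in> I. (s [^] n) \<odot>\<^bsub>V\<^esub> g r = \<zero>\<^bsub>V\<^esub>}"
    using fn AI by (intro V.R.genideal_minimal) auto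
  then have sn: "(s [^] n) \<odot>\<^bsub>V\<^esub> g r = \<zero>\<^bsub>V\<^esub>" if "r \<in> I" for r using A that by auto
  obtain k where k: "\<And>n r. r \<in> carrier R \<Longrightarrow> s [^] (n::nat) \<otimes> r \<in> I \<Longrightarrow> s [^] (k::nat) \<otimes> r \<in> I"
    using ideal_colon_stable[OF V.R.is_cring noeth I s] by blast
  \<comment> \<open>The extra exponent k makes the extension by zero well defined: r v in
    \<open>I\<close> implies s^k r in \<open>I\<close>, whence g (r v) = s^n g (s^k r) = 0.\<close>
  define v where "v = s [^] (n + k)"
  have v: "v \<in> carrier R" using s by (simp add: v_def)
  have gv: "g (r \<otimes> v) = \<zero>\<^bsub>V\<^esub>" if r: "r \<in> carrier R" "r \<otimes> v \<in> I" for r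
  proof -
    have "s [^] k \<otimes> r \<in> I" using k[of r "n + k"] r s V.R.m_comm[of r v] v by (simp add: v_def)
    moreover have "r \<otimes> v = s [^] n \<otimes> (s [^] k \<otimes> r)"
      using r s by (simp add: v_def V.R.nat_pow_mult[symmetric] V.R.m_ac)
    ultimately show ?thesis using gsm[of "s [^] n" "s [^] k \<otimes> r"] sn s by simp
  qed
  define J where "J = {i \<oplus> r \<otimes> v | i r. i \<in> I \<and> r \<in> carrier R}"
  have JI: "i \<oplus> r \<otimes> v \<in> J" if "i \<in> I" "r \<in> carrier R" for i r using that unfolding J_def by blast
  have J: "ideal J R" unfolding J_def by (rule ideal_add_multiples[OF V.R.is_cring I v])
  define g' where "g' j = g (SOME i. i \<in> I \<and> (\<exists>r\<in>carrier R. j = i \<oplus> r \<otimes> v))" for j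
  have g': "g' (i \<oplus> r \<otimes> v) = g i" if ir: "i \<in> I" "r \<in> carrier R" for i r
  proof -
    define i' where "i' = (SOME i'. i' \<in> I \<and> (\<exists>r'\<in>carrier R. i \<oplus> r \<otimes> v = i' \<oplus> r' \<otimes> v))"
    have "i' \<in> I \<and> (\<exists>r'\<in>carrier R. i \<oplus> r \<otimes> v = i' \<oplus> r' \<otimes> v)"
      unfolding i'_def by (rule someI_ex) (use ir in auto)
    then obtain r' where i': "i' \<in> I" "r' \<in> carrier R" "i \<oplus> r \<otimes> v = i' \<oplus> r' \<otimes> v" by auto
    have c: "i \<in> carrier R" "i' \<in> carrier R" using ir i' Icarr by auto
    have "(r' \<ominus> r) \<otimes> v = i \<ominus> i'"
    proof -
      have "r' \<otimes> v = (i \<oplus> r \<otimes> v) \<ominus> i'" using i' c ir v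
        by (simp add: V.R.minus_eq V.R.a_ac V.R.r_neg V.R.r_neg1 V.R.r_neg2)
      moreover have "(r' \<ominus> r) \<otimes> v = r' \<otimes> v \<ominus> r \<otimes> v"
        using i' ir v by (simp add: V.R.minus_eq V.R.l_distr V.R.l_minus)
      ultimately have "(r' \<ominus> r) \<otimes> v = ((i \<oplus> r \<otimes> v) \<ominus> i') \<ominus> r \<otimes> v" by simp
      also have "\<dots> = i \<ominus> i'"
        using c ir v by (simp add: V.R.minus_eq V.R.a_ac V.R.r_neg V.R.r_neg1 V.R.r_neg2)
      finally show ?thesis .
    qed
    moreover have "i \<ominus> i' \<in> I" using ir i' by (simp add: V.R.minus_eq)
    ultimately have "g (i \<ominus> i') = \<zero>\<^bsub>V\<^esub>" using gv[of "r' \<ominus> r"] ir i' by simp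
    moreover have "i = (i \<ominus> i') \<oplus> i'" using c by (simp add: V.R.minus_eq V.R.a_assoc V.R.l_neg)
    ultimately have "g i = g i'" using gadd[of "i \<ominus> i'" i'] \<open>i \<ominus> i' \<in> I\<close> i' gc by simp
    then show ?thesis unfolding g'_def i'_def by simp
  qed
  have g'c: "g' j \<in> carrier V" if "j \<in> J" for j using that g' gc unfolding J_def by auto
  have g'add: "g' (x \<oplus> y) = g' x \<oplus>\<^bsub>V\<^esub> g' y" if xy: "x \<in> J" "y \<in> J" for x y
  proof -
    obtain i r i' r' where *: "i \<in> I" "r \<in> carrier R" "x = i \<oplus> r \<otimes> v" "i' \<in> I" "r' \<in> carrier R" "y = i' \<oplus> r' \<otimes> v"
      using xy unfolding J_def by auto
    have "x \<oplus> y = (i \<oplus> i') \<oplus> (r \<oplus> r') \<otimes> v" using * Icarr v by (simp add: V.R.l_distr V.R.a_ac)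
    then show ?thesis using * g'[of "i \<oplus> i'" "r \<oplus> r'"] g' gadd by simp
  qed
  have g'sm: "g' (x \<otimes> y) = x \<odot>\<^bsub>V\<^esub> g' y" if xy: "x \<in> carrier R" "y \<in> J" for x y
  proof -
    obtain i r where *: "i \<in> I" "r \<in> carrier R" "y = i \<oplus> r \<otimes> v" using xy unfolding J_def by auto
    have "x \<otimes> y = (x \<otimes> i) \<oplus> (x \<otimes> r) \<otimes> v" using * Icarr v xy by (simp add: V.R.r_distr V.R.m_assoc)
    then show ?thesis using * g'[of "x \<otimes> i" "x \<otimes> r"] g' gsm xy I_l_closed by simp
  qed
  obtain e where e: "e \<in> carrier V" "\<And>j. j \<in> J \<Longrightarrow> g' j = j \<odot>\<^bsub>V\<^esub> e"
    using baer_moduleD[OF V J g'c g'add g'sm] by blast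
  have "v \<odot>\<^bsub>V\<^esub> e = \<zero>\<^bsub>V\<^esub>" using e(2)[OF JI[of \<zero> \<one>]] g'[of \<zero> \<one>] v g0 by simp
  then have "e \<in> tors R {s} V" using e by (auto simp: tors_def v_def)
  moreover have "g r = r \<odot>\<^bsub>V\<^esub> e" if "r \<in> I" for r
    using e(2)[OF JI[of r \<zero>]] g'[of r \<zero>] v that Icarr by simp
  ultimately show "\<exists>e\<in>carrier (tors_mod R {s} V). \<forall>r\<in>I. g r = r \<odot>\<^bsub>tors_mod R {s} V\<^esub> e" by auto
qed

lemma baer_module_tors:
  assumes noeth: "noetherian_ring R" and V: "baer_module R V" and S: "finite S" "S \<subseteq> carrier R"
  shows "baer_module R (tors_mod R S V)"
  using S
proof (induction S rule: finite_induct)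
  case (insert s S)
  then have "baer_module R (tors_mod R {s} (tors_mod R S V))"
    by (intro baer_module_tors_single[OF noeth]) auto
  then show ?case by (simp add: tors_Un)
qed (use V in simp)

text \<open>Let k be such that every ring element killed by a power of s is killed by s^k. Then r
  s^(k+1) -> r s^k w is well defined, and Baer's condition gives e with s^(k+1) e = s^k w, so s^k
  kills w - s e. In other words, \<open>V\<close> maps onto its localisation at s.\<close>

lemma baer_module_divisible:
  fixes R (structure)
  assumes noeth: "noetherian_ring R" and V: "baer_module R V" and s: "s \<in> carrier R" and w: "w \<in> carrier V"
  shows "\<exists>e\<in>carrier V. w \<ominus>\<^bsub>V\<^esub> s \<odot>\<^bsub>V\<^esub> e \<in> tors R {s} V"
proof -
  interpret V: module R V using V by (simp add: baer_module_def)
  obtain k where k: "\<And>n r. r \<in> carrier R \<Longrightarrow> s [^] (n::nat) \<otimes> r \<in> {\<zero>} \<Longrightarrow> s [^] (k::nat) \<otimes> r \<in> {\<zero>}"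
    using ideal_colon_stable[OF V.R.is_cring noeth V.R.zeroideal s] by blast
  define v where "v = s [^] Suc k"
  have v: "v \<in> carrier R" using s by (simp add: v_def)
  define J where "J = {i \<oplus> r \<otimes> v | i r. i \<in> {\<zero>} \<and> r \<in> carrier R}"
  have J: "ideal J R" unfolding J_def by (rule ideal_add_multiples[OF V.R.is_cring V.R.zeroideal v])
  have JI: "j \<in> J \<longleftrightarrow> (\<exists>r\<in>carrier R. j = r \<otimes> v)" for j
    unfolding J_def using v by (simp, metis V.R.l_zero V.R.m_closed)
  define u where "u = (s [^] k) \<odot>\<^bsub>V\<^esub> w"
  have u: "u \<in> carrier V" using s w by (simp add: u_def)
  define g where "g j = (SOME r. r \<in> carrier R \<and> j = r \<otimes> v) \<odot>\<^bsub>V\<^esub> u" for j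
  have g: "g (r \<otimes> v) = r \<odot>\<^bsub>V\<^esub> u" if r: "r \<in> carrier R" for r
  proof -
    define r' where "r' = (SOME r'. r' \<in> carrier R \<and> r \<otimes> v = r' \<otimes> v)"
    have r': "r' \<in> carrier R \<and> r \<otimes> v = r' \<otimes> v" unfolding r'_def by (rule someI_ex) (use r in auto)
    have "(r \<ominus> r') \<otimes> v = \<zero>" using r r' v by (simp add: V.R.minus_eq V.R.l_distr V.R.l_minus V.R.r_neg)
    then have "s [^] k \<otimes> (r \<ominus> r') \<in> {\<zero>}" using k[of "r \<ominus> r'" "Suc k"] r r' v V.R.m_comm[of v "r \<ominus> r'"]
      by (simp add: v_def)
    then have "((r \<ominus> r') \<otimes> s [^] k) \<odot>\<^bsub>V\<^esub> w = \<zero>\<^bsub>V\<^esub>" using s r r' w by (simp add: V.R.m_comm)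
    then have "(r \<ominus> r') \<odot>\<^bsub>V\<^esub> u = \<zero>\<^bsub>V\<^esub>" using s r r' w by (simp add: u_def V.smult_assoc1)
    then have "r \<odot>\<^bsub>V\<^esub> u \<oplus>\<^bsub>V\<^esub> \<ominus>\<^bsub>V\<^esub> (r' \<odot>\<^bsub>V\<^esub> u) = \<zero>\<^bsub>V\<^esub>"
      using r r' u by (simp add: V.R.minus_eq V.smult_l_distr V.smult_l_minus)
    then have "r \<odot>\<^bsub>V\<^esub> u = r' \<odot>\<^bsub>V\<^esub> u"
      using r r' u V.M.minus_equality[of "r \<odot>\<^bsub>V\<^esub> u" "\<ominus>\<^bsub>V\<^esub> (r' \<odot>\<^bsub>V\<^esub> u)"] by simp
    then show ?thesis unfolding g_def r'_def by simp
  qed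
  have gc: "g j \<in> carrier V" if "j \<in> J" for j using that g u by (auto simp: JI)
  have gadd: "g (x \<oplus> y) = g x \<oplus>\<^bsub>V\<^esub> g y" if xy: "x \<in> J" "y \<in> J" for x y
  proof -
    obtain r r' where *: "r \<in> carrier R" "x = r \<otimes> v" "r' \<in> carrier R" "y = r' \<otimes> v" using xy by (auto simp: JI)
    have "x \<oplus> y = (r \<oplus> r') \<otimes> v" using * v by (simp add: V.R.l_distr)
    then show ?thesis using * g u by (simp add: V.smult_l_distr)
  qed
  have gsm: "g (x \<otimes> y) = x \<odot>\<^bsub>V\<^esub> g y" if xy: "x \<in> carrier R" "y \<in> J" for x y
  proof -
    obtain r where *: "r \<in> carrier R" "y = r \<otimes> v" using xy by (auto simp: JI)
    have "x \<otimes> y = (x \<otimes> r) \<otimes> v" using * xy v by (simp add: V.R.m_assoc)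
    then show ?thesis using * g u xy by (simp add: V.smult_assoc1)
  qed
  obtain e where e: "e \<in> carrier V" "\<And>j. j \<in> J \<Longrightarrow> g j = j \<odot>\<^bsub>V\<^esub> e"
    using baer_moduleD[OF V J gc gadd gsm] by blast
  have "v \<in> J" using v by (auto simp: JI intro: bexI[of _ \<one>])
  then have "v \<odot>\<^bsub>V\<^esub> e = u" using e(2)[of v] g[of \<one>] u v by simp
  then have "(s [^] k) \<odot>\<^bsub>V\<^esub> (w \<ominus>\<^bsub>V\<^esub> s \<odot>\<^bsub>V\<^esub> e) = \<zero>\<^bsub>V\<^esub>"
    using s w e V.smult_pow_Suc(1)[OF s e(1), of k] u
    by (simp add: V.M.minus_eq V.smult_r_distr V.smult_r_minus v_def u_def V.M.r_neg)
  then show ?thesis using s w e by (intro bexI[of _ e]) (auto simp: tors_def)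
qed

section \<open>Complexes indexed by the integers\<close>

text \<open>Integer indices let the shifts in cones, and resolutions placed at an arbitrary degree,
  be written without boundary cases.\<close>

definition cyc :: "(int \<Rightarrow> ('a, 'x) module) \<Rightarrow> (int \<Rightarrow> 'x \<Rightarrow> 'x) \<Rightarrow> int \<Rightarrow> 'x set" where
  "cyc P D n = {x \<in> carrier (P n). D n x = \<zero>\<^bsub>P (n + 1)\<^esub>}"

definition bnd :: "(int \<Rightarrow> ('a, 'x) module) \<Rightarrow> (int \<Rightarrow> 'x \<Rightarrow> 'x) \<Rightarrow> int \<Rightarrow> 'x set" where
  "bnd P D n = D (n - 1) ` carrier (P (n - 1))"

locale int_complex =
  fixes R :: "('a, 'r) ring_scheme" and P :: "int \<Rightarrow> ('a, 'x) module" and D :: "int \<Rightarrow> 'x \<Rightarrow> 'x"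
  assumes cx_module: "module R (P n)"
    and cx_hom: "D n \<in> mod_hom R (P n) (P (n + 1))"
    and cx_square: "x \<in> carrier (P n) \<Longrightarrow> D (n + 1) (D n x) = \<zero>\<^bsub>P (n + 2)\<^esub>"
begin

lemma ring_is_cring: "cring R"
  using cx_module[of 0] by (simp add: module_def)

lemma cx_hom': "D (n - 1) \<in> mod_hom R (P (n - 1)) (P n)"
  using cx_hom[of "n - 1"] by simp

lemma cx_square': "x \<in> carrier (P (n - 1)) \<Longrightarrow> D n (D (n - 1) x) = \<zero>\<^bsub>P (n + 1)\<^esub>"
  using cx_square[of x "n - 1"] by (simp add: add.commute)

lemma cyc_submodule: "submodule (cyc P D n) R (P n)"
proof -
  interpret Pn: module R "P n" by (rule cx_module)
  interpret Pm: module R "P (n + 1)" by (rule cx_module)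
  show ?thesis
    using Pn.submodule_preimage[OF cx_hom cx_module Pn.carrier_is_submodule Pm.zero_submodule]
    by (simp add: cyc_def)
qed

lemma bnd_submodule: "submodule (bnd P D n) R (P n)"
proof -
  interpret Pn: module R "P (n - 1)" by (rule cx_module)
  show ?thesis
    using Pn.submodule_image[OF cx_hom' cx_module Pn.carrier_is_submodule] by (simp add: bnd_def)
qed

lemma bnd_subset_cyc: "bnd P D n \<subseteq> cyc P D n"
  using cx_square' mod_homD(1)[OF cx_hom'] by (auto simp: bnd_def cyc_def)

lemma bndI: "x \<in> carrier (P (n - 1)) \<Longrightarrow> D (n - 1) x \<in> bnd P D n"
  by (simp add: bnd_def)

lemma cycD: "x \<in> cyc P D n \<Longrightarrow> x \<in> carrier (P n)" "x \<in> cyc P D n \<Longrightarrow> D n x = \<zero>\<^bsub>P (n + 1)\<^esub>"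
  by (auto simp: cyc_def)

lemma tors_complex:
  assumes "S \<subseteq> carrier R"
  shows "int_complex R (\<lambda>n. tors_mod R S (P n)) D"
proof (rule int_complex.intro)
  show "module R (tors_mod R S (P n))" for n using module.tors_module[OF cx_module assms] .
  show "D n \<in> mod_hom R (tors_mod R S (P n)) (tors_mod R S (P (n + 1)))" for n
    by (rule tors_hom(2)[OF cx_module cx_module cx_hom assms])
  show "D (n + 1) (D n x) = \<zero>\<^bsub>tors_mod R S (P (n + 2))\<^esub>" if "x \<in> carrier (tors_mod R S (P n))" for n x
    using that cx_square[of x n] subsetD[OF tors_subset, of x R S "P n"] by simp
qed

lemma cyc_tors: "cyc (\<lambda>n. tors_mod R S (P n)) D n = cyc P D n \<inter> tors R S (P n)"
  by (auto simp: cyc_def tors_def)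

text \<open>If \<open>z = D y\<close> and \<open>x\<close> kills a power of \<open>z\<close>, then \<open>x ^ k y\<close> is a boundary \<open>D w\<close> for some \<open>k\<close>;
  dividing \<open>w\<close> by \<open>x ^ k\<close> up to torsion corrects \<open>y\<close> to a torsion element.\<close>

lemma tors_boundary:
  assumes noeth: "noetherian_ring R" and baer: "\<And>n. baer_module R (P n)" and s: "s \<in> carrier R"
    and tors: "\<And>z. z \<in> cyc P D (n - 1) \<Longrightarrow> \<exists>k::nat. (s [^]\<^bsub>R\<^esub> k) \<odot>\<^bsub>P (n - 1)\<^esub> z \<in> bnd P D (n - 1)"
    and z: "z \<in> tors R {s} (P n)" "z \<in> bnd P D n"
  shows "z \<in> bnd (\<lambda>n. tors_mod R {s} (P n)) D n"
proof -
  interpret P0: module R "P n" by (rule cx_module)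
  interpret P1: module R "P (n - 1)" by (rule cx_module)
  interpret P2: module R "P (n - 1 - 1)" by (rule cx_module)
  note d1 = mod_homD[OF cx_hom'[of n]] and d2 = mod_homD[OF cx_hom'[of "n - 1"]]
  obtain y where y: "y \<in> carrier (P (n - 1))" "z = D (n - 1) y" using z by (auto simp: bnd_def)
  obtain a :: nat where a: "(s [^]\<^bsub>R\<^esub> a) \<odot>\<^bsub>P n\<^esub> z = \<zero>\<^bsub>P n\<^esub>" using z by (auto simp: tors_def)
  have "(s [^]\<^bsub>R\<^esub> a) \<odot>\<^bsub>P (n - 1)\<^esub> y \<in> cyc P D (n - 1)" using a y s d1(3) by (simp add: cyc_def)
  then obtain b :: nat where "(s [^]\<^bsub>R\<^esub> b) \<odot>\<^bsub>P (n - 1)\<^esub> ((s [^]\<^bsub>R\<^esub> a) \<odot>\<^bsub>P (n - 1)\<^esub> y) \<in> bnd P D (n - 1)"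
    using tors by blast
  then obtain w where w: "w \<in> carrier (P (n - 1 - 1))" "(s [^]\<^bsub>R\<^esub> (b + a)) \<odot>\<^bsub>P (n - 1)\<^esub> y = D (n - 1 - 1) w"
    using y s by (auto simp: bnd_def P1.smult_pow_add)
  \<comment> \<open>It is t y that equals D w, so w has to be divided by the whole power t.\<close>
  define t where "t = s [^]\<^bsub>R\<^esub> (b + a)"
  have t: "t \<in> carrier R" using s by (simp add: t_def)
  obtain e where e: "e \<in> carrier (P (n - 1 - 1))"
      "w \<ominus>\<^bsub>P (n - 1 - 1)\<^esub> t \<odot>\<^bsub>P (n - 1 - 1)\<^esub> e \<in> tors R {t} (P (n - 1 - 1))"
    using baer_module_divisible[OF noeth baer t w(1)] by blast
  define y' where "y' = y \<ominus>\<^bsub>P (n - 1)\<^esub> D (n - 1 - 1) e"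
  have De: "D (n - 1 - 1) e \<in> carrier (P (n - 1))" using d2(1) e by simp
  have y': "y' \<in> carrier (P (n - 1))" using y De by (simp add: y'_def)
  have te: "t \<odot>\<^bsub>P (n - 1 - 1)\<^esub> e \<in> carrier (P (n - 1 - 1))" using t e(1) by (rule P2.smult_closed)
  have "t \<odot>\<^bsub>P (n - 1)\<^esub> y' = D (n - 1 - 1) (w \<ominus>\<^bsub>P (n - 1 - 1)\<^esub> t \<odot>\<^bsub>P (n - 1 - 1)\<^esub> e)"
    using w e t te y De d2(3)
    by (subst mod_hom_diff[OF cx_module cx_module cx_hom'])
      (simp_all add: y'_def P1.M.minus_eq P1.smult_r_distr P1.smult_r_minus t_def)
  also have "\<dots> \<in> tors R {t} (P (n - 1))"
    using tors_hom(1)[OF cx_module cx_module cx_hom'[of "n - 1"], of "{t}"] t e(2) by simp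
  finally obtain k :: nat where "(t [^]\<^bsub>R\<^esub> k) \<odot>\<^bsub>P (n - 1)\<^esub> (t \<odot>\<^bsub>P (n - 1)\<^esub> y') = \<zero>\<^bsub>P (n - 1)\<^esub>"
    by (auto simp: tors_def)
  then have "(t [^]\<^bsub>R\<^esub> Suc k) \<odot>\<^bsub>P (n - 1)\<^esub> y' = \<zero>\<^bsub>P (n - 1)\<^esub>"
    using P1.smult_pow_Suc(1)[OF t y'] by simp
  then have "(s [^]\<^bsub>R\<^esub> ((b + a) * Suc k)) \<odot>\<^bsub>P (n - 1)\<^esub> y' = \<zero>\<^bsub>P (n - 1)\<^esub>"
    using P0.R.nat_pow_pow[OF s, of "b + a" "Suc k"] by (simp only: t_def)
  then have "y' \<in> tors R {s} (P (n - 1))" using y' by (auto simp: tors_def)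
  moreover have "D (n - 1) y' = z"
  proof -
    have "D (n - 1) y' = z \<ominus>\<^bsub>P n\<^esub> D (n - 1) (D (n - 1 - 1) e)"
      unfolding y'_def y(2) by (rule mod_hom_diff[OF cx_module cx_module cx_hom' y(1) De])
    then show ?thesis using cx_square'[OF e(1)] d1(1)[OF y(1)] y(2) by simp
  qed
  ultimately show ?thesis by (force simp: bnd_def)
qed

text \<open>By \<open>tors_boundary\<close> each further element s costs one degree: in degree q
  torsion cocycles are boundaries of torsion elements as soon as the cohomology in degree q - 1 is
  s-torsion, and there it is already zero.\<close>

lemma tors_vanishing:
  assumes noeth: "noetherian_ring R" and baer: "\<And>n. baer_module R (P n)"
    and S: "finite S" "S \<subseteq> carrier R"
    and van: "\<And>q. q > e \<Longrightarrow> cyc P D q \<subseteq> bnd P D q"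
  shows "q > e + int (card S) \<Longrightarrow> cyc (\<lambda>n. tors_mod R S (P n)) D q \<subseteq> bnd (\<lambda>n. tors_mod R S (P n)) D q"
  using S
proof (induction S arbitrary: q rule: finite_induct)
  case empty
  then show ?case using van by simp
next
  case (insert s S)
  let ?T = "\<lambda>n. tors_mod R S (P n)"
  interpret T: int_complex R ?T D using tors_complex insert by simp
  have Tb: "baer_module R (?T n)" for n using baer_module_tors[OF noeth baer] insert by simp
  have q: "q > e + int (card S)" "q - 1 > e + int (card S)" using insert by auto
  have IH: "cyc ?T D q \<subseteq> bnd ?T D q" "cyc ?T D (q - 1) \<subseteq> bnd ?T D (q - 1)"
    using insert.IH q insert.prems by auto
  have "cyc (\<lambda>n. tors_mod R {s} (?T n)) D q \<subseteq> bnd (\<lambda>n. tors_mod R {s} (?T n)) D q"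
  proof
    fix z assume "z \<in> cyc (\<lambda>n. tors_mod R {s} (?T n)) D q"
    then have z: "z \<in> cyc ?T D q" "z \<in> tors R {s} (?T q)" unfolding T.cyc_tors by auto
    show "z \<in> bnd (\<lambda>n. tors_mod R {s} (?T n)) D q"
    proof (rule T.tors_boundary[OF noeth Tb _ _ z(2)])
      fix w assume w: "w \<in> cyc ?T D (q - 1)"
      then have "w \<in> bnd ?T D (q - 1)" using IH insert.prems by blast
      moreover have "(s [^]\<^bsub>R\<^esub> (0::nat)) \<odot>\<^bsub>?T (q - 1)\<^esub> w = w"
        using module.smult_one[OF T.cx_module T.cycD(1)[OF w]] by simp
      ultimately show "\<exists>k::nat. (s [^]\<^bsub>R\<^esub> k) \<odot>\<^bsub>?T (q - 1)\<^esub> w \<in> bnd ?T D (q - 1)" by metis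
    qed (use insert subsetD[OF IH(1) z(1)] in auto)
  qed
  then show ?case by (simp add: tors_Un)
qed

end

section \<open>Mapping cones\<close>

definition prod_mod :: "('x \<Rightarrow> 'f \<Rightarrow> 'y) \<Rightarrow> ('y \<Rightarrow> 'x) \<Rightarrow> ('y \<Rightarrow> 'f) \<Rightarrow> ('a, 'x) module \<Rightarrow> ('a, 'f) module \<Rightarrow> ('a, 'y) module"
  where "prod_mod p l r U V = \<lparr>carrier = {p u v | u v. u \<in> carrier U \<and> v \<in> carrier V},
    monoid.mult = undefined, one = undefined, ring.zero = p \<zero>\<^bsub>U\<^esub> \<zero>\<^bsub>V\<^esub>,
    ring.add = (\<lambda>a b. p (l a \<oplus>\<^bsub>U\<^esub> l b) (r a \<oplus>\<^bsub>V\<^esub> r b)), smult = (\<lambda>c a. p (c \<odot>\<^bsub>U\<^esub> l a) (c \<odot>\<^bsub>V\<^esub> r a))\<rparr>"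

text \<open>The encoding \<open>p\<close> of pairs is a parameter so that a cone of a complex with itself can live on
  the type of that complex.\<close>

locale pairing =
  fixes p :: "'x \<Rightarrow> 'f \<Rightarrow> 'y" and l :: "'y \<Rightarrow> 'x" and r :: "'y \<Rightarrow> 'f"
  assumes left [simp]: "l (p u v) = u" and right [simp]: "r (p u v) = v"
begin

lemma pair_eq_iff [simp]: "p u v = p u' v' \<longleftrightarrow> u = u' \<and> v = v'"
  by (metis left right)

lemma prod_mod_simps [simp]:
  "w \<in> carrier (prod_mod p l r U V) \<longleftrightarrow> (\<exists>u v. w = p u v \<and> u \<in> carrier U \<and> v \<in> carrier V)"
  "\<zero>\<^bsub>prod_mod p l r U V\<^esub> = p \<zero>\<^bsub>U\<^esub> \<zero>\<^bsub>V\<^esub>"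
  "a \<oplus>\<^bsub>prod_mod p l r U V\<^esub> b = p (l a \<oplus>\<^bsub>U\<^esub> l b) (r a \<oplus>\<^bsub>V\<^esub> r b)"
  "c \<odot>\<^bsub>prod_mod p l r U V\<^esub> a = p (c \<odot>\<^bsub>U\<^esub> l a) (c \<odot>\<^bsub>V\<^esub> r a)"
  by (auto simp: prod_mod_def)

lemma prod_module:
  assumes "module R U" "module R V"
  shows "module R (prod_mod p l r U V)"
proof -
  interpret U: module R U by fact
  interpret V: module R V by fact
  have "abelian_group (prod_mod p l r U V)"
  proof (rule abelian_groupI)
    fix x assume "x \<in> carrier (prod_mod p l r U V)"
    then obtain u v where uv: "x = p u v" "u \<in> carrier U" "v \<in> carrier V" by auto
    then show "\<exists>y\<in>carrier (prod_mod p l r U V). y \<oplus>\<^bsub>prod_mod p l r U V\<^esub> x = \<zero>\<^bsub>prod_mod p l r U V\<^esub>"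
      by (intro bexI[of _ "p (\<ominus>\<^bsub>U\<^esub> u) (\<ominus>\<^bsub>V\<^esub> v)"]) (auto simp: U.M.l_neg V.M.l_neg)
  qed (auto simp: U.M.a_ac V.M.a_ac)
  then show ?thesis
    by (intro moduleI U.R.is_cring)
      (auto simp: U.smult_l_distr V.smult_l_distr U.smult_r_distr V.smult_r_distr U.smult_assoc1 V.smult_assoc1)
qed

lemma prod_mod_homs:
  assumes "module R U" "module R V"
  shows "l \<in> mod_hom R (prod_mod p l r U V) U" "(\<lambda>v. p \<zero>\<^bsub>U\<^esub> v) \<in> mod_hom R V (prod_mod p l r U V)"
proof -
  interpret U: module R U by fact
  show "l \<in> mod_hom R (prod_mod p l r U V) U" by (rule mod_homI) auto
  show "(\<lambda>v. p \<zero>\<^bsub>U\<^esub> v) \<in> mod_hom R V (prod_mod p l r U V)" by (rule mod_homI) auto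
qed

lemma tors_prod_mod:
  assumes "module R U" "module R V" "S \<subseteq> carrier R"
  shows "tors_mod R S (prod_mod p l r U V) = prod_mod p l r (tors_mod R S U) (tors_mod R S V)"
proof -
  interpret U: module R U by fact
  interpret V: module R V by fact
  have "p u v \<in> tors R S (prod_mod p l r U V)" if uv: "u \<in> tors R S U" "v \<in> tors R S V" for u v
  proof -
    have "\<exists>n::nat. (s [^]\<^bsub>R\<^esub> n) \<odot>\<^bsub>U\<^esub> u = \<zero>\<^bsub>U\<^esub> \<and> (s [^]\<^bsub>R\<^esub> n) \<odot>\<^bsub>V\<^esub> v = \<zero>\<^bsub>V\<^esub>" if s: "s \<in> S" for s
    proof -
      obtain m n :: nat where "(s [^]\<^bsub>R\<^esub> m) \<odot>\<^bsub>U\<^esub> u = \<zero>\<^bsub>U\<^esub>" "(s [^]\<^bsub>R\<^esub> n) \<odot>\<^bsub>V\<^esub> v = \<zero>\<^bsub>V\<^esub>"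
        using uv s unfolding tors_def by blast
      then show ?thesis
        using U.pow_annihilates_mono[of s m u "max m n"] V.pow_annihilates_mono[of s n v "max m n"] uv s assms(3)
        by (intro exI[of _ "max m n"]) (auto simp: tors_def)
    qed
    then show ?thesis using uv by (auto simp: tors_def)
  qed
  moreover have "w \<in> tors R S (prod_mod p l r U V) \<Longrightarrow> \<exists>u v. w = p u v \<and> u \<in> tors R S U \<and> v \<in> tors R S V" for w
    by (auto simp: tors_def) blast+
  ultimately have "tors R S (prod_mod p l r U V) = {p u v | u v. u \<in> tors R S U \<and> v \<in> tors R S V}" by auto
  then show ?thesis by (simp add: tors_mod_def prod_mod_def)
qed

lemma baer_prod_mod:
  assumes U: "baer_module R U" and V: "baer_module R V"
  shows "baer_module R (prod_mod p l r U V)"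
  unfolding baer_module_def
proof (intro conjI allI impI)
  show "module R (prod_mod p l r U V)" using assms by (intro prod_module) (simp_all add: baer_module_def)
  fix I g assume "ideal I R \<and> (\<forall>r'\<in>I. g r' \<in> carrier (prod_mod p l r U V)) \<and>
     (\<forall>r'\<in>I. \<forall>s\<in>I. g (r' \<oplus>\<^bsub>R\<^esub> s) = g r' \<oplus>\<^bsub>prod_mod p l r U V\<^esub> g s) \<and>
     (\<forall>r'\<in>carrier R. \<forall>s\<in>I. g (r' \<otimes>\<^bsub>R\<^esub> s) = r' \<odot>\<^bsub>prod_mod p l r U V\<^esub> g s)"
  then have I: "ideal I R" and g: "\<And>a. a \<in> I \<Longrightarrow> g a \<in> carrier (prod_mod p l r U V)"
    "\<And>a b. a \<in> I \<Longrightarrow> b \<in> I \<Longrightarrow> g (a \<oplus>\<^bsub>R\<^esub> b) = g a \<oplus>\<^bsub>prod_mod p l r U V\<^esub> g b"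
    "\<And>a b. a \<in> carrier R \<Longrightarrow> b \<in> I \<Longrightarrow> g (a \<otimes>\<^bsub>R\<^esub> b) = a \<odot>\<^bsub>prod_mod p l r U V\<^esub> g b" by auto
  have glr: "l (g a) \<in> carrier U" "r (g a) \<in> carrier V" "g a = p (l (g a)) (r (g a))" if "a \<in> I" for a
    using g(1)[OF that] by auto
  obtain e where e: "e \<in> carrier U" "\<And>a. a \<in> I \<Longrightarrow> l (g a) = a \<odot>\<^bsub>U\<^esub> e"
    by (rule baer_moduleD[OF U I, of "\<lambda>a. l (g a)"]) (use glr g(2,3) in auto)
  obtain e' where e': "e' \<in> carrier V" "\<And>a. a \<in> I \<Longrightarrow> r (g a) = a \<odot>\<^bsub>V\<^esub> e'"
    by (rule baer_moduleD[OF V I, of "\<lambda>a. r (g a)"]) (use glr g(2,3) in auto)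
  show "\<exists>e\<in>carrier (prod_mod p l r U V). \<forall>a\<in>I. g a = a \<odot>\<^bsub>prod_mod p l r U V\<^esub> e"
    using e e' glr(3) by (intro bexI[of _ "p e e'"]) auto
qed

end

locale cone = P: int_complex R P D + Q: int_complex R Q D' + pairing p l r
  for R :: "('a, 'r) ring_scheme" and P :: "int \<Rightarrow> ('a, 'x) module" and D
    and Q :: "int \<Rightarrow> ('a, 'f) module" and D' and p :: "'x \<Rightarrow> 'f \<Rightarrow> 'y" and l r +
  fixes \<psi> :: "int \<Rightarrow> 'x \<Rightarrow> 'f"
  assumes chain_hom: "\<psi> n \<in> mod_hom R (P n) (Q n)"
    and chain_commute: "x \<in> carrier (P n) \<Longrightarrow> \<psi> (n + 1) (D n x) = D' n (\<psi> n x)"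

text \<open>The usual cone shifted by one degree, so that the long exact sequence reads H^(n-1) Q ->
  H^n K -> H^n P -> H^n Q.\<close>

definition cone_mod where "cone_mod p l r P Q n = prod_mod p l r (P n) (Q (n - 1 :: int))"

text \<open>The sign is a scalar because \<open>a_inv\<close> of a submodule record is a different function.\<close>

definition cone_diff where
  "cone_diff R p l r D Q D' \<psi> n w =
     p (D n (l w)) (\<psi> n (l w) \<oplus>\<^bsub>Q n\<^esub> (\<ominus>\<^bsub>R\<^esub> \<one>\<^bsub>R\<^esub>) \<odot>\<^bsub>Q n\<^esub> D' (n - 1 :: int) (r w))"

context cone
begin

abbreviation "K \<equiv> cone_mod p l r P Q"
abbreviation "KD \<equiv> cone_diff R p l r D Q D' \<psi>"

lemma chain_commute': "x \<in> carrier (P (n - 1)) \<Longrightarrow> \<psi> n (D (n - 1) x) = D' (n - 1) (\<psi> (n - 1) x)"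
  using chain_commute[of x "n - 1"] by simp

lemma cone_diff_pair:
  assumes "u \<in> carrier (P n)" "v \<in> carrier (Q (n - 1))"
  shows "KD n (p u v) = p (D n u) (\<psi> n u \<ominus>\<^bsub>Q n\<^esub> D' (n - 1) v)"
proof -
  interpret Qn: module R "Q n" by (rule Q.cx_module)
  show ?thesis using assms mod_homD(1)[OF Q.cx_hom'] by (simp add: cone_diff_def Qn.neg_one_smult a_minus_def)
qed

lemma cone_complex: "int_complex R K KD"
proof (rule int_complex.intro)
  fix n
  interpret Pn: module R "P n" by (rule P.cx_module)
  interpret Pm: module R "P (n + 1)" by (rule P.cx_module)
  interpret Qn: module R "Q n" by (rule Q.cx_module)
  interpret Qm: module R "Q (n + 1)" by (rule Q.cx_module)
  interpret Ql: module R "Q (n - 1)" by (rule Q.cx_module)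
  note homs = mod_homD[OF P.cx_hom[of n]] mod_homD[OF Q.cx_hom'[of n]] mod_homD[OF chain_hom[of n]]
  show "module R (K n)" unfolding cone_mod_def by (intro prod_module P.cx_module Q.cx_module)
  show "KD n \<in> mod_hom R (K n) (K (n + 1))"
    unfolding cone_mod_def cone_diff_def
    by (rule mod_homI) (auto simp: homs Qn.smult_r_distr Qn.M.a_ac Qn.smult_comm[of "\<ominus>\<^bsub>R\<^esub> \<one>\<^bsub>R\<^esub>"])
  fix x assume "x \<in> carrier (K n)"
  then obtain u v where uv: "x = p u v" "u \<in> carrier (P n)" "v \<in> carrier (Q (n - 1))"
    by (auto simp: cone_mod_def)
  have c: "D n u \<in> carrier (P (n + 1))" "\<psi> n u \<in> carrier (Q n)" "D' (n - 1) v \<in> carrier (Q n)"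
    "\<psi> n u \<ominus>\<^bsub>Q n\<^esub> D' (n - 1) v \<in> carrier (Q n)" using homs uv by auto
  have "D' n (\<psi> n u \<ominus>\<^bsub>Q n\<^esub> D' (n - 1) v) = D' n (\<psi> n u) \<ominus>\<^bsub>Q (n + 1)\<^esub> \<zero>\<^bsub>Q (n + 1)\<^esub>"
    using mod_hom_diff[OF Q.cx_module Q.cx_module Q.cx_hom c(2,3)] Q.cx_square'[OF uv(3)] by simp
  then have "KD (n + 1) (KD n x) = p (D (n + 1) (D n u)) (D' n (\<psi> n u) \<ominus>\<^bsub>Q (n + 1)\<^esub> D' n (\<psi> n u))"
    using c uv cone_diff_pair[of u n v] cone_diff_pair[of "D n u" "n + 1" "\<psi> n u \<ominus>\<^bsub>Q n\<^esub> D' (n - 1) v"]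
      chain_commute[OF uv(2)] mod_homD(1)[OF Q.cx_hom[of n]] by simp
  then have "KD (n + 1) (KD n x) = p \<zero>\<^bsub>P (n + 2)\<^esub> \<zero>\<^bsub>Q (n + 1)\<^esub>"
    using P.cx_square[OF uv(2)] mod_homD(1)[OF Q.cx_hom[of n] c(2)] by simp
  moreover have "n + 2 - 1 = n + 1" by simp
  ultimately show "KD (n + 1) (KD n x) = \<zero>\<^bsub>K (n + 2)\<^esub>" by (simp only: cone_mod_def prod_mod_simps)
qed

sublocale K: int_complex R K KD by (rule cone_complex)

lemma cone_baer: "(\<And>n. baer_module R (P n)) \<Longrightarrow> (\<And>n. baer_module R (Q n)) \<Longrightarrow> baer_module R (K n)"
  unfolding cone_mod_def by (intro baer_prod_mod)

text \<open>Torsion commutes with finite direct sums, and the differential is literally the same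
  function because \<open>tors_mod\<close> keeps the operations of a module.\<close>

lemma cone_tors:
  assumes S: "S \<subseteq> carrier R"
  shows "cone R (\<lambda>n. tors_mod R S (P n)) D (\<lambda>n. tors_mod R S (Q n)) D' p l r \<psi>"
    and "(\<lambda>n. tors_mod R S (K n)) = cone_mod p l r (\<lambda>n. tors_mod R S (P n)) (\<lambda>n. tors_mod R S (Q n))"
    and "cone_diff R p l r D (\<lambda>n. tors_mod R S (Q n)) D' \<psi> = KD"
proof -
  interpret TP: int_complex R "\<lambda>n. tors_mod R S (P n)" D by (rule P.tors_complex[OF S])
  interpret TQ: int_complex R "\<lambda>n. tors_mod R S (Q n)" D' by (rule Q.tors_complex[OF S])
  show "cone R (\<lambda>n. tors_mod R S (P n)) D (\<lambda>n. tors_mod R S (Q n)) D' p l r \<psi>"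
  proof unfold_locales
    show "\<psi> n \<in> mod_hom R (tors_mod R S (P n)) (tors_mod R S (Q n))" for n
      by (rule tors_hom(2)[OF P.cx_module Q.cx_module chain_hom S])
    show "\<psi> (n + 1) (D n x) = D' n (\<psi> n x)" if "x \<in> carrier (tors_mod R S (P n))" for x n
      using that chain_commute[of x n] tors_subset[of R S "P n"] by auto
  qed
  show "(\<lambda>n. tors_mod R S (K n)) = cone_mod p l r (\<lambda>n. tors_mod R S (P n)) (\<lambda>n. tors_mod R S (Q n))"
    by (auto simp: cone_mod_def tors_prod_mod[OF P.cx_module Q.cx_module S])
  show "cone_diff R p l r D (\<lambda>n. tors_mod R S (Q n)) D' \<psi> = KD"
    by (simp add: cone_diff_def fun_eq_iff)
qed

section \<open>The long exact sequence of a cone\<close>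

lemma cone_carrier: "w \<in> carrier (K n) \<longleftrightarrow> (\<exists>u v. w = p u v \<and> u \<in> carrier (P n) \<and> v \<in> carrier (Q (n - 1)))"
  by (simp add: cone_mod_def)

lemma cyc_cone_iff: "w \<in> cyc K KD n \<longleftrightarrow>
  (\<exists>u v. w = p u v \<and> u \<in> cyc P D n \<and> v \<in> carrier (Q (n - 1)) \<and> \<psi> n u = D' (n - 1) v)"
proof -
  interpret Qn: module R "Q n" by (rule Q.cx_module)
  have "\<psi> n u \<ominus>\<^bsub>Q n\<^esub> D' (n - 1) v = \<zero>\<^bsub>Q n\<^esub> \<longleftrightarrow> \<psi> n u = D' (n - 1) v"
    if "u \<in> carrier (P n)" "v \<in> carrier (Q (n - 1))" for u v
    using mod_homD(1)[OF chain_hom] mod_homD(1)[OF Q.cx_hom'] that by (intro Qn.minus_eq_zero_iff)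
  moreover have "w \<in> cyc K KD n \<longleftrightarrow> (\<exists>u v. w = p u v \<and> u \<in> carrier (P n) \<and> v \<in> carrier (Q (n - 1)) \<and>
      KD n (p u v) = p \<zero>\<^bsub>P (n + 1)\<^esub> \<zero>\<^bsub>Q n\<^esub>)"
    by (auto simp: cyc_def cone_mod_def)
  ultimately have iff: "w \<in> cyc K KD n \<longleftrightarrow> (\<exists>u v. w = p u v \<and> u \<in> carrier (P n) \<and> v \<in> carrier (Q (n - 1)) \<and>
      D n u = \<zero>\<^bsub>P (n + 1)\<^esub> \<and> \<psi> n u = D' (n - 1) v)"
    by (simp add: cone_diff_pair cong: conj_cong)
  then show ?thesis using cyc_def[of P D n] by blast
qed

lemma bnd_cone_iff: "w \<in> bnd K KD n \<longleftrightarrow>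
  (\<exists>u v. w = p (D (n - 1) u) (\<psi> (n - 1) u \<ominus>\<^bsub>Q (n - 1)\<^esub> D' (n - 1 - 1) v) \<and>
     u \<in> carrier (P (n - 1)) \<and> v \<in> carrier (Q (n - 1 - 1)))"
proof -
  have "w \<in> bnd K KD n \<longleftrightarrow> (\<exists>x\<in>carrier (K (n - 1)). w = KD (n - 1) x)" by (auto simp: bnd_def)
  also have "\<dots> \<longleftrightarrow> (\<exists>u v. u \<in> carrier (P (n - 1)) \<and> v \<in> carrier (Q (n - 1 - 1)) \<and> w = KD (n - 1) (p u v))"
    unfolding Bex_def cone_carrier by blast
  finally show ?thesis using cone_diff_pair[of _ "n - 1"] by metis
qed

text \<open>Exactness of H^(n-1) Q -> H^n K -> H^n P, where the first map is v -> (0, v) and the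
  second is the projection.\<close>

lemma chain_cond_cone:
  assumes "chain_cond asc R (P n) (bnd P D n) (cyc P D n)"
    and "chain_cond asc R (Q (n - 1)) (bnd Q D' (n - 1)) (cyc Q D' (n - 1))"
  shows "chain_cond asc R (K n) (bnd K KD n) (cyc K KD n)"
proof (rule chain_cond_exact[OF Q.cx_module[of "n - 1"] K.cx_module P.cx_module _ _ Q.cyc_submodule
      P.cyc_submodule P.bnd_submodule Q.bnd_subset_cyc P.bnd_subset_cyc _ _ _ assms(2,1)])
  interpret Pn: module R "P n" by (rule P.cx_module)
  interpret Pm: module R "P (n - 1)" by (rule P.cx_module)
  interpret Qm: module R "Q (n - 1)" by (rule Q.cx_module)
  interpret Qk: module R "Q (n - 1 - 1)" by (rule Q.cx_module)
  show "l \<in> mod_hom R (K n) (P n)" "(\<lambda>v. p \<zero>\<^bsub>P n\<^esub> v) \<in> mod_hom R (Q (n - 1)) (K n)"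
    unfolding cone_mod_def using prod_mod_homs[OF P.cx_module Q.cx_module] by auto
  fix v assume "v \<in> bnd Q D' (n - 1)"
  then obtain v' where v': "v' \<in> carrier (Q (n - 1 - 1))" "v = D' (n - 1 - 1) v'" by (auto simp: bnd_def)
  have vc: "D' (n - 1 - 1) v' \<in> carrier (Q (n - 1))" using mod_homD(1)[OF Q.cx_hom'[of "n - 1"] v'(1)] by simp
  show "p \<zero>\<^bsub>P n\<^esub> v \<in> bnd K KD n"
    unfolding bnd_cone_iff
  proof (intro exI conjI)
    show "p \<zero>\<^bsub>P n\<^esub> v = p (D (n - 1) \<zero>\<^bsub>P (n - 1)\<^esub>)
      (\<psi> (n - 1) \<zero>\<^bsub>P (n - 1)\<^esub> \<ominus>\<^bsub>Q (n - 1)\<^esub> D' (n - 1 - 1) (\<ominus>\<^bsub>Q (n - 1 - 1)\<^esub> v'))"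
      using mod_hom_minus[OF Q.cx_module Q.cx_module Q.cx_hom'[of "n - 1"] v'(1)] vc v'
        mod_hom_zero[OF P.cx_module P.cx_module P.cx_hom'[of n]]
        mod_hom_zero[OF P.cx_module Q.cx_module chain_hom[of "n - 1"]] by (simp add: Qm.M.minus_eq)
    show "\<ominus>\<^bsub>Q (n - 1 - 1)\<^esub> v' \<in> carrier (Q (n - 1 - 1))" using v'(1) by (rule Qk.M.a_inv_closed)
  qed simp
next
  fix w assume "w \<in> cyc K KD n"
  then show "l w \<in> cyc P D n" by (auto simp: cyc_cone_iff)
next
  interpret Pn: module R "P n" by (rule P.cx_module)
  interpret Qm: module R "Q (n - 1)" by (rule Q.cx_module)
  interpret Qk: module R "Q (n - 1 - 1)" by (rule Q.cx_module)
  interpret Qn: module R "Q n" by (rule Q.cx_module)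
  fix w assume "w \<in> cyc K KD n" "l w \<in> bnd P D n"
  then obtain u v where uv: "w = p u v" "u \<in> cyc P D n" "v \<in> carrier (Q (n - 1))" "\<psi> n u = D' (n - 1) v"
    "u \<in> bnd P D n" by (auto simp: cyc_cone_iff)
  then obtain u' where u': "u' \<in> carrier (P (n - 1))" "u = D (n - 1) u'" by (auto simp: bnd_def)
  have c: "\<psi> (n - 1) u' \<in> carrier (Q (n - 1))" using mod_homD(1)[OF chain_hom u'(1)] .
  have "D' (n - 1) (v \<ominus>\<^bsub>Q (n - 1)\<^esub> \<psi> (n - 1) u') = D' (n - 1) v \<ominus>\<^bsub>Q n\<^esub> D' (n - 1) v"
    using mod_hom_diff[OF Q.cx_module Q.cx_module Q.cx_hom' uv(3) c] chain_commute'[OF u'(1)] u' uv by simp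
  then have "v \<ominus>\<^bsub>Q (n - 1)\<^esub> \<psi> (n - 1) u' \<in> cyc Q D' (n - 1)"
    using mod_homD(1)[OF Q.cx_hom' uv(3)] c uv by (simp add: cyc_def Qn.M.minus_eq Qn.M.r_neg)
  moreover have "p u (\<psi> (n - 1) u') \<in> bnd K KD n"
    unfolding bnd_cone_iff
  proof (intro exI conjI)
    show "p u (\<psi> (n - 1) u') = p (D (n - 1) u') (\<psi> (n - 1) u' \<ominus>\<^bsub>Q (n - 1)\<^esub> D' (n - 1 - 1) \<zero>\<^bsub>Q (n - 1 - 1)\<^esub>)"
      using mod_hom_zero[OF Q.cx_module Q.cx_module Q.cx_hom'[of "n - 1"]] u' c by simp
  qed (fact u'(1), rule Qk.M.zero_closed)
  moreover have "w = p \<zero>\<^bsub>P n\<^esub> (v \<ominus>\<^bsub>Q (n - 1)\<^esub> \<psi> (n - 1) u') \<oplus>\<^bsub>K n\<^esub> p u (\<psi> (n - 1) u')"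
    using uv c P.cycD(1)[OF uv(2)] by (simp add: cone_mod_def Qm.M.minus_eq Qm.M.a_assoc Qm.M.l_neg)
  ultimately show "\<exists>y\<in>cyc Q D' (n - 1). \<exists>b\<in>bnd K KD n. w = p \<zero>\<^bsub>P n\<^esub> y \<oplus>\<^bsub>K n\<^esub> b" by blast
qed

text \<open>The projection maps H^n K onto the kernel of H^n P -> H^n Q.\<close>

lemma chain_cond_kernel:
  assumes "chain_cond asc R (K n) (bnd K KD n) (cyc K KD n)"
  shows "chain_cond asc R (P n) (bnd P D n) {u \<in> cyc P D n. \<psi> n u \<in> bnd Q D' n}"
proof (rule chain_cond_image[OF K.cx_module P.cx_module _ K.cyc_submodule _ K.bnd_subset_cyc _ _ assms])
  interpret Pn: module R "P n" by (rule P.cx_module)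
  show "l \<in> mod_hom R (K n) (P n)"
    unfolding cone_mod_def using prod_mod_homs[OF P.cx_module Q.cx_module] by auto
  show "submodule {u \<in> cyc P D n. \<psi> n u \<in> bnd Q D' n} R (P n)"
    by (rule Pn.submodule_preimage[OF chain_hom Q.cx_module P.cyc_submodule Q.bnd_submodule])
  show "l w \<in> bnd P D n" if "w \<in> bnd K KD n" for w
    using that P.bndI[of _ n] by (auto simp: bnd_cone_iff)
  fix u assume "u \<in> {u \<in> cyc P D n. \<psi> n u \<in> bnd Q D' n}"
  then obtain v where v: "u \<in> cyc P D n" "v \<in> carrier (Q (n - 1))" "\<psi> n u = D' (n - 1) v" by (auto simp: bnd_def)
  then have "p u v \<in> cyc K KD n" by (auto simp: cyc_cone_iff)
  moreover have "u = l (p u v) \<oplus>\<^bsub>P n\<^esub> \<zero>\<^bsub>P n\<^esub>" using P.cycD(1)[OF v(1)] by simp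
  ultimately show "\<exists>y\<in>cyc K KD n. \<exists>b\<in>bnd P D n. u = l y \<oplus>\<^bsub>P n\<^esub> b"
    using submodule_memD(3)[OF P.bnd_submodule] by metis
qed

text \<open>The kernel of H^n P -> H^n Q is controlled by the cone, the image by
  \<open>Q\<close>.\<close>

lemma chain_cond_source:
  assumes "chain_cond asc R (K n) (bnd K KD n) (cyc K KD n)"
    and "chain_cond asc R (Q n) (bnd Q D' n) (cyc Q D' n)"
  shows "chain_cond asc R (P n) (bnd P D n) (cyc P D n)"
proof (rule chain_cond_trans[OF P.cx_module _ P.cyc_submodule _ _ chain_cond_kernel[OF assms(1)]])
  interpret Pn: module R "P n" by (rule P.cx_module)
  let ?N = "{u \<in> cyc P D n. \<psi> n u \<in> bnd Q D' n}"
  show "submodule ?N R (P n)"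
    by (rule Pn.submodule_preimage[OF chain_hom Q.cx_module P.cyc_submodule Q.bnd_submodule])
  show "bnd P D n \<subseteq> ?N"
  proof
    fix u assume u: "u \<in> bnd P D n"
    then obtain u' where "u' \<in> carrier (P (n - 1))" "u = D (n - 1) u'" by (auto simp: bnd_def)
    then show "u \<in> ?N" using u P.bnd_subset_cyc chain_commute' Q.bndI mod_homD(1)[OF chain_hom] by auto
  qed
  show "?N \<subseteq> cyc P D n" by auto
  show "\<zero>\<^bsub>P n\<^esub> \<in> bnd P D n" by (rule submodule_memD(3)[OF P.bnd_submodule])
  have cyc: "\<psi> n u \<in> cyc Q D' n" if "u \<in> cyc P D n" for u
  proof -
    have "\<psi> (n + 1) (D n u) = \<zero>\<^bsub>Q (n + 1)\<^esub>"
      using P.cycD(2)[OF that] mod_hom_zero[OF P.cx_module Q.cx_module chain_hom] by simp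
    then show ?thesis using chain_commute[OF P.cycD(1)[OF that]] mod_homD(1)[OF chain_hom P.cycD(1)[OF that]]
      by (simp add: cyc_def)
  qed
  show "chain_cond asc R (P n) ?N (cyc P D n)"
    by (rule chain_cond_inj[OF P.cx_module Q.cx_module chain_hom Q.cyc_submodule Q.bnd_submodule
          Q.bnd_subset_cyc cyc _ assms(2)])
      (use submodule_memD(3)[OF P.cyc_submodule] mod_hom_zero[OF P.cx_module Q.cx_module chain_hom]
        submodule_memD(3)[OF Q.bnd_submodule] in auto)
qed

text \<open>Exactness of H^n P -> H^n Q -> H^(n+1) K, where the second map is v -> (0, v).\<close>

lemma chain_cond_target:
  assumes "chain_cond asc R (P n) (bnd P D n) (cyc P D n)"
    and "chain_cond asc R (K (n + 1)) (bnd K KD (n + 1)) (cyc K KD (n + 1))"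
  shows "chain_cond asc R (Q n) (bnd Q D' n) (cyc Q D' n)"
proof (rule chain_cond_exact[OF P.cx_module Q.cx_module K.cx_module chain_hom[of n] _ P.cyc_submodule
      K.cyc_submodule K.bnd_submodule P.bnd_subset_cyc K.bnd_subset_cyc _ _ _ assms])
  interpret Pm: module R "P (n + 1)" by (rule P.cx_module)
  interpret Qn: module R "Q n" by (rule Q.cx_module)
  show "(\<lambda>v. p \<zero>\<^bsub>P (n + 1)\<^esub> v) \<in> mod_hom R (Q n) (K (n + 1))"
    unfolding cone_mod_def using prod_mod_homs(2)[OF P.cx_module Q.cx_module, of "n + 1" n] by simp
  show "\<psi> n u \<in> bnd Q D' n" if u: "u \<in> bnd P D n" for u
  proof -
    obtain u' where "u' \<in> carrier (P (n - 1))" "u = D (n - 1) u'" using u by (auto simp: bnd_def)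
    then show ?thesis using chain_commute' Q.bndI mod_homD(1)[OF chain_hom] by auto
  qed
  show "p \<zero>\<^bsub>P (n + 1)\<^esub> v \<in> cyc K KD (n + 1)" if "v \<in> cyc Q D' n" for v
    using that submodule_memD(3)[OF P.cyc_submodule] mod_hom_zero[OF P.cx_module Q.cx_module chain_hom]
      Q.cycD[OF that] unfolding cyc_cone_iff by (intro exI[of _ "\<zero>\<^bsub>P (n + 1)\<^esub>"] exI[of _ v]) simp
  fix z assume z: "z \<in> cyc Q D' n" "p \<zero>\<^bsub>P (n + 1)\<^esub> z \<in> bnd K KD (n + 1)"
  then obtain u v where uv: "u \<in> carrier (P n)" "v \<in> carrier (Q (n - 1))" "\<zero>\<^bsub>P (n + 1)\<^esub> = D n u"
    "z = \<psi> n u \<ominus>\<^bsub>Q n\<^esub> D' (n - 1) v" by (auto simp: bnd_cone_iff)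
  have "\<ominus>\<^bsub>Q n\<^esub> D' (n - 1) v \<in> bnd Q D' n"
    using submodule_memD(6)[OF Q.bnd_submodule] Q.bndI uv by blast
  then show "\<exists>y\<in>cyc P D n. \<exists>b\<in>bnd Q D' n. z = \<psi> n y \<oplus>\<^bsub>Q n\<^esub> b"
    using uv by (intro bexI[of _ u] bexI[of _ "\<ominus>\<^bsub>Q n\<^esub> D' (n - 1) v"]) (auto simp: cyc_def a_minus_def)
qed

end

section \<open>Splitting off the top cohomology module\<close>

text \<open>\<open>F\<close> is an injective resolution of H^k P. Its augmentation is given as a map
  \<open>h\<close> on cocycles with the boundaries as kernel, so that the coset type of H^k P does
  not appear.\<close>

definition resolves ::
  "('a, 'r) ring_scheme \<Rightarrow> (int \<Rightarrow> ('a, 'x) module) \<Rightarrow> (int \<Rightarrow> 'x \<Rightarrow> 'x) \<Rightarrow> int \<Rightarrow>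
    (int \<Rightarrow> ('a, 'f) module) \<Rightarrow> (int \<Rightarrow> 'f \<Rightarrow> 'f) \<Rightarrow> ('x \<Rightarrow> 'f) \<Rightarrow> bool"
  where "resolves R P D k F D' h \<longleftrightarrow> int_complex R F D' \<and> (\<forall>n. injective_module R (F n)) \<and>
    (\<forall>n<0. carrier (F n) = {\<zero>\<^bsub>F n\<^esub>}) \<and> (\<forall>n>0. cyc F D' n \<subseteq> bnd F D' n) \<and>
    h \<in> mod_hom R ((P k)\<lparr>carrier := cyc P D k\<rparr>) (F 0) \<and>
    {z \<in> cyc P D k. h z = \<zero>\<^bsub>F 0\<^esub>} = bnd P D k \<and> h ` cyc P D k = cyc F D' 0"

lemma mod_hom_compose:
  "f \<in> mod_hom R U V \<Longrightarrow> g \<in> mod_hom R V W \<Longrightarrow> (\<lambda>x. g (f x)) \<in> mod_hom R U W"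
  by (rule mod_homI) (simp_all add: mod_homD[of f R U V] mod_homD[of g R V W])

context int_complex
begin

text \<open>D' f vanishes on cocycles, so it factors through D as a map on the boundaries in degree
  n + 1, and this extends to P (n + 1) because F (j + 1) is injective. Exactness of \<open>P\<close>
  in degree n + 1 gives the vanishing needed for the next step.\<close>

lemma lift_chain_map_step:
  assumes F: "int_complex R F D'" and inj: "injective_module R (F (j + 1))"
    and f: "f \<in> mod_hom R (P n) (F j)" and kill: "\<And>z. z \<in> cyc P D n \<Longrightarrow> D' j (f z) = \<zero>\<^bsub>F (j + 1)\<^esub>"
    and exact: "cyc P D (n + 1) \<subseteq> bnd P D (n + 1)"
  shows "\<exists>f'\<in>mod_hom R (P (n + 1)) (F (j + 1)). (\<forall>x\<in>carrier (P n). f' (D n x) = D' j (f x)) \<and>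
    (\<forall>z\<in>cyc P D (n + 1). D' (j + 1) (f' z) = \<zero>\<^bsub>F (j + 2)\<^esub>)"
proof -
  interpret F: int_complex R F D' by fact
  interpret Pn: module R "P n" by (rule cx_module)
  interpret Pm: module R "P (n + 1)" by (rule cx_module)
  interpret Fj: module R "F j" by (rule F.cx_module)
  interpret Fm: module R "F (j + 1)" by (rule F.cx_module)
  note Dh = mod_homD[OF cx_hom[of n]]
  define a where "a x = D' j (f x)" for x
  have a: "a \<in> mod_hom R (P n) (F (j + 1))" unfolding a_def by (rule mod_hom_compose[OF f F.cx_hom])
  \<comment> \<open>Independent of the chosen preimage: two of them differ by a cocycle, on which
    \<open>a\<close> vanishes.\<close>
  define g where "g y = a (SOME x. x \<in> carrier (P n) \<and> D n x = y)" for y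
  have g: "g (D n x) = a x" if x: "x \<in> carrier (P n)" for x
  proof -
    define x' where "x' = (SOME x'. x' \<in> carrier (P n) \<and> D n x' = D n x)"
    have x': "x' \<in> carrier (P n) \<and> D n x' = D n x" unfolding x'_def by (rule someI_ex) (use x in auto)
    have "x' \<ominus>\<^bsub>P n\<^esub> x \<in> cyc P D n"
      using mod_hom_diff[OF cx_module cx_module cx_hom, of x' n x] x x' Dh(1)[OF x] by (simp add: cyc_def)
    then have "a x' \<ominus>\<^bsub>F (j + 1)\<^esub> a x = \<zero>\<^bsub>F (j + 1)\<^esub>"
      using kill mod_hom_diff[OF cx_module F.cx_module a, of x' x] x x' by (simp add: a_def)
    then have "a x' = a x" using Fm.minus_eq_zero_iff mod_homD(1)[OF a] x x' by blast
    then show ?thesis by (simp add: g_def x'_def)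
  qed
  have bnd: "bnd P D (n + 1) = D n ` carrier (P n)" by (simp add: bnd_def)
  have "g \<in> mod_hom R ((P (n + 1))\<lparr>carrier := bnd P D (n + 1)\<rparr>) (F (j + 1))"
  proof (rule mod_homI)
    fix y assume "y \<in> carrier ((P (n + 1))\<lparr>carrier := bnd P D (n + 1)\<rparr>)"
    then obtain x where x: "x \<in> carrier (P n)" "y = D n x" by (auto simp: bnd)
    then show "g y \<in> carrier (F (j + 1))" using g mod_homD(1)[OF a] by simp
    fix r assume r: "r \<in> carrier R"
    have "g (D n (r \<odot>\<^bsub>P n\<^esub> x)) = a (r \<odot>\<^bsub>P n\<^esub> x)" using g r x by simp
    then show "g (r \<odot>\<^bsub>(P (n + 1))\<lparr>carrier := bnd P D (n + 1)\<rparr>\<^esub> y) = r \<odot>\<^bsub>F (j + 1)\<^esub> g y"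
      using x r Dh(3) mod_homD(3)[OF a] g by simp
  next
    fix y y' assume "y \<in> carrier ((P (n + 1))\<lparr>carrier := bnd P D (n + 1)\<rparr>)"
      "y' \<in> carrier ((P (n + 1))\<lparr>carrier := bnd P D (n + 1)\<rparr>)"
    then obtain x x' where x: "x \<in> carrier (P n)" "y = D n x" "x' \<in> carrier (P n)" "y' = D n x'" by (auto simp: bnd)
    have "g (D n (x \<oplus>\<^bsub>P n\<^esub> x')) = a (x \<oplus>\<^bsub>P n\<^esub> x')" using g x by simp
    then show "g (y \<oplus>\<^bsub>(P (n + 1))\<lparr>carrier := bnd P D (n + 1)\<rparr>\<^esub> y') = g y \<oplus>\<^bsub>F (j + 1)\<^esub> g y'"
      using x Dh(2) mod_homD(2)[OF a] g by simp
  qed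
  then obtain f' where f': "f' \<in> mod_hom R (P (n + 1)) (F (j + 1))" "\<And>y. y \<in> bnd P D (n + 1) \<Longrightarrow> f' y = g y"
    using injective_module_extend[OF inj cx_module bnd_submodule] by blast
  have comm: "f' (D n x) = D' j (f x)" if "x \<in> carrier (P n)" for x
    using f'(2)[of "D n x"] g[OF that] that by (auto simp: a_def bnd)
  have "D' (j + 1) (f' z) = \<zero>\<^bsub>F (j + 2)\<^esub>" if "z \<in> cyc P D (n + 1)" for z
  proof -
    obtain x where x: "x \<in> carrier (P n)" "z = D n x" using \<open>z \<in> cyc P D (n + 1)\<close> exact by (auto simp: bnd)
    then show ?thesis using comm F.cx_square mod_homD(1)[OF f] by simp
  qed
  then show ?thesis using f'(1) comm by blast
qed

text \<open>By injectivity \<open>h\<close> extends from the cocycles to P k. As D' h = 0 on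
  cocycles, the recursive lifting can start, and it runs upwards because \<open>P\<close> is exact
  above k. Below k the map is zero; it commutes with the differential at k - 1 because
  \<open>h\<close> kills boundaries.\<close>

lemma lift_chain_map:
  assumes van: "\<And>q. q > k \<Longrightarrow> cyc P D q \<subseteq> bnd P D q" and res: "resolves R P D k F D' h"
  shows "\<exists>\<psi>. cone R P D (\<lambda>n. F (n - k)) (\<lambda>n. D' (n - k)) Pair fst snd \<psi> \<and>
    (\<forall>z\<in>cyc P D k. \<psi> k z = h z) \<and> (\<forall>n<k. \<forall>x. \<psi> n x = \<zero>\<^bsub>F (n - k)\<^esub>)"
proof -
  interpret F: int_complex R F D' using res by (simp add: resolves_def)
  have inj: "injective_module R (F n)" and Fneg: "n < 0 \<Longrightarrow> carrier (F n) = {\<zero>\<^bsub>F n\<^esub>}"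
    and h: "h \<in> mod_hom R ((P k)\<lparr>carrier := cyc P D k\<rparr>) (F 0)"
    and hker: "{z \<in> cyc P D k. h z = \<zero>\<^bsub>F 0\<^esub>} = bnd P D k" and him: "h ` cyc P D k = cyc F D' 0" for n
    using res unfolding resolves_def by auto
  define good where "good i f \<longleftrightarrow> f \<in> mod_hom R (P (k + int i)) (F (int i)) \<and>
    (\<forall>z\<in>cyc P D (k + int i). D' (int i) (f z) = \<zero>\<^bsub>F (int i + 1)\<^esub>) \<and>
    (i = 0 \<longrightarrow> (\<forall>z\<in>cyc P D k. f z = h z))" for i f
  obtain f0 where f0: "f0 \<in> mod_hom R (P k) (F 0)" "\<And>z. z \<in> cyc P D k \<Longrightarrow> f0 z = h z"
    using injective_module_extend[OF inj cx_module cyc_submodule h] by blast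
  have "good 0 f0" using f0 him F.cycD(2)[of _ 0] unfolding good_def by auto
  then have 1: "\<exists>f. good 0 f" by blast
  have 2: "\<exists>f'. good (Suc i) f' \<and> (\<forall>x\<in>carrier (P (k + int i)). f' (D (k + int i) x) = D' (int i) (f x))"
    if "good i f" for i f
  proof -
    have "\<exists>f'\<in>mod_hom R (P (k + int i + 1)) (F (int i + 1)). (\<forall>x\<in>carrier (P (k + int i)). f' (D (k + int i) x) = D' (int i) (f x)) \<and>
      (\<forall>z\<in>cyc P D (k + int i + 1). D' (int i + 1) (f' z) = \<zero>\<^bsub>F (int i + 2)\<^esub>)"
      by (rule lift_chain_map_step[OF F.int_complex_axioms inj])
        (use \<open>good i f\<close> van in \<open>auto simp: good_def\<close>)
    moreover have "k + int i + 1 = k + int (Suc i)" "int i + 1 = int (Suc i)" "int i + 2 = int (Suc i) + 1" by auto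
    ultimately show ?thesis unfolding good_def by (metis Zero_neq_Suc)
  qed
  obtain f where f: "\<And>i. good i (f i)"
    "\<And>i x. x \<in> carrier (P (k + int i)) \<Longrightarrow> f (Suc i) (D (k + int i) x) = D' (int i) (f i x)"
    using dependent_nat_choice[of good "\<lambda>i f f'. \<forall>x\<in>carrier (P (k + int i)). f' (D (k + int i) x) = D' (int i) (f x)", OF 1 2]
    by metis
  define \<psi> where "\<psi> n = (if n < k then (\<lambda>_. \<zero>\<^bsub>F (n - k)\<^esub>) else f (nat (n - k)))" for n
  have "cone R P D (\<lambda>n. F (n - k)) (\<lambda>n. D' (n - k)) Pair fst snd \<psi>"
  proof (intro cone.intro cone_axioms.intro)
    show "int_complex R P D" by (rule int_complex_axioms)
    show "int_complex R (\<lambda>n. F (n - k)) (\<lambda>n. D' (n - k))"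
    proof (rule int_complex.intro)
      show "module R (F (n - k))" for n by (rule F.cx_module)
      have eq: "n + 1 - k = n - k + 1" "n + 2 - k = n - k + 2" for n by auto
      show "D' (n - k) \<in> mod_hom R (F (n - k)) (F (n + 1 - k))" for n unfolding eq by (rule F.cx_hom)
      show "D' (n + 1 - k) (D' (n - k) x) = \<zero>\<^bsub>F (n + 2 - k)\<^esub>" if "x \<in> carrier (F (n - k))" for n x
        unfolding eq using F.cx_square[OF that] .
    qed
    show "pairing Pair fst snd" by (rule pairing.intro) auto
    show "\<psi> n \<in> mod_hom R (P n) (F (n - k))" for n
    proof (cases "n < k")
      case True
      interpret Fn: module R "F (n - k)" by (rule F.cx_module)
      show ?thesis using True by (intro mod_homI) (auto simp: \<psi>_def)
    next
      case False
      then obtain i where "n = k + int i" by (metis linorder_not_less zle_iff_zadd)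
      then show ?thesis using f(1)[of i] by (simp add: \<psi>_def good_def)
    qed
    show "\<psi> (n + 1) (D n x) = D' (n - k) (\<psi> n x)" if x: "x \<in> carrier (P n)" for n x
    proof (cases "n < k")
      case True
      have D0: "D' (n - k) \<zero>\<^bsub>F (n - k)\<^esub> = \<zero>\<^bsub>F (n - k + 1)\<^esub>"
        by (rule mod_hom_zero[OF F.cx_module F.cx_module F.cx_hom])
      show ?thesis
      proof (cases "n + 1 = k")
        case True
        then have "n = k - 1" by simp
        then have "D n x \<in> bnd P D k" using x by (auto simp: bnd_def)
        then have "D n x \<in> cyc P D k" "h (D n x) = \<zero>\<^bsub>F 0\<^esub>" using hker by auto
        then show ?thesis using f(1)[of 0] D0 True \<open>n = k - 1\<close> by (simp add: \<psi>_def good_def)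
      next
        case False
        then show ?thesis using D0 True by (simp add: \<psi>_def algebra_simps)
      qed
    next
      case False
      then obtain i where i: "n = k + int i" by (metis linorder_not_less zle_iff_zadd)
      moreover have "nat (k + int i + 1 - k) = Suc i" by simp
      ultimately show ?thesis using f(2)[of x i] x by (simp add: \<psi>_def)
    qed
  qed
  moreover have "\<forall>z\<in>cyc P D k. \<psi> k z = h z" using f(1)[of 0] by (simp add: \<psi>_def good_def)
  moreover have "\<forall>n<k. \<forall>x. \<psi> n x = \<zero>\<^bsub>F (n - k)\<^esub>" by (simp add: \<psi>_def)
  ultimately show ?thesis by blast
qed

end

text \<open>The chain map induces an isomorphism from H^k P to the cohomology of \<open>F\<close> in
  degree 0, the only one \<open>F\<close> has. Injectivity makes the cone exact in degree k,
  surjectivity in degree k + 1. Below k the modules of \<open>F\<close> that enter are zero, so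
  cocycles and boundaries of the cone are those of \<open>P\<close> paired with zero, and
  resolutions carry over.\<close>

lemma split_off_top:
  assumes P: "int_complex R P D" and van: "\<And>q. q > k \<Longrightarrow> cyc P D q \<subseteq> bnd P D q"
    and res: "resolves R P D k F D' h"
  obtains \<psi> where "cone R P D (\<lambda>n. F (n - k)) (\<lambda>n. D' (n - k)) Pair fst snd \<psi>"
    and "\<And>q. q \<ge> k \<Longrightarrow> cyc (cone_mod Pair fst snd P (\<lambda>n. F (n - k)))
          (cone_diff R Pair fst snd D (\<lambda>n. F (n - k)) (\<lambda>n. D' (n - k)) \<psi>) q
        \<subseteq> bnd (cone_mod Pair fst snd P (\<lambda>n. F (n - k)))
          (cone_diff R Pair fst snd D (\<lambda>n. F (n - k)) (\<lambda>n. D' (n - k)) \<psi>) q"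
    and "\<And>q F2 D2 h2. q < k \<Longrightarrow> resolves R P D q (F2 :: int \<Rightarrow> ('a, 'g) module) D2 h2 \<Longrightarrow>
        resolves R (cone_mod Pair fst snd P (\<lambda>n. F (n - k)))
          (cone_diff R Pair fst snd D (\<lambda>n. F (n - k)) (\<lambda>n. D' (n - k)) \<psi>) q F2 D2 (\<lambda>w. h2 (fst w))"
proof -
  interpret P: int_complex R P D by fact
  interpret F: int_complex R F D' using res by (simp add: resolves_def)
  have Fneg: "\<And>n. n < 0 \<Longrightarrow> carrier (F n) = {\<zero>\<^bsub>F n\<^esub>}" and Fex: "\<And>n. n > 0 \<Longrightarrow> cyc F D' n \<subseteq> bnd F D' n"
    and h: "h \<in> mod_hom R ((P k)\<lparr>carrier := cyc P D k\<rparr>) (F 0)"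
    and hker: "{z \<in> cyc P D k. h z = \<zero>\<^bsub>F 0\<^esub>} = bnd P D k" and him: "h ` cyc P D k = cyc F D' 0"
    using res unfolding resolves_def by auto
  obtain \<psi> where cone: "cone R P D (\<lambda>n. F (n - k)) (\<lambda>n. D' (n - k)) Pair fst snd \<psi>"
    and \<psi>k: "\<And>z. z \<in> cyc P D k \<Longrightarrow> \<psi> k z = h z" and \<psi>0: "\<And>n x. n < k \<Longrightarrow> \<psi> n x = \<zero>\<^bsub>F (n - k)\<^esub>"
    using P.lift_chain_map[OF van res] by blast
  interpret cone R P D "\<lambda>n. F (n - k)" "\<lambda>n. D' (n - k)" Pair fst snd \<psi> by (rule cone)
  have D0: "D' n \<zero>\<^bsub>F n\<^esub> = \<zero>\<^bsub>F (n + 1)\<^esub>" for n by (rule mod_hom_zero[OF F.cx_module F.cx_module F.cx_hom])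
  show thesis
  proof (rule that[OF cone])
    fix q assume q: "q \<ge> k"
    interpret Fq: module R "F (q - k)" by (rule F.cx_module)
    interpret Fq1: module R "F (q - 1 - k)" by (rule F.cx_module)
    interpret Fq2: module R "F (q - 1 - 1 - k)" by (rule F.cx_module)
    interpret Pq1: module R "P (q - 1)" by (rule P.cx_module)
    show "cyc K KD q \<subseteq> bnd K KD q"
    proof
      fix w assume "w \<in> cyc K KD q"
      then obtain u v where uv: "w = (u, v)" "u \<in> cyc P D q" "v \<in> carrier (F (q - 1 - k))" "\<psi> q u = D' (q - 1 - k) v"
        unfolding cyc_cone_iff by blast
      \<comment> \<open>For q = k the component v lies in F (-1) = 0, so h u = 0 and u is a
        boundary; for larger q the complex \<open>P\<close> is exact.\<close>
      have "u \<in> bnd P D q"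
      proof (cases "q = k")
        case True
        then have "v = \<zero>\<^bsub>F (q - 1 - k)\<^esub>" using uv Fneg[of "q - 1 - k"] by simp
        then have "\<psi> q u = \<zero>\<^bsub>F 0\<^esub>" using uv(4) D0[of "q - 1 - k"] True by simp
        then show ?thesis using \<psi>k[of u] uv True hker by auto
      next
        case False
        then show ?thesis using van[of q] uv(2) q by auto
      qed
      then obtain u' where u': "u' \<in> carrier (P (q - 1))" "u = D (q - 1) u'" by (auto simp: bnd_def)
      have c: "\<psi> (q - 1) u' \<in> carrier (F (q - 1 - k))" using mod_homD(1)[OF chain_hom u'(1)] .
      have "D' (q - 1 - k) (\<psi> (q - 1) u' \<ominus>\<^bsub>F (q - 1 - k)\<^esub> v) = \<psi> q u \<ominus>\<^bsub>F (q - k)\<^esub> \<psi> q u"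
        using mod_hom_diff[OF Q.cx_module Q.cx_module Q.cx_hom'[of q] c uv(3)] chain_commute'[OF u'(1)] u' uv by simp
      then have e: "\<psi> (q - 1) u' \<ominus>\<^bsub>F (q - 1 - k)\<^esub> v \<in> cyc F D' (q - 1 - k)"
        using Fq1.M.minus_closed[OF c uv(3)] mod_homD(1)[OF chain_hom P.cycD(1)[OF uv(2)]]
        by (simp add: cyc_def)
      \<comment> \<open>What remains is a cocycle of \<open>F\<close> in degree q - 1 - k: zero for
        q = k, in the image of \<open>h\<close> for q = k + 1, and a boundary beyond.\<close>
      have ex: "\<exists>a\<in>cyc P D (q - 1). \<exists>b\<in>carrier (F (q - 1 - 1 - k)).
        \<psi> (q - 1) u' \<ominus>\<^bsub>F (q - 1 - k)\<^esub> v = \<psi> (q - 1) a \<oplus>\<^bsub>F (q - 1 - k)\<^esub> D' (q - 1 - 1 - k) b"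
      proof -
        consider "q = k" | "q = k + 1" | "q > k + 1" using q by linarith
        then show ?thesis
        proof cases
          case 1
          then have "\<psi> (q - 1) u' = \<zero>\<^bsub>F (q - 1 - k)\<^esub>" "v = \<zero>\<^bsub>F (q - 1 - k)\<^esub>"
            using c uv(3) Fneg[of "q - 1 - k"] by auto
          then show ?thesis
            using mod_hom_zero[OF P.cx_module Q.cx_module chain_hom, of "q - 1"]
              mod_hom_zero[OF Q.cx_module Q.cx_module Q.cx_hom'[of "q - 1"]]
              submodule_memD(3)[OF P.cyc_submodule]
            by (intro bexI[of _ "\<zero>\<^bsub>P (q - 1)\<^esub>"] bexI[of _ "\<zero>\<^bsub>F (q - 1 - 1 - k)\<^esub>"], simp)
              (rule Fq2.M.zero_closed, simp)
        next
          case 2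
          then have "q - 1 = k" "q - 1 - k = 0" by auto
          then obtain a where "a \<in> cyc P D (q - 1)" "h a = \<psi> (q - 1) u' \<ominus>\<^bsub>F (q - 1 - k)\<^esub> v"
            using e unfolding \<open>q - 1 - k = 0\<close> him[symmetric] by auto
          then have a: "a \<in> cyc P D (q - 1)" "\<psi> (q - 1) a = \<psi> (q - 1) u' \<ominus>\<^bsub>F (q - 1 - k)\<^esub> v"
            using \<psi>k[of a] \<open>q - 1 = k\<close> by auto
          have "\<psi> (q - 1) a = \<psi> (q - 1) a \<oplus>\<^bsub>F (q - 1 - k)\<^esub> D' (q - 1 - 1 - k) \<zero>\<^bsub>F (q - 1 - 1 - k)\<^esub>"
            unfolding mod_hom_zero[OF Q.cx_module Q.cx_module Q.cx_hom'[of "q - 1"]]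
            using mod_homD(1)[OF chain_hom P.cycD(1)[OF a(1)]] by simp
          then show ?thesis using a Fq2.M.zero_closed by metis
        next
          case 3
          then have "\<psi> (q - 1) u' \<ominus>\<^bsub>F (q - 1 - k)\<^esub> v \<in> bnd F D' (q - 1 - k)" using Fex[of "q - 1 - k"] e by auto
          moreover have "q - 1 - k - 1 = q - 1 - 1 - k" by simp
          ultimately obtain b where b: "b \<in> carrier (F (q - 1 - 1 - k))"
            "\<psi> (q - 1) u' \<ominus>\<^bsub>F (q - 1 - k)\<^esub> v = D' (q - 1 - 1 - k) b" unfolding bnd_def by auto
          have "D' (q - 1 - 1 - k) b \<in> carrier (F (q - 1 - k))" using mod_homD(1)[OF Q.cx_hom'[of "q - 1"] b(1)] .
          then show ?thesis
            using mod_hom_zero[OF P.cx_module Q.cx_module chain_hom, of "q - 1"] b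
              submodule_memD(3)[OF P.cyc_submodule]
            by (intro bexI[of _ "\<zero>\<^bsub>P (q - 1)\<^esub>"] bexI[of _ b], simp) (rule b(1), simp)
        qed
      qed
      then obtain a b where ab: "a \<in> cyc P D (q - 1)" "b \<in> carrier (F (q - 1 - 1 - k))"
        "\<psi> (q - 1) u' \<ominus>\<^bsub>F (q - 1 - k)\<^esub> v = \<psi> (q - 1) a \<oplus>\<^bsub>F (q - 1 - k)\<^esub> D' (q - 1 - 1 - k) b" by blast
      have ac: "a \<in> carrier (P (q - 1))" and Da: "D (q - 1) a = \<zero>\<^bsub>P q\<^esub>" using P.cycD[OF ab(1)] by auto
      have c': "\<psi> (q - 1) a \<in> carrier (F (q - 1 - k))" "D' (q - 1 - 1 - k) b \<in> carrier (F (q - 1 - k))"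
        using mod_homD(1)[OF chain_hom ac] mod_homD(1)[OF Q.cx_hom'[of "q - 1"] ab(2)] .
      have "\<psi> (q - 1) (u' \<ominus>\<^bsub>P (q - 1)\<^esub> a) \<ominus>\<^bsub>F (q - 1 - k)\<^esub> D' (q - 1 - 1 - k) b
          = \<psi> (q - 1) u' \<ominus>\<^bsub>F (q - 1 - k)\<^esub> (\<psi> (q - 1) a \<oplus>\<^bsub>F (q - 1 - k)\<^esub> D' (q - 1 - 1 - k) b)"
        unfolding mod_hom_diff[OF P.cx_module Q.cx_module chain_hom u'(1) ac]
        using c c' by (simp add: Fq1.M.minus_eq Fq1.M.minus_add Fq1.M.a_assoc)
      also have "\<dots> = v" unfolding ab(3)[symmetric]
        using c uv(3) by (simp add: Fq1.M.minus_eq Fq1.M.minus_add Fq1.M.a_assoc[symmetric] Fq1.M.r_neg)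
      finally have "v = \<psi> (q - 1) (u' \<ominus>\<^bsub>P (q - 1)\<^esub> a) \<ominus>\<^bsub>F (q - 1 - k)\<^esub> D' (q - 1 - 1 - k) b" by simp
      moreover have "u = D (q - 1) (u' \<ominus>\<^bsub>P (q - 1)\<^esub> a)"
        unfolding mod_hom_diff[OF P.cx_module P.cx_module P.cx_hom' u'(1) ac] Da
        using u' mod_homD(1)[OF P.cx_hom' u'(1)] module.minus_zero_right[OF P.cx_module] by metis
      moreover have "u' \<ominus>\<^bsub>P (q - 1)\<^esub> a \<in> carrier (P (q - 1))" using u' ac by simp
      ultimately show "w \<in> bnd K KD q" unfolding bnd_cone_iff uv(1) using ab(2) by blast
    qed
  next
    fix q F2 D2 h2 assume q: "q < k" and r2: "resolves R P D q (F2 :: int \<Rightarrow> ('a, 'g) module) D2 h2"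
    have z: "carrier (F (q - 1 - k)) = {\<zero>\<^bsub>F (q - 1 - k)\<^esub>}" using Fneg q by simp
    interpret Fq: module R "F (q - 1 - k)" by (rule F.cx_module)
    have cyc: "w \<in> cyc K KD q \<longleftrightarrow> (\<exists>u\<in>cyc P D q. w = (u, \<zero>\<^bsub>F (q - 1 - k)\<^esub>))" for w
      using \<psi>0[OF q] mod_hom_zero[OF Q.cx_module Q.cx_module Q.cx_hom'[of q]] z unfolding cyc_cone_iff by auto
    have "w \<in> bnd K KD q \<longleftrightarrow> (\<exists>u\<in>bnd P D q. w = (u, \<zero>\<^bsub>F (q - 1 - k)\<^esub>))" for w
    proof -
      have "D (q - 1) u \<in> bnd P D q \<and> \<psi> (q - 1) u \<ominus>\<^bsub>F (q - 1 - k)\<^esub> D' (q - 1 - 1 - k) v = \<zero>\<^bsub>F (q - 1 - k)\<^esub>"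
        if "u \<in> carrier (P (q - 1))" "v \<in> carrier (F (q - 1 - 1 - k))" for u v
        using Fq.M.minus_closed[OF mod_homD(1)[OF chain_hom that(1)] mod_homD(1)[OF Q.cx_hom'[of "q - 1"] that(2)]]
          z P.bndI[OF that(1)] by simp
      moreover have "\<exists>v. v \<in> carrier (F (q - 1 - 1 - k))"
        using module.carrier_is_submodule[OF F.cx_module] submodule_memD(3) by blast
      ultimately show ?thesis unfolding bnd_cone_iff bnd_def[of P D q] by (auto; metis)
    qed
    note bnd = this
    have r2': "h2 \<in> mod_hom R ((P q)\<lparr>carrier := cyc P D q\<rparr>) (F2 0)"
      "{z \<in> cyc P D q. h2 z = \<zero>\<^bsub>F2 0\<^esub>} = bnd P D q" "h2 ` cyc P D q = cyc F2 D2 0"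
      using r2 unfolding resolves_def by auto
    have "fst \<in> mod_hom R ((K q)\<lparr>carrier := cyc K KD q\<rparr>) ((P q)\<lparr>carrier := cyc P D q\<rparr>)"
      by (rule mod_homI) (auto simp: cyc cone_mod_def)
    then have "(\<lambda>w. h2 (fst w)) \<in> mod_hom R ((K q)\<lparr>carrier := cyc K KD q\<rparr>) (F2 0)"
      by (rule mod_hom_compose) (rule r2'(1))
    moreover have "{z \<in> cyc K KD q. h2 (fst z) = \<zero>\<^bsub>F2 0\<^esub>} = bnd K KD q"
    proof -
      have "w \<in> bnd K KD q \<longleftrightarrow> w \<in> cyc K KD q \<and> h2 (fst w) = \<zero>\<^bsub>F2 0\<^esub>" for w
        unfolding cyc bnd r2'(2)[symmetric] by auto
      then show ?thesis by blast
    qed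
    moreover have "(\<lambda>w. h2 (fst w)) ` cyc K KD q = cyc F2 D2 0"
    proof -
      have "fst ` cyc K KD q = cyc P D q" using cyc by force
      then show ?thesis using r2'(3) by (metis image_image)
    qed
    ultimately show "resolves R K KD q F2 D2 (\<lambda>w. h2 (fst w))" using r2 by (simp add: resolves_def)
  qed
qed

section \<open>Torsion cohomology of a complex with Noetherian cohomology\<close>

text \<open>One power of s turns the first component into a boundary D u'. After subtracting the
  boundary of (u', 0), the second component is a cocycle of \<open>Q\<close>, and a further power of
  s turns it into a boundary.\<close>

lemma (in cone) cone_power_torsion:
  assumes s: "s \<in> carrier R"
    and tP: "\<And>z. z \<in> cyc P D n \<Longrightarrow> \<exists>k::nat. (s [^]\<^bsub>R\<^esub> k) \<odot>\<^bsub>P n\<^esub> z \<in> bnd P D n"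
    and tQ: "\<And>z. z \<in> cyc Q D' (n - 1) \<Longrightarrow> \<exists>k::nat. (s [^]\<^bsub>R\<^esub> k) \<odot>\<^bsub>Q (n - 1)\<^esub> z \<in> bnd Q D' (n - 1)"
    and w: "w \<in> cyc K KD n"
  shows "\<exists>k::nat. (s [^]\<^bsub>R\<^esub> k) \<odot>\<^bsub>K n\<^esub> w \<in> bnd K KD n"
proof -
  interpret Pn: module R "P n" by (rule P.cx_module)
  interpret Pm: module R "P (n - 1)" by (rule P.cx_module)
  interpret Qn: module R "Q n" by (rule Q.cx_module)
  interpret Qm: module R "Q (n - 1)" by (rule Q.cx_module)
  interpret Qk: module R "Q (n - 1 - 1)" by (rule Q.cx_module)
  interpret Kn: module R "K n" by (rule K.cx_module)
  obtain u v where uv: "w = p u v" "u \<in> cyc P D n" "v \<in> carrier (Q (n - 1))" "\<psi> n u = D' (n - 1) v"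
    using w unfolding cyc_cone_iff by blast
  obtain a :: nat where "(s [^]\<^bsub>R\<^esub> a) \<odot>\<^bsub>P n\<^esub> u \<in> bnd P D n" using tP uv by blast
  then obtain u' where u': "u' \<in> carrier (P (n - 1))" "(s [^]\<^bsub>R\<^esub> a) \<odot>\<^bsub>P n\<^esub> u = D (n - 1) u'"
    by (auto simp: bnd_def)
  let ?sa = "s [^]\<^bsub>R\<^esub> a"
  have sa: "?sa \<in> carrier R" using s by simp
  note uc = P.cycD(1)[OF uv(2)]
  have c: "\<psi> (n - 1) u' \<in> carrier (Q (n - 1))" "D' (n - 1) v \<in> carrier (Q n)" "?sa \<odot>\<^bsub>Q (n - 1)\<^esub> v \<in> carrier (Q (n - 1))"
    using mod_homD(1)[OF chain_hom u'(1)] mod_homD(1)[OF Q.cx_hom' uv(3)] uv(3) sa by auto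
  define v' where "v' = ?sa \<odot>\<^bsub>Q (n - 1)\<^esub> v \<ominus>\<^bsub>Q (n - 1)\<^esub> \<psi> (n - 1) u'"
  have v'c: "v' \<in> carrier (Q (n - 1))" using c by (simp add: v'_def)
  have "D' (n - 1) v' = ?sa \<odot>\<^bsub>Q n\<^esub> D' (n - 1) v \<ominus>\<^bsub>Q n\<^esub> \<psi> n (D (n - 1) u')"
    unfolding v'_def using mod_hom_diff[OF Q.cx_module Q.cx_module Q.cx_hom' c(3,1)]
      mod_homD(3)[OF Q.cx_hom' sa uv(3)] chain_commute'[OF u'(1)] by simp
  also have "\<dots> = \<zero>\<^bsub>Q n\<^esub>"
    using mod_homD(3)[OF chain_hom sa uc] u'(2) uv(4) c sa by (metis Qn.minus_self Qn.smult_closed)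
  finally have "v' \<in> cyc Q D' (n - 1)" using v'c by (simp add: cyc_def)
  then obtain b :: nat where "(s [^]\<^bsub>R\<^esub> b) \<odot>\<^bsub>Q (n - 1)\<^esub> v' \<in> bnd Q D' (n - 1)" using tQ by blast
  then obtain w' where w': "w' \<in> carrier (Q (n - 1 - 1))" "(s [^]\<^bsub>R\<^esub> b) \<odot>\<^bsub>Q (n - 1)\<^esub> v' = D' (n - 1 - 1) w'"
    by (auto simp: bnd_def)
  let ?sb = "s [^]\<^bsub>R\<^esub> b"
  have sb: "?sb \<in> carrier R" using s by simp
  have Dw: "D' (n - 1 - 1) w' \<in> carrier (Q (n - 1))" using mod_homD(1)[OF Q.cx_hom'[of "n - 1"] w'(1)] by simp
  have z1: "KD (n - 1) (p u' \<zero>\<^bsub>Q (n - 1 - 1)\<^esub>) = p (D (n - 1) u') (\<psi> (n - 1) u')"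
    using cone_diff_pair[OF u'(1) Qk.M.zero_closed] c mod_hom_zero[OF Q.cx_module Q.cx_module Q.cx_hom'[of "n - 1"]]
    by simp
  have z2: "KD (n - 1) (p \<zero>\<^bsub>P (n - 1)\<^esub> (\<ominus>\<^bsub>Q (n - 1 - 1)\<^esub> w')) = p \<zero>\<^bsub>P n\<^esub> (D' (n - 1 - 1) w')"
    using cone_diff_pair[OF Pm.M.zero_closed Qk.M.a_inv_closed[OF w'(1)]] Dw
      mod_hom_zero[OF P.cx_module P.cx_module P.cx_hom'[of n]] mod_hom_zero[OF P.cx_module Q.cx_module chain_hom[of "n - 1"]]
      mod_hom_minus[OF Q.cx_module Q.cx_module Q.cx_hom'[of "n - 1"] w'(1)]
    by (simp add: Qm.M.minus_eq)
  have m: "p (D (n - 1) u') (\<psi> (n - 1) u') \<in> bnd K KD n" "p \<zero>\<^bsub>P n\<^esub> (D' (n - 1 - 1) w') \<in> bnd K KD n"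
    using K.bndI[of "p u' \<zero>\<^bsub>Q (n - 1 - 1)\<^esub>" n] K.bndI[of "p \<zero>\<^bsub>P (n - 1)\<^esub> (\<ominus>\<^bsub>Q (n - 1 - 1)\<^esub> w')" n]
      u'(1) Qk.M.zero_closed Qk.M.a_inv_closed[OF w'(1)] unfolding z1 z2 cone_carrier by auto
  have "?sa \<odot>\<^bsub>Q (n - 1)\<^esub> v = \<psi> (n - 1) u' \<oplus>\<^bsub>Q (n - 1)\<^esub> v'"
    unfolding v'_def using c Qm.M.a_lcomm[of "\<psi> (n - 1) u'" "?sa \<odot>\<^bsub>Q (n - 1)\<^esub> v" "\<ominus>\<^bsub>Q (n - 1)\<^esub> \<psi> (n - 1) u'"]
    by (simp add: Qm.M.minus_eq Qm.M.r_neg)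
  then have "?sb \<odot>\<^bsub>Q (n - 1)\<^esub> (?sa \<odot>\<^bsub>Q (n - 1)\<^esub> v) = ?sb \<odot>\<^bsub>Q (n - 1)\<^esub> \<psi> (n - 1) u' \<oplus>\<^bsub>Q (n - 1)\<^esub> D' (n - 1 - 1) w'"
    using w'(2) c(1) v'c sb by (simp add: Qm.smult_r_distr)
  moreover have "?sb \<odot>\<^bsub>P n\<^esub> D (n - 1) u' \<oplus>\<^bsub>P n\<^esub> \<zero>\<^bsub>P n\<^esub> = ?sb \<odot>\<^bsub>P n\<^esub> D (n - 1) u'"
    using mod_homD(1)[OF P.cx_hom' u'(1)] sb by simp
  moreover have "?sa \<odot>\<^bsub>K n\<^esub> w = p (D (n - 1) u') (?sa \<odot>\<^bsub>Q (n - 1)\<^esub> v)" using uv u' by (simp add: cone_mod_def)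
  ultimately have "?sb \<odot>\<^bsub>K n\<^esub> (?sa \<odot>\<^bsub>K n\<^esub> w) = ?sb \<odot>\<^bsub>K n\<^esub> p (D (n - 1) u') (\<psi> (n - 1) u') \<oplus>\<^bsub>K n\<^esub> p \<zero>\<^bsub>P n\<^esub> (D' (n - 1 - 1) w')"
    by (simp add: cone_mod_def)
  also have "\<dots> \<in> bnd K KD n" using m submodule_memD(4,5)[OF K.bnd_submodule] sb by blast
  finally show ?thesis using Kn.smult_pow_add[OF s K.cycD(1)[OF w], of b a] by metis
qed

lemma cone_mult:
  assumes "int_complex R P D" "pairing p l r" "x \<in> carrier R"
  shows "cone R P D P D p l r (\<lambda>n u. x \<odot>\<^bsub>P n\<^esub> u)"
proof -
  interpret P: int_complex R P D by fact
  show ?thesis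
  proof (intro cone.intro cone_axioms.intro assms)
    show "(\<lambda>u. x \<odot>\<^bsub>P n\<^esub> u) \<in> mod_hom R (P n) (P n)" for n
      using module.mod_hom_smult[OF P.cx_module assms(3)] .
    show "x \<odot>\<^bsub>P (n + 1)\<^esub> D n u = D n (x \<odot>\<^bsub>P n\<^esub> u)" if "u \<in> carrier (P n)" for n u
      using mod_homD(3)[OF P.cx_hom assms(3) that] by simp
  qed
qed

text \<open>The homotopy is (u, v) -> (v, 0): for a cocycle (u, v) the differential of (v, 0) is (D
  v, x v) = x (u, v).\<close>

lemma cone_mult_kills:
  assumes P: "int_complex R P D" "pairing p l r" "x \<in> carrier R"
    and w: "w \<in> cyc (cone_mod p l r P P) (cone_diff R p l r D P D (\<lambda>n u. x \<odot>\<^bsub>P n\<^esub> u)) n"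
  shows "x \<odot>\<^bsub>cone_mod p l r P P n\<^esub> w \<in> bnd (cone_mod p l r P P) (cone_diff R p l r D P D (\<lambda>n u. x \<odot>\<^bsub>P n\<^esub> u)) n"
proof -
  interpret cone R P D P D p l r "\<lambda>n u. x \<odot>\<^bsub>P n\<^esub> u" by (rule cone_mult[OF P])
  interpret Pm: module R "P (n - 1)" by (rule P.cx_module)
  interpret Pk: module R "P (n - 1 - 1)" by (rule P.cx_module)
  obtain u v where uv: "w = p u v" "u \<in> cyc P D n" "v \<in> carrier (P (n - 1))" "x \<odot>\<^bsub>P n\<^esub> u = D (n - 1) v"
    using w unfolding cyc_cone_iff by blast
  have "KD (n - 1) (p v \<zero>\<^bsub>P (n - 1 - 1)\<^esub>) = p (D (n - 1) v) (x \<odot>\<^bsub>P (n - 1)\<^esub> v)"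
    using cone_diff_pair[OF uv(3) Pk.M.zero_closed] mod_hom_zero[OF P.cx_module P.cx_module P.cx_hom'[of "n - 1"]]
      uv(3) assms(3) by simp
  moreover have "KD (n - 1) (p v \<zero>\<^bsub>P (n - 1 - 1)\<^esub>) \<in> bnd K KD n"
    using uv(3) Pk.M.zero_closed by (intro K.bndI) (auto simp: cone_carrier)
  ultimately show ?thesis using uv by (simp add: cone_mod_def)
qed

text \<open>Each generator \<open>x\<close> in \<open>T\<close> is removed by passing to the cone of \<open>x\<close>, whose cohomology is killed by \<open>x\<close>
  and, after taking torsion, surjects onto the elements of the cohomology killed by \<open>x\<close>.\<close>

lemma tors_cohomology_artinian_aux:
  fixes p :: "'y \<Rightarrow> 'y \<Rightarrow> 'y" and P :: "int \<Rightarrow> ('a, 'y) module"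
  assumes noeth: "noetherian_ring R" and pr: "pairing p l r" and S: "finite S" "S \<subseteq> carrier R"
    and field: "\<And>a. a \<in> carrier R \<Longrightarrow> a \<in> Idl\<^bsub>R\<^esub> S \<or> (\<exists>u\<in>carrier R. u \<otimes>\<^bsub>R\<^esub> a \<ominus>\<^bsub>R\<^esub> \<one>\<^bsub>R\<^esub> \<in> Idl\<^bsub>R\<^esub> S)"
    and T: "finite T" "T \<subseteq> S"
    and P: "int_complex R P D" "\<And>n. baer_module R (P n)"
      "\<And>n. chain_cond True R (P n) (bnd P D n) (cyc P D n)"
      "\<And>n s z. s \<in> S - T \<Longrightarrow> z \<in> cyc P D n \<Longrightarrow> \<exists>k::nat. (s [^]\<^bsub>R\<^esub> k) \<odot>\<^bsub>P n\<^esub> z \<in> bnd P D n"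
  shows "chain_cond False R (tors_mod R T (P n)) (bnd (\<lambda>n. tors_mod R T (P n)) D n) (cyc (\<lambda>n. tors_mod R T (P n)) D n)"
  using T P
proof (induction T arbitrary: P D n rule: finite_induct)
  case empty
  interpret P: int_complex R P D by fact
  interpret Pn: module R "P n" by (rule P.cx_module)
  \<comment> \<open>With no generator left to remove, all of \<open>S\<close> acts by power torsion
    on Noetherian cohomology.\<close>
  show ?case
    using Pn.noetherian_torsion_artinian[OF P.bnd_submodule P.cyc_submodule P.bnd_subset_cyc _ S field] empty by simp
next
  case (insert x T)
  interpret P: int_complex R P D by fact
  interpret Rc: cring R by (rule P.ring_is_cring)
  have x: "x \<in> carrier R" "x \<in> S" "T \<subseteq> S" "T \<subseteq> carrier R" "finite T" "insert x T \<subseteq> carrier R"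
    using insert.prems(1) insert.hyps S by auto
  let ?m = "\<lambda>P n u. x \<odot>\<^bsub>(P :: int \<Rightarrow> ('a, 'y) module) n\<^esub> u"
  let ?TP = "\<lambda>n. tors_mod R T (P n)" and ?UP = "\<lambda>n. tors_mod R (insert x T) (P n)"
  interpret C: cone R P D P D p l r "?m P" by (rule cone_mult[OF P.int_complex_axioms pr x(1)])
  have m: "?m ?TP = ?m P" "?m ?UP = ?m P" by auto
  have Kx: "\<exists>k::nat. (x [^]\<^bsub>R\<^esub> k) \<odot>\<^bsub>C.K n\<^esub> w \<in> bnd C.K C.KD n" if "w \<in> cyc C.K C.KD n" for n w
    using cone_mult_kills[OF P.int_complex_axioms pr x(1) that] by (intro exI[of _ 1]) (simp add: P.ring_is_cring x)
  \<comment> \<open>The cone satisfies the hypotheses for the smaller set \<open>T\<close>: x kills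
    its cohomology, and the remaining elements of \<open>S\<close> act on it by power torsion as
    they do on \<open>P\<close>.\<close>
  have TK: "chain_cond False R (tors_mod R T (C.K n)) (bnd (\<lambda>n. tors_mod R T (C.K n)) C.KD n)
      (cyc (\<lambda>n. tors_mod R T (C.K n)) C.KD n)"
  proof (rule insert.IH[OF x(3) C.cone_complex])
    show "baer_module R (C.K n)" for n by (rule C.cone_baer) (rule insert.prems)+
    show "chain_cond True R (C.K n) (bnd C.K C.KD n) (cyc C.K C.KD n)" for n
      by (rule C.chain_cond_cone) (rule insert.prems)+
    show "\<exists>k::nat. (s [^]\<^bsub>R\<^esub> k) \<odot>\<^bsub>C.K n\<^esub> w \<in> bnd C.K C.KD n" if "s \<in> S - T" "w \<in> cyc C.K C.KD n" for n s w
    proof (cases "s = x")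
      case False
      then have "s \<in> carrier R" "s \<in> S - insert x T" using that S by auto
      then show ?thesis using C.cone_power_torsion insert.prems(5) that(2) by blast
    qed (use Kx that in simp)
  qed
  interpret TK: int_complex R "\<lambda>n. tors_mod R T (C.K n)" C.KD by (rule C.K.tors_complex[OF x(4)])
  interpret TTK: int_complex R "\<lambda>n. tors_mod R {x} (tors_mod R T (C.K n))" C.KD
    using TK.tors_complex[of "{x}"] x by simp
  \<comment> \<open>Adding x to the torsion set is injective on cohomology by
    \<open>tors_boundary\<close>. This applies because the T-torsion of the cone is the cone of x on
    the T-torsion of \<open>P\<close>, whose cohomology x kills.\<close>
  have TTK: "chain_cond False R (tors_mod R {x} (tors_mod R T (C.K n)))
      (bnd (\<lambda>n. tors_mod R {x} (tors_mod R T (C.K n))) C.KD n) (cyc (\<lambda>n. tors_mod R {x} (tors_mod R T (C.K n))) C.KD n)"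
  proof (rule chain_cond_inj[OF TTK.cx_module TK.cx_module _ TK.cyc_submodule TK.bnd_submodule TK.bnd_subset_cyc _ _ TK])
    show "(\<lambda>z. z) \<in> mod_hom R (tors_mod R {x} (tors_mod R T (C.K n))) (tors_mod R T (C.K n))"
      by (rule mod_homI) (auto simp: tors_def)
    show "\<zero>\<^bsub>tors_mod R {x} (tors_mod R T (C.K n))\<^esub> \<in> bnd (\<lambda>n. tors_mod R {x} (tors_mod R T (C.K n))) C.KD n"
      by (rule submodule_memD(3)[OF TTK.bnd_submodule])
    show "z \<in> cyc (\<lambda>n. tors_mod R T (C.K n)) C.KD n"
      if "z \<in> cyc (\<lambda>n. tors_mod R {x} (tors_mod R T (C.K n))) C.KD n" for z
      using that unfolding TK.cyc_tors by simp
    fix z assume z: "z \<in> cyc (\<lambda>n. tors_mod R {x} (tors_mod R T (C.K n))) C.KD n"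
      "z \<in> bnd (\<lambda>n. tors_mod R T (C.K n)) C.KD n"
    show "z \<in> bnd (\<lambda>n. tors_mod R {x} (tors_mod R T (C.K n))) C.KD n"
    proof (rule TK.tors_boundary[OF noeth _ x(1) _ _ z(2)])
      show "baer_module R (tors_mod R T (C.K n))" for n
        using baer_module_tors[OF noeth _ x(5,4)] C.cone_baer insert.prems(3) by blast
      show "z \<in> tors R {x} (tors_mod R T (C.K n))" using TTK.cycD(1)[OF z(1)] by simp
      fix w assume w: "w \<in> cyc (\<lambda>n. tors_mod R T (C.K n)) C.KD (n - 1)"
      have "x \<odot>\<^bsub>tors_mod R T (C.K (n - 1))\<^esub> w \<in> bnd (\<lambda>n. tors_mod R T (C.K n)) C.KD (n - 1)"
        using cone_mult_kills[OF P.tors_complex[OF x(4)] pr x(1), of w "n - 1"] w C.cone_tors(2,3)[OF x(4)]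
        by (simp add: fun_eq_iff)
      then show "\<exists>k::nat. (x [^]\<^bsub>R\<^esub> k) \<odot>\<^bsub>tors_mod R T (C.K (n - 1))\<^esub> w \<in> bnd (\<lambda>n. tors_mod R T (C.K n)) C.KD (n - 1)"
        by (intro exI[of _ 1]) (simp add: x)
    qed
  qed
  interpret UP: int_complex R ?UP D by (rule P.tors_complex[OF x(6)])
  interpret U: cone R ?UP D ?UP D p l r "?m P" by (rule C.cone_tors(1)[OF x(6)])
  have UK: "(\<lambda>n. tors_mod R {x} (tors_mod R T (C.K n))) = U.K" "C.KD = U.KD"
    using C.cone_tors(2,3)[OF x(6)] by (simp_all add: tors_Un)
  have "tors_mod R {x} (tors_mod R T (C.K n)) = U.K n" using UK(1) by metis
  then have "chain_cond False R (U.K n) (bnd U.K U.KD n) (cyc U.K U.KD n)" using TTK unfolding UK by metis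
  \<comment> \<open>The torsion of the cone, being the cone of x on the torsion complex of
    \<open>P\<close>, has cohomology mapping onto the kernel of x there.\<close>
  then have socle: "chain_cond False R (?UP n) (bnd ?UP D n) {u \<in> cyc ?UP D n. x \<odot>\<^bsub>?UP n\<^esub> u \<in> bnd ?UP D n}"
    using U.chain_cond_kernel by simp
  interpret Un: module R "?UP n" by (rule UP.cx_module)
  show ?case
  proof (rule Un.artinian_if_socle_artinian[OF x(1) UP.bnd_submodule UP.cyc_submodule UP.bnd_subset_cyc _ socle])
    fix z assume "z \<in> cyc ?UP D n"
    then obtain k :: nat where "(x [^]\<^bsub>R\<^esub> k) \<odot>\<^bsub>P n\<^esub> z = \<zero>\<^bsub>P n\<^esub>"
      using UP.cycD(1) by (fastforce simp: tors_def)
    then show "\<exists>k::nat. (x [^]\<^bsub>R\<^esub> k) \<odot>\<^bsub>?UP n\<^esub> z \<in> bnd ?UP D n"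
      using submodule_memD(3)[OF UP.bnd_submodule] by (intro exI[of _ k]) simp
  qed
qed

text \<open>Interleaving turns pairs of sequences into sequences, so that iterated cones of a
  complex of sequences stay on one type.\<close>

lemma pairing_sequence:
  "pairing (\<lambda>f g n. if even n then f (n div 2) else g (n div 2)) (\<lambda>h n. h (2 * n :: nat)) (\<lambda>h n. h (2 * n + 1))"
  by (rule pairing.intro) auto

text \<open>This pairing carries a complex on an arbitrary type over to sequences.\<close>

lemma pairing_into_sequence:
  "pairing (\<lambda>u v n. if n = 0 then u else v) (\<lambda>h. h (0 :: nat)) (\<lambda>h. h 1)"
  by (rule pairing.intro) auto

text \<open>A type need not be able to encode its own pairs, as the induction on generators
  requires. So \<open>P\<close> is first moved to sequences, as the cone of its map to a zero
  complex \<open>Z\<close>. Since \<open>Z\<close> and its torsion have no cohomology, hypotheses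
  and conclusion pass through this cone.\<close>

theorem tors_cohomology_artinian:
  fixes P :: "int \<Rightarrow> ('a, 'e) module"
  assumes noeth: "noetherian_ring R" and S: "finite S" "S \<subseteq> carrier R"
    and field: "\<And>a. a \<in> carrier R \<Longrightarrow> a \<in> Idl\<^bsub>R\<^esub> S \<or> (\<exists>u\<in>carrier R. u \<otimes>\<^bsub>R\<^esub> a \<ominus>\<^bsub>R\<^esub> \<one>\<^bsub>R\<^esub> \<in> Idl\<^bsub>R\<^esub> S)"
    and P: "int_complex R P D" "\<And>n. baer_module R (P n)"
      "\<And>n. chain_cond True R (P n) (bnd P D n) (cyc P D n)"
  shows "chain_cond False R (tors_mod R S (P n)) (bnd (\<lambda>n. tors_mod R S (P n)) D n) (cyc (\<lambda>n. tors_mod R S (P n)) D n)"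
proof -
  interpret P: int_complex R P D by fact
  define Z where "Z n = (P n)\<lparr>carrier := {\<zero>\<^bsub>P n\<^esub>}\<rparr>" for n
  define DZ where "DZ n z = \<zero>\<^bsub>P (n + 1)\<^esub>" for n :: int and z :: 'e
  have Zm: "module R (Z n)" for n
    unfolding Z_def using submodule.submodule_is_module[OF module.zero_submodule[OF P.cx_module] P.cx_module] .
  have Zc: "carrier (Z n) = {\<zero>\<^bsub>P n\<^esub>}" "\<zero>\<^bsub>Z n\<^esub> = \<zero>\<^bsub>P n\<^esub>" for n by (simp_all add: Z_def)
  have hom0: "(\<lambda>_. \<zero>\<^bsub>V\<^esub>) \<in> mod_hom R U V" if "module R V" for U :: "('a, 'e) module" and V :: "('a, 'e) module"
  proof -
    interpret V: module R V by fact
    show ?thesis by (rule mod_homI) auto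
  qed
  have Z: "int_complex R Z DZ"
  proof (rule int_complex.intro)
    show "module R (Z n)" for n by (rule Zm)
    show "DZ n \<in> mod_hom R (Z n) (Z (n + 1))" for n using hom0[OF Zm, of "n + 1" "Z n"] by (simp add: DZ_def[abs_def] Zc)
    show "DZ (n + 1) (DZ n x) = \<zero>\<^bsub>Z (n + 2)\<^esub>" for n x by (simp add: DZ_def Zc add.commute)
  qed
  let ?p = "\<lambda>(u :: 'e) v n. if n = (0 :: nat) then u else v"
  have cone: "cone R P D Z DZ ?p (\<lambda>h. h 0) (\<lambda>h. h 1) (\<lambda>n _. \<zero>\<^bsub>P n\<^esub>)"
  proof (intro cone.intro cone_axioms.intro P(1) Z pairing_into_sequence)
    show "(\<lambda>_. \<zero>\<^bsub>P n\<^esub>) \<in> mod_hom R (P n) (Z n)" for n using hom0[OF Zm, of n "P n"] by (simp add: Zc)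
  qed (simp add: DZ_def)
  interpret C: cone R P D Z DZ ?p "\<lambda>h. h 0" "\<lambda>h. h 1" "\<lambda>n _. \<zero>\<^bsub>P n\<^esub>" by (rule cone)
  have Zbaer: "baer_module R (Z n)" for n
  proof -
    interpret Zn: module R "Z n" by (rule Zm)
    show ?thesis unfolding baer_module_def
    proof (intro conjI allI impI Zm)
      fix I g
      assume g: "ideal I R \<and> (\<forall>r\<in>I. g r \<in> carrier (Z n)) \<and> (\<forall>r\<in>I. \<forall>s\<in>I. g (r \<oplus>\<^bsub>R\<^esub> s) = g r \<oplus>\<^bsub>Z n\<^esub> g s) \<and>
        (\<forall>r\<in>carrier R. \<forall>s\<in>I. g (r \<otimes>\<^bsub>R\<^esub> s) = r \<odot>\<^bsub>Z n\<^esub> g s)"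
      have "g r = r \<odot>\<^bsub>Z n\<^esub> \<zero>\<^bsub>Z n\<^esub>" if "r \<in> I" for r
        using g that Zc[of n] Zn.smult_r_null[of r] ideal.Icarr[of I R r] by auto
      then show "\<exists>e\<in>carrier (Z n). \<forall>r\<in>I. g r = r \<odot>\<^bsub>Z n\<^esub> e" using Zn.M.zero_closed by blast
    qed
  qed
  have ccZ: "chain_cond asc R (tors_mod R T (Z n)) (bnd (\<lambda>n. tors_mod R T (Z n)) DZ n) (cyc (\<lambda>n. tors_mod R T (Z n)) DZ n)"
    if "T \<subseteq> carrier R" for T n asc
  proof (rule chain_cond_trivial)
    have "int_complex R (\<lambda>n. tors_mod R T (Z n)) DZ" by (rule int_complex.tors_complex[OF Z that])
    then have "\<zero>\<^bsub>tors_mod R T (Z n)\<^esub> \<in> bnd (\<lambda>n. tors_mod R T (Z n)) DZ n"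
      using submodule_memD(3)[OF int_complex.bnd_submodule] by blast
    then show "cyc (\<lambda>n. tors_mod R T (Z n)) DZ n \<subseteq> bnd (\<lambda>n. tors_mod R T (Z n)) DZ n"
      by (auto simp: cyc_def Zc tors_def)
  qed
  have "chain_cond False R (tors_mod R S (C.K n)) (bnd (\<lambda>n. tors_mod R S (C.K n)) C.KD n)
      (cyc (\<lambda>n. tors_mod R S (C.K n)) C.KD n)"
  proof (rule tors_cohomology_artinian_aux[OF noeth pairing_sequence S field S(1) order_refl C.cone_complex])
    show "baer_module R (C.K n)" for n by (rule C.cone_baer[OF P(2) Zbaer])
    show "chain_cond True R (C.K n) (bnd C.K C.KD n) (cyc C.K C.KD n)" for n
      using C.chain_cond_cone[OF P(3)] ccZ[of "{}" True "n - 1"] by simp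
  qed auto
  then show ?thesis
    using cone.chain_cond_source[OF C.cone_tors(1)[OF S(2)], of False n] ccZ[OF S(2), of False n] C.cone_tors(2,3)[OF S(2)]
    by (metis (no_types, lifting))
qed

section \<open>Dimension of Noetherian local rings\<close>

locale noetherian_cring = cring R + noetherian_ring R for R (structure)
begin

lemma exists_maximal_ideal_with:
  assumes "ideal I R" "\<Phi> I"
  shows "\<exists>J. ideal J R \<and> \<Phi> J \<and> (\<forall>J'. ideal J' R \<and> \<Phi> J' \<and> J \<subseteq> J' \<longrightarrow> J' = J)"
proof -
  have "submodules_between R (regular_module R) {\<zero>} (carrier R) = {I. ideal I R}"
    using submodule_regular_module_iff[OF is_cring] additive_subgroup.zero_closed[OF ideal.axioms(1)] ideal.Icarr
    by (auto simp: submodules_between_def)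
  then show ?thesis
    using chain_cond_maximal[OF noetherian_regular_module[OF is_cring noetherian_ring_axioms], of I \<Phi>] assms by auto
qed

lemma idealI':
  assumes "I \<subseteq> carrier R" "\<zero> \<in> I" "\<And>a b. a \<in> I \<Longrightarrow> b \<in> I \<Longrightarrow> a \<oplus> b \<in> I"
    "\<And>a x. a \<in> carrier R \<Longrightarrow> x \<in> I \<Longrightarrow> a \<otimes> x \<in> I"
  shows "ideal I R"
proof -
  interpret RR: module R "regular_module R" by (rule regular_module) (rule is_cring)
  have "submodule I R (regular_module R)"
    by (rule RR.submoduleI') (use assms in \<open>auto simp: regular_module_def\<close>)
  then show ?thesis using submodule_regular_module_iff[OF is_cring] by blast
qed

lemma idealD:
  assumes "ideal I R"
  shows "x \<in> I \<Longrightarrow> x \<in> carrier R" "\<zero> \<in> I" "x \<in> I \<Longrightarrow> y \<in> I \<Longrightarrow> x \<oplus> y \<in> I"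
    "a \<in> carrier R \<Longrightarrow> x \<in> I \<Longrightarrow> a \<otimes> x \<in> I" "a \<in> carrier R \<Longrightarrow> x \<in> I \<Longrightarrow> x \<otimes> a \<in> I"
    "x \<in> I \<Longrightarrow> y \<in> I \<Longrightarrow> x \<ominus> y \<in> I"
proof -
  interpret ideal I R by fact
  show "x \<in> I \<Longrightarrow> x \<in> carrier R" "\<zero> \<in> I" "x \<in> I \<Longrightarrow> y \<in> I \<Longrightarrow> x \<oplus> y \<in> I"
    "a \<in> carrier R \<Longrightarrow> x \<in> I \<Longrightarrow> a \<otimes> x \<in> I" "a \<in> carrier R \<Longrightarrow> x \<in> I \<Longrightarrow> x \<otimes> a \<in> I"
    "x \<in> I \<Longrightarrow> y \<in> I \<Longrightarrow> x \<ominus> y \<in> I"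
    by (auto simp: I_l_closed I_r_closed a_minus_def)
qed

definition add_multiples :: "'a set \<Rightarrow> 'a \<Rightarrow> 'a set" where
  "add_multiples I v = {i \<oplus> r \<otimes> v | i r. i \<in> I \<and> r \<in> carrier R}"

lemma add_multiples:
  assumes "ideal I R" "v \<in> carrier R"
  shows "ideal (add_multiples I v) R" "I \<subseteq> add_multiples I v" "v \<in> add_multiples I v"
    "ideal J R \<Longrightarrow> I \<subseteq> J \<Longrightarrow> v \<in> J \<Longrightarrow> add_multiples I v \<subseteq> J"
proof -
  show "ideal (add_multiples I v) R" unfolding add_multiples_def
    by (rule ideal_add_multiples[OF is_cring assms])
  note D = idealD[OF assms(1)]
  show "I \<subseteq> add_multiples I v"
  proof
    fix i assume "i \<in> I"
    moreover from this have "i = i \<oplus> \<zero> \<otimes> v" using D assms by simp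
    ultimately show "i \<in> add_multiples I v" unfolding add_multiples_def by blast
  qed
  have "v = \<zero> \<oplus> \<one> \<otimes> v" using assms by simp
  then show "v \<in> add_multiples I v" unfolding add_multiples_def using D(2) by blast
  show "ideal J R \<Longrightarrow> I \<subseteq> J \<Longrightarrow> v \<in> J \<Longrightarrow> add_multiples I v \<subseteq> J"
    unfolding add_multiples_def using idealD by blast
qed

lemma primeideal_ideal: "primeideal P R \<Longrightarrow> ideal P R"
  by (rule primeideal.axioms(1))

lemma primeideal_one: "primeideal P R \<Longrightarrow> \<one> \<notin> P"
  using ideal.one_imp_carrier[OF primeideal_ideal] primeideal.I_notcarr by metis

lemma primeideal_mult: "primeideal P R \<Longrightarrow> a \<in> carrier R \<Longrightarrow> b \<in> carrier R \<Longrightarrow> a \<notin> P \<Longrightarrow> b \<notin> P \<Longrightarrow> a \<otimes> b \<notin> P"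
  using primeideal.I_prime[of P R a b] by auto

lemma primeideal_pow: "primeideal P R \<Longrightarrow> a \<in> carrier R \<Longrightarrow> a \<notin> P \<Longrightarrow> a [^] (n::nat) \<notin> P"
proof (induction n)
  case (Suc n)
  then show ?case using primeideal_mult[of P "a [^] n" a] by simp
qed (simp add: primeideal_one)

text \<open>An ideal over \<open>I\<close> maximal among those missing \<open>W\<close> is prime: if
  it contained a b but neither factor, both enlargements, by a and by b, would meet
  \<open>W\<close>, and the product of two such elements would lie in \<open>W\<close> and in the
  ideal.\<close>

lemma exists_primeideal_avoiding:
  assumes I: "ideal I R" and W: "W \<subseteq> carrier R" "\<one> \<in> W" "\<And>a b. a \<in> W \<Longrightarrow> b \<in> W \<Longrightarrow> a \<otimes> b \<in> W"
    and disj: "I \<inter> W = {}"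
  shows "\<exists>P. primeideal P R \<and> I \<subseteq> P \<and> P \<inter> W = {}"
proof -
  obtain J where J: "ideal J R" "I \<subseteq> J" "J \<inter> W = {}"
    and max: "\<And>J'. ideal J' R \<Longrightarrow> I \<subseteq> J' \<Longrightarrow> J' \<inter> W = {} \<Longrightarrow> J \<subseteq> J' \<Longrightarrow> J' = J"
    using exists_maximal_ideal_with[OF I, of "\<lambda>J. I \<subseteq> J \<and> J \<inter> W = {}"] disj by auto
  note JD = idealD[OF J(1)]
  have meet: "\<exists>j\<in>J. \<exists>r\<in>carrier R. j \<oplus> r \<otimes> a \<in> W" if "a \<in> carrier R" "a \<notin> J" for a
  proof (rule ccontr)
    assume "\<not> ?thesis"
    then have "add_multiples J a \<inter> W = {}" unfolding add_multiples_def by blast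
    then show False using max[of "add_multiples J a"] add_multiples[OF J(1) that(1)] J(2) that by auto
  qed
  have "primeideal J R"
  proof (rule primeidealI[OF J(1) is_cring])
    show "carrier R \<noteq> J" using W J by auto
    fix a b assume ab: "a \<in> carrier R" "b \<in> carrier R" "a \<otimes> b \<in> J"
    show "a \<in> J \<or> b \<in> J"
    proof (rule ccontr)
      assume "\<not> ?thesis"
      then obtain i r j s where *: "i \<in> J" "r \<in> carrier R" "i \<oplus> r \<otimes> a \<in> W" "j \<in> J" "s \<in> carrier R" "j \<oplus> s \<otimes> b \<in> W"
        using meet ab by metis
      have "(i \<oplus> r \<otimes> a) \<otimes> (j \<oplus> s \<otimes> b) = i \<otimes> (j \<oplus> s \<otimes> b) \<oplus> ((r \<otimes> a) \<otimes> j \<oplus> (r \<otimes> s) \<otimes> (a \<otimes> b))"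
        using * ab JD(1) by (simp add: l_distr r_distr m_ac a_ac)
      also have "\<dots> \<in> J" using * ab JD by simp
      finally show False using W(3)[OF *(3,6)] J(3) by blast
    qed
  qed
  then show ?thesis using J by blast
qed

text \<open>Noetherian induction: an ideal maximal among the counterexamples is proper and not
  prime, so it contains some a b without a and b. Every prime over it contains a or b, hence the
  finite sets for the two enlargements together serve for it as well.\<close>

lemma finitely_many_primes_over:
  assumes "ideal I R"
  shows "\<exists>\<Q>. finite \<Q> \<and> (\<forall>Q\<in>\<Q>. primeideal Q R \<and> I \<subseteq> Q) \<and> (\<forall>P. primeideal P R \<and> I \<subseteq> P \<longrightarrow> (\<exists>Q\<in>\<Q>. Q \<subseteq> P))"
    (is "?good I")
proof (rule ccontr)
  assume "\<not> ?good I"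
  then obtain J where J: "ideal J R" "\<not> ?good J"
    and max: "\<And>J'. ideal J' R \<Longrightarrow> \<not> ?good J' \<Longrightarrow> J \<subseteq> J' \<Longrightarrow> J' = J"
    using exists_maximal_ideal_with[OF assms, of "\<lambda>J. \<not> ?good J"] by auto
  have "\<not> primeideal J R" using J(2) by (metis finite.emptyI finite_insert order_refl singletonD singletonI)
  moreover have "carrier R \<noteq> J"
  proof
    assume "carrier R = J"
    then have "\<not> (primeideal P R \<and> J \<subseteq> P)" for P using primeideal_one by auto
    then have "?good J" by (intro exI[of _ "{}"]) auto
    then show False using J(2) by blast
  qed
  ultimately obtain a b where ab: "a \<in> carrier R" "b \<in> carrier R" "a \<otimes> b \<in> J" "a \<notin> J" "b \<notin> J"
    using primeidealI[OF J(1) is_cring] by blast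
  note A = add_multiples[OF J(1) ab(1)] and B = add_multiples[OF J(1) ab(2)]
  have "?good (add_multiples J a)"
  proof (rule ccontr)
    assume "\<not> ?good (add_multiples J a)"
    from max[OF A(1) this A(2)] show False using A(3) ab by simp
  qed
  moreover have "?good (add_multiples J b)"
  proof (rule ccontr)
    assume "\<not> ?good (add_multiples J b)"
    from max[OF B(1) this B(2)] show False using B(3) ab by simp
  qed
  ultimately obtain \<Q>a \<Q>b where Qa: "finite \<Q>a \<and> (\<forall>Q\<in>\<Q>a. primeideal Q R \<and> add_multiples J a \<subseteq> Q) \<and>
      (\<forall>P. primeideal P R \<and> add_multiples J a \<subseteq> P \<longrightarrow> (\<exists>Q\<in>\<Q>a. Q \<subseteq> P))"
    and Qb: "finite \<Q>b \<and> (\<forall>Q\<in>\<Q>b. primeideal Q R \<and> add_multiples J b \<subseteq> Q) \<and>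
      (\<forall>P. primeideal P R \<and> add_multiples J b \<subseteq> P \<longrightarrow> (\<exists>Q\<in>\<Q>b. Q \<subseteq> P))"
    by (elim exE)
  have "\<exists>Q\<in>\<Q>a \<union> \<Q>b. Q \<subseteq> P" if P: "primeideal P R" "J \<subseteq> P" for P
  proof -
    have "a \<in> P \<or> b \<in> P" using primeideal.I_prime[OF P(1), of a b] ab P(2) by auto
    then have "add_multiples J a \<subseteq> P \<or> add_multiples J b \<subseteq> P"
      using A(4)[OF primeideal_ideal[OF P(1)] P(2)] B(4)[OF primeideal_ideal[OF P(1)] P(2)] by auto
    then show ?thesis using Qa Qb P(1) by (metis UnCI)
  qed
  moreover have "primeideal Q R \<and> J \<subseteq> Q" if "Q \<in> \<Q>a \<union> \<Q>b" for Q
    using that Qa Qb A(2) B(2) by (metis UnE subset_trans)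
  moreover have "finite (\<Q>a \<union> \<Q>b)" using Qa Qb by auto
  ultimately have "?good J" by (intro exI[of _ "\<Q>a \<union> \<Q>b"]) simp
  then show False using J(2) by (rule notE[rotated])
qed

lemma exists_in_ideals_not_in_prime:
  assumes "finite \<Q>" "\<And>Q. Q \<in> \<Q> \<Longrightarrow> ideal Q R" "primeideal P R" "\<And>Q. Q \<in> \<Q> \<Longrightarrow> \<not> Q \<subseteq> P"
  shows "\<exists>z\<in>carrier R. z \<notin> P \<and> (\<forall>Q\<in>\<Q>. z \<in> Q)"
  using assms
proof (induction \<Q> rule: finite_induct)
  case empty
  then show ?case using primeideal_one by auto
next
  case (insert Q \<Q>)
  then obtain z where z: "z \<in> carrier R" "z \<notin> P" "\<And>Q. Q \<in> \<Q> \<Longrightarrow> z \<in> Q" by auto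
  obtain w where w: "w \<in> Q" "w \<notin> P" using insert.prems(3)[of Q] by auto
  have Q: "ideal Q R" using insert by auto
  have wc: "w \<in> carrier R" using idealD(1)[OF Q w(1)] .
  have "z \<otimes> w \<in> Q'" if "Q' \<in> insert Q \<Q>" for Q'
    using that idealD(4)[OF Q z(1) w(1)] idealD(5)[of Q'] z(3) wc insert.prems(1)[of Q'] by auto
  then show ?case using primeideal_mult[OF assms(3) z(1) wc z(2) w(2)] z(1) wc by blast
qed

text \<open>Induction on the number of primes, taking out a minimal one \<open>Q\<close>. If y
  avoids the others but lies in \<open>Q\<close>, then an element z of \<open>I\<close> and of all
  the others, but not of \<open>Q\<close>, is added. It exists because neither \<open>I\<close> nor,
  by minimality, any other prime of the set lies inside \<open>Q\<close>.\<close>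

lemma prime_avoidance:
  assumes "finite \<Q>" "\<And>Q. Q \<in> \<Q> \<Longrightarrow> primeideal Q R" "ideal I R" "\<And>Q. Q \<in> \<Q> \<Longrightarrow> \<not> I \<subseteq> Q"
  shows "\<exists>y\<in>I. \<forall>Q\<in>\<Q>. y \<notin> Q"
  using assms
proof (induction "card \<Q>" arbitrary: \<Q>)
  case 0
  then show ?case using idealD(2) by auto
next
  case (Suc n)
  note ID = idealD[OF \<open>ideal I R\<close>]
  have "\<Q> \<noteq> {}" using Suc by auto
  then obtain Q where Q: "Q \<in> \<Q>" "\<And>Q'. Q' \<in> \<Q> \<Longrightarrow> Q' \<subseteq> Q \<Longrightarrow> Q = Q'"
    using finite_has_minimal[OF \<open>finite \<Q>\<close>] by blast
  obtain y where y: "y \<in> I" "\<And>Q'. Q' \<in> \<Q> - {Q} \<Longrightarrow> y \<notin> Q'"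
  proof -
    have "n = card (\<Q> - {Q})" using Suc.hyps(2) Q(1) Suc.prems(1) by simp
    from Suc.hyps(1)[OF this] have "\<exists>y\<in>I. \<forall>Q'\<in>\<Q> - {Q}. y \<notin> Q'" using Suc.prems by auto
    then show thesis using that by blast
  qed
  show ?case
  proof (cases "y \<in> Q")
    case False
    then show ?thesis using y by blast
  next
    case True
    have "\<exists>z\<in>carrier R. z \<notin> Q \<and> (\<forall>Q'\<in>insert I (\<Q> - {Q}). z \<in> Q')"
      by (rule exists_in_ideals_not_in_prime) (use Suc.prems Q primeideal_ideal in blast)+
    then obtain z where z: "z \<in> carrier R" "z \<notin> Q" "z \<in> I" "\<And>Q'. Q' \<in> \<Q> - {Q} \<Longrightarrow> z \<in> Q'" by blast
    have yc: "y \<in> carrier R" using y ID by blast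
    have "(y \<oplus> z) \<ominus> z = y" "(y \<oplus> z) \<ominus> y = z"
      using yc z(1) a_lcomm[of y z "\<ominus> y"] by (simp_all add: minus_eq a_assoc r_neg)
    then have "y \<oplus> z \<notin> Q'" if "Q' \<in> \<Q>" for Q'
      using that True y(2) z(2,4) idealD(6)[OF primeideal_ideal[OF Suc.prems(2)[OF that]]]
      by (metis DiffI singletonD)
    then show ?thesis using ID(3)[OF y(1) z(3)] by blast
  qed
qed

subsection \<open>Krull's principal ideal theorem\<close>

text \<open>The ideals of the localisation at a prime \<open>P\<close> are represented by the \<open>P\<close>-saturated ideals.\<close>

definition saturated :: "'a set \<Rightarrow> 'a set \<Rightarrow> bool" where
  "saturated P N \<longleftrightarrow> ideal N R \<and> (\<forall>s\<in>carrier R - P. \<forall>x\<in>carrier R. s \<otimes> x \<in> N \<longrightarrow> x \<in> N)"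

text \<open>The contraction to R of the extension of \<open>N\<close> to the localisation at
  \<open>P\<close>.\<close>

definition saturation :: "'a set \<Rightarrow> 'a set \<Rightarrow> 'a set" where
  "saturation P N = {x \<in> carrier R. \<exists>s\<in>carrier R - P. s \<otimes> x \<in> N}"

lemma saturatedD:
  assumes "saturated P N"
  shows "ideal N R" "s \<in> carrier R \<Longrightarrow> s \<notin> P \<Longrightarrow> x \<in> carrier R \<Longrightarrow> s \<otimes> x \<in> N \<Longrightarrow> x \<in> N"
  using assms by (auto simp: saturated_def)

lemma saturation:
  assumes P: "primeideal P R" and N: "ideal N R"
  shows "saturated P (saturation P N)" "N \<subseteq> saturation P N" "saturated P L \<Longrightarrow> N \<subseteq> L \<Longrightarrow> saturation P N \<subseteq> L"
proof -
  note ND = idealD[OF N]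
  show "N \<subseteq> saturation P N"
    using ND(1) primeideal_one[OF P] by (auto simp: saturation_def intro!: bexI[of _ \<one>])
  show "saturated P L \<Longrightarrow> N \<subseteq> L \<Longrightarrow> saturation P N \<subseteq> L"
    using saturatedD(2)[of P L] by (auto simp: saturation_def)
  have I: "x \<in> saturation P N" if "x \<in> carrier R" "s \<in> carrier R" "s \<notin> P" "s \<otimes> x \<in> N" for x s
    using that by (auto simp: saturation_def)
  have "ideal (saturation P N) R"
  proof (rule idealI')
    show "saturation P N \<subseteq> carrier R" by (auto simp: saturation_def)
    show "\<zero> \<in> saturation P N" using \<open>N \<subseteq> saturation P N\<close> ND(2) by auto
  next
    fix a b assume "a \<in> saturation P N" "b \<in> saturation P N"
    then obtain s t where *: "a \<in> carrier R" "s \<in> carrier R" "s \<notin> P" "s \<otimes> a \<in> N"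
      "b \<in> carrier R" "t \<in> carrier R" "t \<notin> P" "t \<otimes> b \<in> N" by (auto simp: saturation_def)
    have "(s \<otimes> t) \<otimes> (a \<oplus> b) = t \<otimes> (s \<otimes> a) \<oplus> s \<otimes> (t \<otimes> b)" using * by (simp add: r_distr m_ac)
    also have "\<dots> \<in> N" using * ND by simp
    finally show "a \<oplus> b \<in> saturation P N" using I[of "a \<oplus> b" "s \<otimes> t"] * primeideal_mult[OF P] by simp
  next
    fix a x assume a: "a \<in> carrier R" and "x \<in> saturation P N"
    then obtain s where *: "x \<in> carrier R" "s \<in> carrier R" "s \<notin> P" "s \<otimes> x \<in> N" by (auto simp: saturation_def)
    have "s \<otimes> (a \<otimes> x) = a \<otimes> (s \<otimes> x)" using * a by (simp add: m_ac)
    then show "a \<otimes> x \<in> saturation P N" using I[of "a \<otimes> x" s] * a ND(4) by simp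
  qed
  moreover have "x \<in> saturation P N" if *: "s \<in> carrier R - P" "x \<in> carrier R" "s \<otimes> x \<in> saturation P N" for s x
  proof -
    obtain t where t: "t \<in> carrier R" "t \<notin> P" "t \<otimes> (s \<otimes> x) \<in> N" using *(3) by (auto simp: saturation_def)
    then show ?thesis using I[of x "t \<otimes> s"] * primeideal_mult[OF P] by (simp add: m_assoc)
  qed
  ultimately show "saturated P (saturation P N)" by (simp add: saturated_def)
qed

text \<open>In other words, the localisation of \<open>R / I\<close> at \<open>P\<close> is Artinian.\<close>

lemma saturated_descending_chain:
  assumes P: "primeideal P R" and I: "ideal I R"
    and nil: "\<And>a. a \<in> P \<Longrightarrow> \<exists>s\<in>carrier R - P. \<exists>k::nat. s \<otimes> a [^] k \<in> I"
    and f: "\<And>n::nat. saturated P (f n)" "\<And>n. I \<subseteq> f n" "\<And>n. f (Suc n) \<subseteq> f n"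
  shows "\<exists>n. \<forall>i\<ge>n. f i = f n"
proof -
  interpret RR: module R "regular_module R" by (rule regular_module) (rule is_cring)
  \<comment> \<open>The descending condition for saturated ideals between \<open>I\<close> and
    \<open>N\<close>. A saturated ideal maximal with this property exists because R is Noetherian,
    and it is shown to be all of R.\<close>
  define dcc where "dcc N \<longleftrightarrow> (\<forall>f::nat \<Rightarrow> 'a set. (\<forall>n. saturated P (f n) \<and> I \<subseteq> f n \<and> f n \<subseteq> N \<and> f (Suc n) \<subseteq> f n)
    \<longrightarrow> (\<exists>n. \<forall>i\<ge>n. f i = f n))" for N
  have "dcc (saturation P I)"
    unfolding dcc_def
  proof (intro allI impI)
    fix f :: "nat \<Rightarrow> 'a set"
    assume "\<forall>n. saturated P (f n) \<and> I \<subseteq> f n \<and> f n \<subseteq> saturation P I \<and> f (Suc n) \<subseteq> f n"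
    then have "f n = saturation P I" for n using saturation(3)[OF P I] by blast
    then show "\<exists>n. \<forall>i\<ge>n. f i = f n" by simp
  qed
  moreover note sI = saturation(1,2)[OF P I]
  moreover have "ideal (saturation P I) R" using saturatedD(1)[OF sI(1)] .
  ultimately obtain N where N: "ideal N R" "saturated P N" "I \<subseteq> N" "dcc N"
    and max: "\<And>N'. ideal N' R \<Longrightarrow> saturated P N' \<Longrightarrow> I \<subseteq> N' \<Longrightarrow> dcc N' \<Longrightarrow> N \<subseteq> N' \<Longrightarrow> N' = N"
    using exists_maximal_ideal_with[of "saturation P I" "\<lambda>N. saturated P N \<and> I \<subseteq> N \<and> dcc N"] by auto
  note ND = idealD[OF N(1)] and Nsat = saturatedD(2)[OF N(2)]
  have "N = carrier R"
  proof (rule ccontr)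
    assume "N \<noteq> carrier R"
    then have one: "\<one> \<in> carrier R" "\<one> \<notin> N" using ideal.one_imp_carrier[OF N(1)] by auto
    obtain B where B: "B \<subseteq> carrier R" "finite B" "P = Idl B" using finetely_gen[OF primeideal_ideal[OF P]] by blast
    have BP: "B \<subseteq> P" using B genideal_self by blast
    have nilN: "\<exists>n::nat. (b [^] n) \<odot>\<^bsub>regular_module R\<^esub> z \<in> N" if b: "b \<in> B" and z: "z \<in> carrier R" for b z
    proof -
      obtain s and k :: nat where s: "s \<in> carrier R" "s \<notin> P" "s \<otimes> b [^] k \<in> I" using nil[of b] b BP by blast
      then have "b [^] k \<in> N" using Nsat[of s "b [^] k"] b B N(3) by auto
      then show ?thesis using ND(5)[of z] z by (intro exI[of _ k]) (simp add: regular_module_def)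
    qed
    have "submodule N R (regular_module R)" "submodule (carrier R) R (regular_module R)"
      using N(1) oneideal submodule_regular_module_iff[OF is_cring] by auto
    then obtain v where v: "v \<in> carrier R" "v \<notin> N" "\<And>b. b \<in> B \<Longrightarrow> b \<otimes> v \<in> N"
      using RR.exists_annihilated_mod[of N "carrier R" \<one> B] one B nilN by (auto simp: regular_module_def)
    have "ideal {a \<in> carrier R. a \<otimes> v \<in> N} R"
      by (rule idealI') (use ND v in \<open>auto simp: l_distr m_assoc\<close>)
    then have "P \<subseteq> {a \<in> carrier R. a \<otimes> v \<in> N}" unfolding B(3) using B v by (intro genideal_minimal) auto
    then have Pv: "a \<otimes> v \<in> N" if "a \<in> P" for a using that by blast
    \<comment> \<open>\<open>P\<close> sends v into \<open>N\<close>, so over the localisation at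
      \<open>P\<close> the step from \<open>N\<close> to \<open>N'\<close> is a simple
      module.\<close>
    define N' where "N' = saturation P (add_multiples N v)"
    note A = add_multiples[OF N(1) v(1)] and S = saturation[OF P add_multiples(1)[OF N(1) v(1)], folded N'_def]
    have N': "N \<subseteq> N'" "v \<in> N'" using A S by auto
    have rep: "\<exists>s\<in>carrier R - P. \<exists>n\<in>N. \<exists>a\<in>carrier R. s \<otimes> y = n \<oplus> a \<otimes> v" if "y \<in> N'" for y
      using that unfolding N'_def saturation_def add_multiples_def by blast
    have "dcc N'"
      unfolding dcc_def
    proof (intro allI impI)
      fix f :: "nat \<Rightarrow> 'a set"
      assume "\<forall>n. saturated P (f n) \<and> I \<subseteq> f n \<and> f n \<subseteq> N' \<and> f (Suc n) \<subseteq> f n"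
      then have f: "saturated P (f n)" "I \<subseteq> f n" "f n \<subseteq> N'" "f (Suc n) \<subseteq> f n" for n by auto
      note fD = idealD[OF saturatedD(1)[OF f(1)]] and fsat = saturatedD(2)[OF f(1)]
      have dec: "f j \<subseteq> f i" if "i \<le> j" for i j using lift_Suc_antimono_le[of f, OF f(4) that] .
      have "saturated P (f n \<inter> N)" for n
        using fsat Nsat i_intersect[OF saturatedD(1)[OF f(1)[of n]] N(1)] by (auto simp: saturated_def)
      then obtain n1 where n1: "\<And>i. i \<ge> n1 \<Longrightarrow> f i \<inter> N = f n1 \<inter> N"
        using N(4)[unfolded dcc_def, rule_format, of "\<lambda>n. f n \<inter> N"] f(2,4) N(3) by blast
      show "\<exists>n. \<forall>i\<ge>n. f i = f n"
      \<comment> \<open>Either the chain ends up inside \<open>N\<close>, or each member has an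
        element outside \<open>N\<close> and so fills the simple layer between \<open>N\<close> and
        \<open>N'\<close>; then it is determined by its intersection with \<open>N\<close>.\<close>
      proof (cases "\<exists>m. f m \<subseteq> N")
        case True
        then obtain m where m: "f m \<subseteq> N" ..
        have "f i = f (max m n1)" if i: "i \<ge> max m n1" for i
        proof -
          have "f i \<subseteq> N" "f (max m n1) \<subseteq> N" using m dec[of m i] dec[of m "max m n1"] i by auto
          then show ?thesis using n1[of i] n1[of "max m n1"] i by auto
        qed
        then show ?thesis by blast
      next
        case False
        have "f n1 \<subseteq> f i" if i: "i \<ge> n1" for i
        proof
          fix y assume y: "y \<in> f n1"
          obtain l where l: "l \<in> f i" "l \<notin> N" using False by blast
          obtain s n a where 1: "s \<in> carrier R" "s \<notin> P" "n \<in> N" "a \<in> carrier R" "s \<otimes> y = n \<oplus> a \<otimes> v"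
            using rep[of y] y f(3)[of n1] by blast
          obtain s' n' a' where 2: "s' \<in> carrier R" "s' \<notin> P" "n' \<in> N" "a' \<in> carrier R" "s' \<otimes> l = n' \<oplus> a' \<otimes> v"
            using rep[of l] l f(3)[of i] by blast
          have lc: "l \<in> carrier R" "y \<in> carrier R" using fD(1) l y by auto
          have "a' \<notin> P"
          proof
            assume "a' \<in> P"
            then have "s' \<otimes> l \<in> N" using Pv 2 ND(3) by simp
            then show False using Nsat[of s' l] 2 lc l by blast
          qed
          have ln: "l \<in> f n1" using l dec[OF i] by blast
          \<comment> \<open>Cross-multiplication cancels the multiples of v and gives an element of
            \<open>N\<close>. The factor a' lies outside \<open>P\<close>, so saturation removes it
            again.\<close>
          define z where "z = a' \<otimes> (s \<otimes> y) \<ominus> a \<otimes> (s' \<otimes> l)"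
          have zf: "z \<in> f n1" unfolding z_def
            by (rule fD(6)[OF fD(4)[OF 2(4) fD(4)[OF 1(1) y]] fD(4)[OF 1(4) fD(4)[OF 2(1) ln]]])
          have "z = a' \<otimes> n \<ominus> a \<otimes> n'"
          proof -
            have nc: "n \<in> carrier R" "n' \<in> carrier R" using 1 2 ND by auto
            have "z = (a' \<otimes> n \<oplus> a' \<otimes> (a \<otimes> v)) \<ominus> (a \<otimes> n' \<oplus> a' \<otimes> (a \<otimes> v))"
              unfolding z_def 1(5) 2(5) using 1 2 nc v by (simp add: r_distr m_lcomm)
            then show ?thesis using 1 2 nc v by (simp add: minus_eq minus_add a_ac r_neg1 r_neg2 r_neg)
          qed
          then have "z \<in> N" using 1 2 ND(4,6) by simp
          then have zi: "z \<in> f i" using zf n1[OF i] by blast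
          have "b = (b \<ominus> c) \<oplus> c" if "b \<in> carrier R" "c \<in> carrier R" for b c
            using that by (simp add: minus_eq a_assoc l_neg)
          then have eq: "a' \<otimes> (s \<otimes> y) = z \<oplus> a \<otimes> (s' \<otimes> l)"
            unfolding z_def using 1(1,4) 2(1,4) lc by (meson m_closed)
          have "a' \<otimes> (s \<otimes> y) \<in> f i"
            unfolding eq by (rule fD(3)[OF zi fD(4)[OF 1(4) fD(4)[OF 2(1) l(1)]]])
          then have "s \<otimes> y \<in> f i" using fsat[of a'] 1 2 lc \<open>a' \<notin> P\<close> by blast
          then show "y \<in> f i" using fsat[of s] 1 lc by blast
        qed
        then have "f i = f n1" if "i \<ge> n1" for i using dec[OF that] that by blast
        then show ?thesis by blast
      qed
    qed
    then have "N' = N" using max[of N'] saturatedD(1)[OF S(1)] S(1) N(3) N'(1) by blast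
    then show False using N' v by blast
  qed
  then have "dcc (carrier R)" using N(4) by simp
  moreover have "f n \<subseteq> carrier R" for n using idealD(1)[OF saturatedD(1)[OF f(1)]] by blast
  ultimately show ?thesis unfolding dcc_def using f by blast
qed

text \<open>Otherwise \<open>P\<close> is the only prime inside \<open>P\<close> over
  \<open>I\<close> = Q0 + (x), and R / I localised at \<open>P\<close> is Artinian. For y in
  \<open>Q\<close> outside \<open>Q0\<close> let \<open>J n\<close> be contracted from Q0 + (y^n) at
  \<open>Q\<close>. For some n, locally at \<open>P\<close>, J n and J (n + 1) agree modulo x; as x
  is outside \<open>Q\<close>, this becomes J n = J (n + 1) + x J n, and Nakayama gives J n = J (n +
  1). Cancelling y^n modulo the prime \<open>Q0\<close> then puts an element outside
  \<open>Q\<close> into \<open>Q\<close>.\<close>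

lemma krull_principal_ideal:
  assumes Q0: "primeideal Q0 R" and Q: "primeideal Q R" and P: "primeideal P R"
    and sub: "Q0 \<subset> Q" "Q \<subset> P" and x: "x \<in> P"
  shows "\<exists>P'. primeideal P' R \<and> Q0 \<subseteq> P' \<and> x \<in> P' \<and> P' \<subset> P"
proof (rule ccontr)
  assume none: "\<not> ?thesis"
  note iQ0 = primeideal_ideal[OF Q0] and iQ = primeideal_ideal[OF Q] and iP = primeideal_ideal[OF P]
  note Q0D = idealD[OF iQ0] and QD = idealD[OF iQ] and PD = idealD[OF iP]
  have xc: "x \<in> carrier R" using PD(1) x .
  have xQ: "x \<notin> Q" using none Q sub by blast
  define I where "I = add_multiples Q0 x"
  note I = add_multiples[OF iQ0 xc, folded I_def]
  \<comment> \<open>A prime over \<open>I\<close> missing all products s a^k with s outside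
    \<open>P\<close> would lie inside \<open>P\<close> without containing a: the very prime assumed
    not to exist.\<close>
  have nil: "\<exists>s\<in>carrier R - P. \<exists>k::nat. s \<otimes> a [^] k \<in> I" if a: "a \<in> P" for a
  proof (rule ccontr)
    assume no: "\<not> ?thesis"
    have ac: "a \<in> carrier R" using a PD by blast
    define W where "W = {s \<otimes> a [^] k | s k. s \<in> carrier R - P \<and> (k :: nat) \<in> UNIV}"
    have WI: "s \<otimes> a [^] k \<in> W" if "s \<in> carrier R" "s \<notin> P" for s and k :: nat using that unfolding W_def by blast
    have "\<exists>P'. primeideal P' R \<and> I \<subseteq> P' \<and> P' \<inter> W = {}"
    proof (rule exists_primeideal_avoiding[OF I(1)])
      show "W \<subseteq> carrier R" using ac unfolding W_def by auto
      show "\<one> \<in> W" using WI[of \<one> 0] primeideal_one[OF P] by simp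
      show "b \<otimes> c \<in> W" if bc: "b \<in> W" "c \<in> W" for b c
      proof -
        obtain s k t m where *: "s \<in> carrier R" "s \<notin> P" "b = s \<otimes> a [^] (k::nat)" "t \<in> carrier R" "t \<notin> P" "c = t \<otimes> a [^] (m::nat)"
          using bc unfolding W_def by blast
        have "b \<otimes> c = (s \<otimes> t) \<otimes> a [^] (k + m)" using * ac by (simp add: nat_pow_mult[symmetric] m_ac)
        then show ?thesis using WI[of "s \<otimes> t" "k + m"] * primeideal_mult[OF P] by simp
      qed
      show "I \<inter> W = {}" using no unfolding W_def by blast
    qed
    then obtain P' where P': "primeideal P' R" "I \<subseteq> P'" "P' \<inter> W = {}" by blast
    have "s \<in> P" if "s \<in> P'" for s
    proof (rule ccontr)
      have sc: "s \<in> carrier R" using idealD(1)[OF primeideal_ideal[OF P'(1)] that] .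
      assume "s \<notin> P"
      then show False using WI[of s 0] sc P'(3) that by auto
    qed
    moreover have "a \<notin> P'" using WI[of \<one> 1] primeideal_one[OF P] ac P'(3) by auto
    ultimately show False using none P' I(2,3) a by blast
  qed
  obtain y where y: "y \<in> Q" "y \<notin> Q0" using sub by blast
  have yc: "y \<in> carrier R" using QD y by blast
  define J where "J n = saturation Q (add_multiples Q0 (y [^] n))" for n :: nat
  have yn: "y [^] n \<in> carrier R" for n :: nat using yc by simp
  note A = add_multiples[OF iQ0 yn] and S = saturation[OF Q add_multiples(1)[OF iQ0 yn], folded J_def]
  note Jsat = saturatedD(2)[OF S(1)] and JD = idealD[OF saturatedD(1)[OF S(1)]]
  have Q0J: "Q0 \<subseteq> J n" for n using A(2) S(2) by blast
  have Jdec: "J (Suc n) \<subseteq> J n" for n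
  proof (rule S(3)[OF S(1)])
    show "add_multiples Q0 (y [^] Suc n) \<subseteq> J n"
    proof (rule A(4))
      show "ideal (J n) R" by (rule saturatedD(1)[OF S(1)])
      show "Q0 \<subseteq> J n" by (rule Q0J)
      have "y [^] n \<in> J n" using A(3) S(2) by blast
      then show "y [^] Suc n \<in> J n" using JD(5) yc by simp
    qed
  qed
  define L where "L n = saturation P (add_multiples (J n) x)" for n
  note B = add_multiples[OF saturatedD(1)[OF S(1)] xc]
  note SL = saturation[OF P B(1), folded L_def]
  have "\<exists>n. \<forall>i\<ge>n. L i = L n"
  proof (rule saturated_descending_chain[OF P I(1) nil])
    show "saturated P (L n)" for n by (rule SL(1))
    show "I \<subseteq> L n" for n
      using add_multiples(4)[OF iQ0 xc B(1)[of n], folded I_def] Q0J B(2,3) SL(2)[of n] by blast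
    have "add_multiples (J (Suc n)) x \<subseteq> add_multiples (J n) x" for n
      using B(4)[of "add_multiples (J n) x" "Suc n"] B(1,2,3) Jdec by blast
    then show "L (Suc n) \<subseteq> L n" for n unfolding L_def saturation_def by blast
  qed
  then obtain n where n: "\<forall>i\<ge>n. L i = L n" ..
  have Ln: "L (Suc n) = L n" by (rule n[rule_format]) simp
  have PQ: "s \<notin> Q" if "s \<notin> P" for s using that sub by blast
  \<comment> \<open>This expresses J n = J (n + 1) + x J n at \<open>P\<close>. At first only x t is
    known to lie in J n; since x is outside \<open>Q\<close>, saturation at \<open>Q\<close> puts t
    itself there.\<close>
  have dec: "\<exists>s\<in>carrier R - P. \<exists>t\<in>J n. s \<otimes> r \<ominus> t \<otimes> x \<in> J (Suc n)" if r: "r \<in> J n" for r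
  proof -
    have "r \<in> L (Suc n)" using r B(2) SL(2) Ln by blast
    then obtain s j t where *: "s \<in> carrier R" "s \<notin> P" "j \<in> J (Suc n)" "t \<in> carrier R" "s \<otimes> r = j \<oplus> t \<otimes> x"
      unfolding L_def saturation_def add_multiples_def by blast
    have c: "r \<in> carrier R" "j \<in> carrier R" using r * JD(1) by auto
    have "t \<otimes> x = s \<otimes> r \<ominus> j" using * c xc by (simp add: minus_eq a_ac r_neg r_neg1 r_neg2)
    moreover have "j \<in> J n" using * Jdec by blast
    ultimately have "t \<otimes> x \<in> J n" using JD(6)[OF JD(4)[OF *(1) r]] by metis
    then have "x \<otimes> t \<in> J n" using * xc by (simp add: m_comm)
    then have "t \<in> J n" using Jsat[of x t] xQ xc * by blast
    moreover have "s \<otimes> r \<ominus> t \<otimes> x = j" using * c xc by (simp add: minus_eq a_assoc r_neg)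
    ultimately show ?thesis using * by blast
  qed
  \<comment> \<open>Nakayama's lemma in terms of saturated ideals: let \<open>N\<close> be maximal
    among those from J (n + 1) up to J n that differ from J n. Over \<open>N\<close> a single v
    generates J n at \<open>P\<close>, and \<open>dec\<close> yields (s' s - a x) v in
    \<open>N\<close> with the factor outside \<open>P\<close>, so v lies in
    \<open>N\<close>.\<close>
  have "J n \<subseteq> J (Suc n)"
  proof (rule ccontr)
    assume ne: "\<not> J n \<subseteq> J (Suc n)"
    have satP: "saturated P (J m)" for m using S(1)[of m] PQ unfolding saturated_def by blast
    have "\<exists>N. ideal N R \<and> (saturated P N \<and> J (Suc n) \<subseteq> N \<and> N \<subseteq> J n \<and> N \<noteq> J n) \<and>
      (\<forall>N'. ideal N' R \<and> (saturated P N' \<and> J (Suc n) \<subseteq> N' \<and> N' \<subseteq> J n \<and> N' \<noteq> J n) \<and> N \<subseteq> N' \<longrightarrow> N' = N)"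
      by (rule exists_maximal_ideal_with[of "J (Suc n)"]) (use satP[of "Suc n"] Jdec ne saturatedD(1)[OF S(1)] in auto)
    then obtain N where N: "ideal N R" "saturated P N" "J (Suc n) \<subseteq> N" "N \<subseteq> J n" "N \<noteq> J n"
      and max0: "\<forall>N'. ideal N' R \<and> (saturated P N' \<and> J (Suc n) \<subseteq> N' \<and> N' \<subseteq> J n \<and> N' \<noteq> J n) \<and> N \<subseteq> N' \<longrightarrow> N' = N"
      by (elim exE conjE)
    have max: "N' = N" if "ideal N' R" "saturated P N'" "J (Suc n) \<subseteq> N'" "N' \<subseteq> J n" "N' \<noteq> J n" "N \<subseteq> N'" for N'
      using max0 that by simp
    note ND = idealD[OF N(1)] and Nsat = saturatedD(2)[OF N(2)]
    obtain v where v: "v \<in> J n" "v \<notin> N" using N by blast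
    have vc: "v \<in> carrier R" using v JD by blast
    define N' where "N' = saturation P (add_multiples N v)"
    note A' = add_multiples[OF N(1) vc] and S' = saturation[OF P add_multiples(1)[OF N(1) vc], folded N'_def]
    have "N' \<subseteq> J n" using S'(3)[OF satP] A'(4)[OF saturatedD(1)[OF S(1)]] N v by blast
    moreover have "N \<subseteq> N'" "v \<in> N'" using A' S' by auto
    ultimately have N': "N' = J n" using max[of N'] saturatedD(1)[OF S'(1)] S'(1) N v by blast
    obtain s t where st: "s \<in> carrier R" "s \<notin> P" "t \<in> J n" "s \<otimes> v \<ominus> t \<otimes> x \<in> J (Suc n)" using dec[OF v(1)] by blast
    then obtain s' m a where t: "s' \<in> carrier R" "s' \<notin> P" "m \<in> N" "a \<in> carrier R" "s' \<otimes> t = m \<oplus> a \<otimes> v"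
      using N' unfolding N'_def saturation_def add_multiples_def by blast
    have c: "t \<in> carrier R" "m \<in> carrier R" using st t JD ND by auto
    have "s' \<otimes> (s \<otimes> v \<ominus> t \<otimes> x) \<oplus> m \<otimes> x \<in> N"
      using st(4) N(3) t ND(3,4,5) xc by (simp add: subset_iff)
    moreover have "s' \<otimes> (s \<otimes> v \<ominus> t \<otimes> x) \<oplus> m \<otimes> x = (s' \<otimes> s \<ominus> a \<otimes> x) \<otimes> v"
    proof -
      have "s' \<otimes> (s \<otimes> v \<ominus> t \<otimes> x) = s' \<otimes> s \<otimes> v \<ominus> (s' \<otimes> t) \<otimes> x"
        using st(1) t(1) c xc vc by (simp add: minus_eq r_distr r_minus m_assoc)
      also have "\<dots> = s' \<otimes> s \<otimes> v \<ominus> (m \<otimes> x \<oplus> a \<otimes> x \<otimes> v)"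
      proof -
        have "(m \<oplus> a \<otimes> v) \<otimes> x = m \<otimes> x \<oplus> a \<otimes> x \<otimes> v"
        proof -
          have "a \<otimes> v \<otimes> x = a \<otimes> x \<otimes> v" using t(4) xc vc by (simp add: m_ac)
          then show ?thesis using t(4) c xc vc by (simp add: l_distr)
        qed
        then show ?thesis unfolding t(5) by simp
      qed
      finally show ?thesis
        using st t c xc vc by (simp add: minus_eq minus_add l_distr l_minus a_ac r_neg r_neg1 r_neg2)
    qed
    ultimately have "(s' \<otimes> s \<ominus> a \<otimes> x) \<otimes> v \<in> N" by simp
    moreover have "s' \<otimes> s \<ominus> a \<otimes> x \<notin> P"
    proof
      assume "s' \<otimes> s \<ominus> a \<otimes> x \<in> P"
      then have "(s' \<otimes> s \<ominus> a \<otimes> x) \<oplus> a \<otimes> x \<in> P" using PD(3,4) x t by blast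
      then show False using st t xc primeideal_mult[OF P, of s' s] by (simp add: minus_eq a_assoc l_neg)
    qed
    ultimately show False using Nsat[of "s' \<otimes> s \<ominus> a \<otimes> x" v] st t xc vc v by simp
  qed
  moreover have "y [^] n \<in> J n" using A(3) S(2) by blast
  ultimately have "y [^] n \<in> J (Suc n)" by blast
  then obtain s q w where *: "s \<in> carrier R" "s \<notin> Q" "q \<in> Q0" "w \<in> carrier R" "s \<otimes> y [^] n = q \<oplus> w \<otimes> y [^] Suc n"
    unfolding J_def saturation_def add_multiples_def by blast
  have qc: "q \<in> carrier R" using * Q0D by blast
  have "(s \<ominus> w \<otimes> y) \<otimes> y [^] n = s \<otimes> y [^] n \<ominus> w \<otimes> y [^] Suc n"
  proof -
    have "w \<otimes> y \<otimes> y [^] n = w \<otimes> y [^] Suc n" using * yc by (simp add: m_ac)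
    then show ?thesis using *(1,4) yc by (simp add: minus_eq l_distr l_minus)
  qed
  also have "\<dots> = q" unfolding *(5) using * qc yc by (simp add: minus_eq a_assoc r_neg)
  finally have "(s \<ominus> w \<otimes> y) \<otimes> y [^] n \<in> Q0" using * by simp
  then have "s \<ominus> w \<otimes> y \<in> Q0"
    using primeideal_mult[OF Q0, of "s \<ominus> w \<otimes> y" "y [^] n"] primeideal_pow[OF Q0 yc y(2), of n] * yc by auto
  then have "(s \<ominus> w \<otimes> y) \<oplus> w \<otimes> y \<in> Q" using QD(3,4) sub y * by blast
  then show False using * yc by (simp add: minus_eq a_assoc l_neg)
qed

subsection \<open>Systems of parameters\<close>

definition prime_chain :: "nat \<Rightarrow> (nat \<Rightarrow> 'a set) \<Rightarrow> bool" where
  "prime_chain n P \<longleftrightarrow> (\<forall>i\<le>n. primeideal (P i) R) \<and> (\<forall>i<n. P i \<subset> P (Suc i))"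

lemma prime_chain_append:
  assumes "prime_chain n P" "primeideal Q R" "P n \<subset> Q"
  shows "prime_chain (Suc n) (P(Suc n := Q))"
  using assms by (auto simp: prime_chain_def le_Suc_eq less_Suc_eq)

lemma prime_chain_butlast: "prime_chain (Suc n) P \<Longrightarrow> prime_chain n P"
  by (simp add: prime_chain_def)

text \<open>The chain is rebuilt from the top. If the prime below the top misses x, the principal
  ideal theorem replaces it by one that contains x; it is strictly above the next lower prime, which
  misses x too. Continuing downwards, only the lowest prime may still miss x, and it is
  dropped.\<close>

lemma prime_chain_through:
  assumes "prime_chain (Suc n) P" "x \<in> P (Suc n)"
  shows "\<exists>P'. prime_chain n P' \<and> P' n = P (Suc n) \<and> P 0 \<subseteq> P' 0 \<and> x \<in> P' 0"
  using assms
proof (induction n arbitrary: P)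
  case 0
  then show ?case by (intro exI[of _ "\<lambda>_. P (Suc 0)"]) (auto simp: prime_chain_def)
next
  case (Suc n)
  have pr: "primeideal (P n) R" "primeideal (P (Suc n)) R" "primeideal (P (Suc (Suc n))) R"
    and sub: "P n \<subset> P (Suc n)" "P (Suc n) \<subset> P (Suc (Suc n))"
    using Suc.prems(1) by (auto simp: prime_chain_def)
  obtain Q where Q: "primeideal Q R" "P n \<subset> Q" "x \<in> Q" "Q \<subset> P (Suc (Suc n))"
  proof (cases "x \<in> P (Suc n)")
    case True
    then show ?thesis using that[OF pr(2) sub(1)] sub(2) by blast
  next
    case False
    obtain Q where "primeideal Q R" "P n \<subseteq> Q" "x \<in> Q" "Q \<subset> P (Suc (Suc n))"
      using krull_principal_ideal[OF pr sub Suc.prems(2)] by blast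
    then show ?thesis using that[of Q] False sub(1) by blast
  qed
  have "prime_chain (Suc n) (P(Suc n := Q))"
    using prime_chain_append[OF prime_chain_butlast[OF prime_chain_butlast[OF Suc.prems(1)]] Q(1,2)]
      by simp
  from Suc.IH[OF this] obtain P' where P': "prime_chain n P'" "P' n = Q" "P 0 \<subseteq> P' 0" "x \<in> P' 0"
    using Q(3) by auto
  have "prime_chain (Suc n) (P'(Suc n := P (Suc (Suc n))))"
    using prime_chain_append[OF P'(1) pr(3)] P'(2) Q(4) by simp
  moreover have "(P'(Suc n := P (Suc (Suc n)))) 0 = P' 0" by simp
  ultimately show ?case using P'(3,4) by (metis fun_upd_same)
qed

lemma prime_chain_through_finite:
  assumes "finite A" "A \<subseteq> P k" "prime_chain k P" "card A \<le> k"
  shows "\<exists>P'. prime_chain (k - card A) P' \<and> P' (k - card A) = P k \<and> A \<subseteq> P' 0"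
  using assms
proof (induction A rule: finite_induct)
  case empty
  then show ?case by auto
next
  case (insert x A)
  then obtain P' where P': "prime_chain (k - card A) P'" "P' (k - card A) = P k" "A \<subseteq> P' 0" by auto
  have "k - card A = Suc (k - card (insert x A))" using insert by simp
  then obtain P'' where "prime_chain (k - card (insert x A)) P''" "P'' (k - card (insert x A)) = P k"
    "P' 0 \<subseteq> P'' 0" "x \<in> P'' 0"
    using prime_chain_through[of "k - card (insert x A)" P' x] P' insert.prems by auto
  then show ?case using P'(3) by blast
qed

end

section \<open>Finite dimension and parameters of local rings\<close>

locale noetherian_local_ring = noetherian_cring +
  fixes \<mm>
  assumes local: "local_ring R \<mm>"
begin

lemma maximal: "maximalideal \<mm> R" "ideal \<mm> R" "primeideal \<mm> R"
  using local maximalideal.axioms(1) maximalideal_prime by (auto simp: local_ring_def)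

lemma proper_ideal_subset:
  assumes "ideal I R" "\<one> \<notin> I"
  shows "I \<subseteq> \<mm>"
proof -
  obtain J where J: "ideal J R" "I \<subseteq> J" "\<one> \<notin> J"
    and max: "\<And>J'. ideal J' R \<Longrightarrow> I \<subseteq> J' \<Longrightarrow> \<one> \<notin> J' \<Longrightarrow> J \<subseteq> J' \<Longrightarrow> J' = J"
    using exists_maximal_ideal_with[OF assms(1), of "\<lambda>J. I \<subseteq> J \<and> \<one> \<notin> J"] assms(2) by auto
  have "maximalideal J R"
  proof (rule maximalidealI[OF J(1)])
    show "carrier R \<noteq> J" using J(3) by auto
    fix J' assume "ideal J' R" "J \<subseteq> J'" "J' \<subseteq> carrier R"
    then show "J' = J \<or> J' = carrier R"
      using max[of J'] J(2) ideal.one_imp_carrier[of J' R] by blast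
  qed
  then show ?thesis using local J(2) by (simp add: local_ring_def)
qed

lemma prime_subset: "primeideal P R \<Longrightarrow> P \<subseteq> \<mm>"
  using proper_ideal_subset primeideal_ideal primeideal_one by simp

text \<open>The dimension is bounded by the number of generators of the maximal ideal. A longer
  chain, with its top replaced by the maximal ideal, could be rearranged into a chain of positive
  length whose lowest prime contains all generators and is thus already maximal.\<close>

lemma krull_dim_finite: "\<exists>d. krull_dim R = enat d \<and> (\<forall>n P. prime_chain n P \<longrightarrow> n \<le> d)"
proof -
  obtain A where A: "A \<subseteq> carrier R" "finite A" "\<mm> = Idl A" using finetely_gen[OF maximal(2)] by blast
  have bound: "n \<le> card A" if ch: "prime_chain n P" for n P
  proof (cases n)
    case (Suc k)
    then have k: "prime_chain k P" "P k \<subset> \<mm>"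
      using ch prime_chain_butlast[of k P] prime_subset[of "P (Suc k)"] by (auto simp: prime_chain_def)
    have ch': "prime_chain n (P(n := \<mm>))" using prime_chain_append[OF k(1) maximal(3) k(2)] Suc by simp
    show ?thesis
    proof (rule ccontr)
      assume "\<not> n \<le> card A"
      moreover have "A \<subseteq> \<mm>" using genideal_self[OF A(1)] A(3) by simp
      ultimately obtain P' where P': "prime_chain (n - card A) P'" "P' (n - card A) = \<mm>" "A \<subseteq> P' 0"
        using prime_chain_through_finite[OF A(2) _ ch'] by auto
      have "\<mm> \<subseteq> P' 0"
        unfolding A(3) by (rule genideal_minimal) (use P' in \<open>auto simp: prime_chain_def primeideal_ideal\<close>)
      moreover have "0 < n - card A" using \<open>\<not> n \<le> card A\<close> by simp
      then have "P' 0 \<subset> P' (Suc 0)" "P' (Suc 0) \<subseteq> \<mm>"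
        using P'(1) prime_subset by (auto simp: prime_chain_def)
      ultimately show False by blast
    qed
  qed simp
  have eq: "krull_dim R = Sup {enat n | n. \<exists>P. prime_chain n P}"
    by (simp add: krull_dim_def prime_chain_def)
  also have "\<dots> \<le> enat (card A)" by (rule Sup_least) (use bound in auto)
  finally obtain d where d: "krull_dim R = enat d" using enat_ile by blast
  moreover have "n \<le> d" if "prime_chain n P" for n P
  proof -
    have "enat n \<le> krull_dim R" unfolding eq by (rule Sup_upper) (use that in blast)
    then show ?thesis using d by simp
  qed
  ultimately show ?thesis by blast
qed

text \<open>Elements are chosen so that every non-maximal prime over the first i of them tops a
  prime chain of length i. The next element avoids the non-maximal members of a finite set of primes
  below all primes over the earlier ones. With d elements a non-maximal prime over them would extend
  to a chain of length d + 1. Hence only the maximal ideal contains \<open>Y\<close>, and each of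
  its elements has a power in \<open>Idl Y\<close>.\<close>

lemma exists_parameters:
  assumes dim: "\<And>n P. prime_chain n P \<Longrightarrow> n \<le> d"
  shows "\<exists>Y. finite Y \<and> card Y \<le> d \<and> Y \<subseteq> \<mm> \<and> (\<forall>a\<in>\<mm>. \<exists>k::nat. a [^] k \<in> Idl Y)"
proof -
  note mD = idealD[OF maximal(2)]
  have "\<exists>Y. finite Y \<and> card Y \<le> i \<and> Y \<subseteq> \<mm> \<and>
    (\<forall>P. primeideal P R \<and> Y \<subseteq> P \<longrightarrow> P = \<mm> \<or> (\<exists>C. prime_chain i C \<and> C i = P))" for i
  proof (induction i)
    case 0
    have "\<exists>C. prime_chain 0 C \<and> C 0 = P" if "primeideal P R" for P
      by (rule exI[of _ "\<lambda>_. P"]) (simp add: prime_chain_def that)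
    then show ?case by (intro exI[of _ "{}"]) auto
  next
    case (Suc i)
    then obtain Y where Y: "finite Y" "card Y \<le> i" "Y \<subseteq> \<mm>"
      "\<And>P. primeideal P R \<Longrightarrow> Y \<subseteq> P \<Longrightarrow> P \<noteq> \<mm> \<Longrightarrow> \<exists>C. prime_chain i C \<and> C i = P" by metis
    have Yc: "Y \<subseteq> carrier R" using Y(3) mD(1) by blast
    obtain \<Q> where \<Q>: "finite \<Q>" "\<forall>Q\<in>\<Q>. primeideal Q R \<and> Idl Y \<subseteq> Q"
      "\<forall>P. primeideal P R \<and> Idl Y \<subseteq> P \<longrightarrow> (\<exists>Q\<in>\<Q>. Q \<subseteq> P)"
      using finitely_many_primes_over[OF genideal_ideal[OF Yc]] by (elim exE conjE)
    have "\<exists>y\<in>\<mm>. \<forall>Q\<in>\<Q> - {\<mm>}. y \<notin> Q"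
    proof (rule prime_avoidance)
      show "\<not> \<mm> \<subseteq> Q" if "Q \<in> \<Q> - {\<mm>}" for Q using that \<Q>(2) prime_subset by blast
    qed (use \<Q> maximal in auto)
    then obtain y where y: "y \<in> \<mm>" "\<And>Q. Q \<in> \<Q> \<Longrightarrow> Q \<noteq> \<mm> \<Longrightarrow> y \<notin> Q" by blast
    have "\<exists>C. prime_chain (Suc i) C \<and> C (Suc i) = P"
      if P: "primeideal P R" "insert y Y \<subseteq> P" "P \<noteq> \<mm>" for P
    proof -
      have "Idl Y \<subseteq> P" using genideal_minimal[OF primeideal_ideal[OF P(1)]] P(2) by auto
      then obtain Q where Q: "Q \<in> \<Q>" "Q \<subseteq> P" using \<Q>(3) P(1) by blast
      then have "Q \<noteq> \<mm>" using P prime_subset by blast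
      then have "y \<notin> Q" using y Q by blast
      then have "Q \<subset> P" using P(2) Q by blast
      moreover have "Y \<subseteq> Q" using \<Q>(2) Q(1) genideal_self[OF Yc] by blast
      then obtain C where "prime_chain i C" "C i = Q" using Y(4)[of Q] \<Q>(2) Q(1) \<open>Q \<noteq> \<mm>\<close> by blast
      ultimately show ?thesis using prime_chain_append[of i C P] P(1) by (metis fun_upd_same)
    qed
    moreover have "card (insert y Y) \<le> Suc i" using Y(1,2) by (simp add: card_insert_if)
    ultimately show ?case using Y y by (intro exI[of _ "insert y Y"]) auto
  qed
  then obtain Y where Y: "finite Y" "card Y \<le> d" "Y \<subseteq> \<mm>"
    "\<And>P. primeideal P R \<Longrightarrow> Y \<subseteq> P \<Longrightarrow> P \<noteq> \<mm> \<Longrightarrow> \<exists>C. prime_chain d C \<and> C d = P" by metis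
  have Yc: "Y \<subseteq> carrier R" using Y(3) mD(1) by blast
  have only: "P = \<mm>" if P: "primeideal P R" "Y \<subseteq> P" for P
  proof (rule ccontr)
    assume ne: "P \<noteq> \<mm>"
    then obtain C where "prime_chain d C" "C d = P" using Y(4) P by blast
    then have "prime_chain (Suc d) (C(Suc d := \<mm>))"
      using prime_chain_append[of d C \<mm>] maximal(3) prime_subset[OF P(1)] ne by auto
    then show False using dim by fastforce
  qed
  have "\<exists>k::nat. a [^] k \<in> Idl Y" if a: "a \<in> \<mm>" for a
  proof (rule ccontr)
    assume no: "\<not> ?thesis"
    have ac: "a \<in> carrier R" using a mD(1) by blast
    have "\<exists>P. primeideal P R \<and> Idl Y \<subseteq> P \<and> P \<inter> range (\<lambda>k::nat. a [^] k) = {}"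
    proof (rule exists_primeideal_avoiding[OF genideal_ideal[OF Yc]])
      show "\<one> \<in> range (\<lambda>k::nat. a [^] k)" by (rule range_eqI[of _ _ 0]) simp
      show "b \<otimes> c \<in> range (\<lambda>k::nat. a [^] k)" if "b \<in> range (\<lambda>k::nat. a [^] k)" "c \<in> range (\<lambda>k::nat. a [^] k)" for b c
        using that ac by (auto simp: nat_pow_mult)
    qed (use ac no in auto)
    then obtain P where P: "primeideal P R" "Idl Y \<subseteq> P" "P \<inter> range (\<lambda>k::nat. a [^] k) = {}" by blast
    moreover have "a \<in> range (\<lambda>k::nat. a [^] k)" using ac by (intro range_eqI[of _ _ 1]) simp
    ultimately show False using only[OF P(1)] genideal_self[OF Yc] a by blast
  qed
  then show ?thesis using Y(1-3) by blast
qed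

end

section \<open>Artinian torsion cohomology along the splitting\<close>

abbreviation tors_artinian ::
  "('a, 'r) ring_scheme \<Rightarrow> 'a set \<Rightarrow> (int \<Rightarrow> ('a, 'x) module) \<Rightarrow> (int \<Rightarrow> 'x \<Rightarrow> 'x) \<Rightarrow> int \<Rightarrow> bool" where
  "tors_artinian R S P D n \<equiv> chain_cond False R (tors_mod R S (P n))
     (bnd (\<lambda>n. tors_mod R S (P n)) D n) (cyc (\<lambda>n. tors_mod R S (P n)) D n)"

text \<open>This hides the concrete cone and keeps the three ways in which the long exact sequence
  after torsion transfers the Artinian property. The resolution sits at degree k, so its torsion
  cohomology in degree p belongs to total degree p + k.\<close>

lemma split_off_top_tors:
  fixes P :: "int \<Rightarrow> ('a, 'x) module" and F :: "int \<Rightarrow> ('a, 'f) module"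
  assumes P: "int_complex R P D" "\<And>n. baer_module R (P n)" and van: "\<And>q. q > k \<Longrightarrow> cyc P D q \<subseteq> bnd P D q"
    and res: "resolves R P D k F D' h" and S: "S \<subseteq> carrier R"
  obtains K :: "int \<Rightarrow> ('a, 'x \<times> 'f) module" and KD where "int_complex R K KD" "\<And>n. baer_module R (K n)"
    "\<And>q. q > k - 1 \<Longrightarrow> cyc K KD q \<subseteq> bnd K KD q"
    "\<And>q F2 D2 h2. q < k \<Longrightarrow> resolves R P D q (F2 :: int \<Rightarrow> ('a, 'g) module) D2 h2 \<Longrightarrow> \<exists>h2. resolves R K KD q F2 D2 h2"
    "\<And>n. tors_artinian R S P D n \<Longrightarrow> tors_artinian R S F D' (n - 1 - k) \<Longrightarrow> tors_artinian R S K KD n"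
    "\<And>n. tors_artinian R S K KD n \<Longrightarrow> tors_artinian R S F D' (n - k) \<Longrightarrow> tors_artinian R S P D n"
    "\<And>n. tors_artinian R S P D n \<Longrightarrow> tors_artinian R S K KD (n + 1) \<Longrightarrow> tors_artinian R S F D' (n - k)"
proof -
  let ?F = "\<lambda>n. F (n - k)" and ?D' = "\<lambda>n. D' (n - k)"
  obtain \<psi> where cone: "cone R P D ?F ?D' Pair fst snd \<psi>"
    and van': "\<And>q. q \<ge> k \<Longrightarrow> cyc (cone_mod Pair fst snd P ?F) (cone_diff R Pair fst snd D ?F ?D' \<psi>) q
        \<subseteq> bnd (cone_mod Pair fst snd P ?F) (cone_diff R Pair fst snd D ?F ?D' \<psi>) q"
    and res': "\<And>q F2 D2 h2. q < k \<Longrightarrow> resolves R P D q (F2 :: int \<Rightarrow> ('a, 'g) module) D2 h2 \<Longrightarrow>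
        resolves R (cone_mod Pair fst snd P ?F) (cone_diff R Pair fst snd D ?F ?D' \<psi>) q F2 D2 (\<lambda>w. h2 (fst w))"
    using split_off_top[OF P(1) van res] by blast
  interpret C: cone R P D ?F ?D' Pair fst snd \<psi> by (rule cone)
  interpret T: cone R "\<lambda>n. tors_mod R S (P n)" D "\<lambda>n. tors_mod R S (?F n)" ?D' Pair fst snd \<psi>
    by (rule C.cone_tors(1)[OF S])
  have K: "tors_artinian R S C.K C.KD n \<longleftrightarrow> chain_cond False R (T.K n) (bnd T.K T.KD n) (cyc T.K T.KD n)" for n
    by (simp only: C.cone_tors(2)[OF S] fun_cong[OF C.cone_tors(2)[OF S]] C.cone_tors(3)[OF S])
  have F: "chain_cond False R (tors_mod R S (?F n)) (bnd (\<lambda>n. tors_mod R S (?F n)) ?D' n)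
      (cyc (\<lambda>n. tors_mod R S (?F n)) ?D' n) \<longleftrightarrow> tors_artinian R S F D' (n - k)" for n
  proof -
    have eq: "n - 1 - k = n - k - 1" "n + 1 - k = n - k + 1" by auto
    show ?thesis unfolding bnd_def cyc_def eq ..
  qed
  show thesis
  proof (rule that[of C.K C.KD])
    show "int_complex R C.K C.KD" by (rule C.cone_complex)
    have "baer_module R (?F n)" for n
      using res injective_imp_baer_module unfolding resolves_def by blast
    then show "baer_module R (C.K n)" for n using C.cone_baer P(2) by blast
    show "cyc C.K C.KD q \<subseteq> bnd C.K C.KD q" if "q > k - 1" for q using van' that by simp
    show "\<exists>h2. resolves R C.K C.KD q F2 D2 h2" if "q < k" "resolves R P D q F2 D2 h2"
      for q and F2 :: "int \<Rightarrow> ('a, 'g) module" and D2 h2 using res'[OF that] by blast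
    show "tors_artinian R S C.K C.KD n" if "tors_artinian R S P D n" "tors_artinian R S F D' (n - 1 - k)" for n
      using T.chain_cond_cone[of False n] that K[of n] F[of "n - 1"] by simp
    show "tors_artinian R S P D n" if "tors_artinian R S C.K C.KD n" "tors_artinian R S F D' (n - k)" for n
      using T.chain_cond_source[of False n] that K[of n] F[of n] by simp
    show "tors_artinian R S F D' (n - k)" if "tors_artinian R S P D n" "tors_artinian R S C.K C.KD (n + 1)" for n
      using T.chain_cond_target[of False n] that K[of "n + 1"] F[of n] by simp
  qed
qed

lemma tors_artinian_vanishing:
  assumes "int_complex R P D" "noetherian_ring R" "\<And>n. baer_module R (P n)" "finite S" "S \<subseteq> carrier R"
    "\<And>q. q > e \<Longrightarrow> cyc P D q \<subseteq> bnd P D q" "int (card S) \<le> d" "n > e + d"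
  shows "tors_artinian R S P D n"
  using assms by (intro chain_cond_trivial int_complex.tors_vanishing[of R P D S e n]) auto

text \<open>Here \<open>a p q\<close> says that the entry \<open>(p, q)\<close> on the second page of the spectral sequence of the
  composite torsion functor is Artinian.\<close>

theorem iterated_torsion_artinian:
  fixes P :: "int \<Rightarrow> ('a, 'x) module" and F :: "int \<Rightarrow> int \<Rightarrow> ('a, 'f) module"
  assumes noeth: "noetherian_ring R" and P: "int_complex R P D" "\<And>n. baer_module R (P n)"
    and van: "\<And>q. q > c \<Longrightarrow> cyc P D q \<subseteq> bnd P D q"
    and res: "\<And>q. resolves R P D q (F q) (D' q) (h q)"
    and S: "finite S" "S \<subseteq> carrier R" "int (card S) \<le> d"
    and art: "\<And>n. tors_artinian R S P D n"
  defines "a \<equiv> \<lambda>p q. tors_artinian R S (F q) (D' q) p"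
  shows "(a d c \<and> a (d - 1) c) \<and> (a (d - 3) c \<and> a (d - 2) (c - 1) \<longrightarrow> a d (c - 2) \<and> a (d - 1) (c - 1)) \<and>
    (a (d - 3) c \<longrightarrow> a (d - 1) (c - 1)) \<and> (a d (c - 2) \<and> a (d - 1) (c - 1) \<longrightarrow> a (d - 3) c) \<and>
    (a (d - 2) c \<longleftrightarrow> a d (c - 1))"
proof -
  obtain K1 :: "int \<Rightarrow> ('a, 'x \<times> 'f) module" and D1 where K1: "int_complex R K1 D1" "\<And>n. baer_module R (K1 n)"
    "\<And>q. q > c - 1 \<Longrightarrow> cyc K1 D1 q \<subseteq> bnd K1 D1 q"
    "\<And>q F2 D2 h2. q < c \<Longrightarrow> resolves R P D q (F2 :: int \<Rightarrow> ('a, 'f) module) D2 h2 \<Longrightarrow> \<exists>h2. resolves R K1 D1 q F2 D2 h2"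
    "\<And>n. tors_artinian R S P D n \<Longrightarrow> a (n - 1 - c) c \<Longrightarrow> tors_artinian R S K1 D1 n"
    "\<And>n. tors_artinian R S K1 D1 n \<Longrightarrow> a (n - c) c \<Longrightarrow> tors_artinian R S P D n"
    "\<And>n. tors_artinian R S P D n \<Longrightarrow> tors_artinian R S K1 D1 (n + 1) \<Longrightarrow> a (n - c) c"
    by (rule split_off_top_tors[where k = c, OF P van res S(2)], assumption, rule that) (unfold a_def, assumption+)
  obtain h1 where r1: "resolves R K1 D1 (c - 1) (F (c - 1)) (D' (c - 1)) h1" using K1(4)[OF _ res, of "c - 1"] by auto
  obtain h1' where r1': "resolves R K1 D1 (c - 2) (F (c - 2)) (D' (c - 2)) h1'" using K1(4)[OF _ res, of "c - 2"] by auto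
  obtain K2 :: "int \<Rightarrow> ('a, ('x \<times> 'f) \<times> 'f) module" and D2 where K2: "int_complex R K2 D2" "\<And>n. baer_module R (K2 n)"
    "\<And>q. q > c - 1 - 1 \<Longrightarrow> cyc K2 D2 q \<subseteq> bnd K2 D2 q"
    "\<And>q F2 D3 h2. q < c - 1 \<Longrightarrow> resolves R K1 D1 q (F2 :: int \<Rightarrow> ('a, 'f) module) D3 h2 \<Longrightarrow> \<exists>h2. resolves R K2 D2 q F2 D3 h2"
    "\<And>n. tors_artinian R S K1 D1 n \<Longrightarrow> a (n - 1 - (c - 1)) (c - 1) \<Longrightarrow> tors_artinian R S K2 D2 n"
    "\<And>n. tors_artinian R S K2 D2 n \<Longrightarrow> a (n - (c - 1)) (c - 1) \<Longrightarrow> tors_artinian R S K1 D1 n"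
    "\<And>n. tors_artinian R S K1 D1 n \<Longrightarrow> tors_artinian R S K2 D2 (n + 1) \<Longrightarrow> a (n - (c - 1)) (c - 1)"
    by (rule split_off_top_tors[where k = "c - 1", OF K1(1-3) r1 S(2)], assumption, rule that) (unfold a_def, assumption+)
  obtain h2 where r2: "resolves R K2 D2 (c - 2) (F (c - 2)) (D' (c - 2)) h2" using K2(4)[OF _ r1'] by auto
  have van2: "\<And>q. q > c - 2 \<Longrightarrow> cyc K2 D2 q \<subseteq> bnd K2 D2 q" using K2(3) by simp
  obtain K3 :: "int \<Rightarrow> ('a, (('x \<times> 'f) \<times> 'f) \<times> 'f) module" and D3 where K3: "int_complex R K3 D3" "\<And>n. baer_module R (K3 n)"
    "\<And>q. q > c - 2 - 1 \<Longrightarrow> cyc K3 D3 q \<subseteq> bnd K3 D3 q"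
    "\<And>n. tors_artinian R S K3 D3 n \<Longrightarrow> a (n - (c - 2)) (c - 2) \<Longrightarrow> tors_artinian R S K2 D2 n"
    "\<And>n. tors_artinian R S K2 D2 n \<Longrightarrow> tors_artinian R S K3 D3 (n + 1) \<Longrightarrow> a (n - (c - 2)) (c - 2)"
    by (rule split_off_top_tors[where k = "c - 2", OF K2(1,2) van2 r2 S(2)], assumption, rule that) (unfold a_def, assumption+)
  have v1: "tors_artinian R S K1 D1 n" if "n > c - 1 + d" for n
    by (rule tors_artinian_vanishing[OF K1(1) noeth K1(2) S(1,2) K1(3) S(3)]) (use that in auto)
  have v2: "tors_artinian R S K2 D2 n" if "n > c - 2 + d" for n
    by (rule tors_artinian_vanishing[OF K2(1) noeth K2(2) S(1,2) van2 S(3)]) (use that in auto)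
  have v3: "tors_artinian R S K3 D3 n" if "n > c - 2 - 1 + d" for n
    by (rule tors_artinian_vanishing[OF K3(1) noeth K3(2) S(1,2) K3(3) S(3)]) (use that in auto)
  \<comment> \<open>For p >= d - 1 the degree p + c + 1 exceeds (c - 1) + d, above which the torsion
    of \<open>K1\<close> has no cohomology.\<close>
  have top: "a p c" if "p \<ge> d - 1" for p using K1(7)[OF art, of "p + c"] v1[of "p + c + 1"] that by simp
  have K1f: "a p c \<Longrightarrow> tors_artinian R S K1 D1 (p + c + 1)" for p
    using K1(5)[OF art, of "p + c + 1"] by simp
  have fK1: "tors_artinian R S K1 D1 (p + c + 1) \<Longrightarrow> a p c" for p
    using K1(7)[OF art, of "p + c"] by simp
  \<comment> \<open>The torsion of \<open>K2\<close> has no cohomology in degrees d + c - 1 and d +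
    c, so the entry (d, c - 1) can be compared directly with \<open>K1\<close> in degree d + c -
    1.\<close>
  have v: "a d (c - 1) \<longleftrightarrow> tors_artinian R S K1 D1 (d - 2 + c + 1)"
    using K2(6)[of "d + c - 1"] K2(7)[of "d + c - 1"] v2[of "d + c - 1"] v2[of "d + c"] by (auto simp: algebra_simps)
  have iii: "tors_artinian R S K1 D1 (d - 3 + c + 1) \<Longrightarrow> a (d - 1) (c - 1)"
    using K2(7)[of "d + c - 2"] v2[of "d + c - 1"] by (simp add: algebra_simps)
  \<comment> \<open>In degree d + c - 2 the torsion of \<open>K3\<close> has already vanished, so
    row c - 2 alone decides about \<open>K2\<close> there.\<close>
  have iv: "a d (c - 2) \<Longrightarrow> a (d - 1) (c - 1) \<Longrightarrow> tors_artinian R S K1 D1 (d - 3 + c + 1)"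
    using K2(6)[of "d + c - 2"] K3(4)[of "d + c - 2"] v3[of "d + c - 2"] by (simp add: algebra_simps)
  have ii: "tors_artinian R S K1 D1 (d - 3 + c + 1) \<Longrightarrow> a (d - 2) (c - 1) \<Longrightarrow> a d (c - 2)"
    using K2(5)[of "d + c - 2"] K3(5)[of "d + c - 2"] v3[of "d + c - 1"] by (simp add: algebra_simps)
  have t: "a d c" "a (d - 1) c" using top by auto
  define T where "T p \<longleftrightarrow> tors_artinian R S K1 D1 (p + c + 1)" for p
  \<comment> \<open>As the abutment is Artinian, the entry (p, c) and the torsion cohomology of
    \<open>K1\<close> in degree p + c + 1 differ by Artinian modules only.\<close>
  have e: "a p c \<longleftrightarrow> T p" for p using K1f fK1 by (auto simp: T_def)
  show ?thesis using t v iii iv ii unfolding T_def[symmetric] e by blast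
qed

section \<open>Torsion with respect to an ideal\<close>

context module
begin

text \<open>Induction on a + b in place of a binomial expansion: one factor r + s splits x into r x
  and s x, for each of which one of the exponents has dropped.\<close>

lemma smult_pow_sum_zero:
  assumes "r \<in> carrier R" "s \<in> carrier R"
  shows "x \<in> carrier M \<Longrightarrow> (r [^] (a::nat)) \<odot>\<^bsub>M\<^esub> x = \<zero>\<^bsub>M\<^esub> \<Longrightarrow> (s [^] (b::nat)) \<odot>\<^bsub>M\<^esub> x = \<zero>\<^bsub>M\<^esub> \<Longrightarrow>
    ((r \<oplus> s) [^] (a + b)) \<odot>\<^bsub>M\<^esub> x = \<zero>\<^bsub>M\<^esub>"
proof (induction "a + b" arbitrary: a b x)
  case 0
  then show ?case using assms by simp
next
  case (Suc n)
  show ?case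
  proof (cases "a = 0 \<or> b = 0")
    case True
    then have "x = \<zero>\<^bsub>M\<^esub>" using Suc.prems by auto
    then show ?thesis using assms by simp
  next
    case False
    then obtain a' b' where ab: "a = Suc a'" "b = Suc b'" by (metis not0_implies_Suc)
    have "(s [^] b) \<odot>\<^bsub>M\<^esub> (r \<odot>\<^bsub>M\<^esub> x) = r \<odot>\<^bsub>M\<^esub> ((s [^] b) \<odot>\<^bsub>M\<^esub> x)"
      "(r [^] a) \<odot>\<^bsub>M\<^esub> (s \<odot>\<^bsub>M\<^esub> x) = s \<odot>\<^bsub>M\<^esub> ((r [^] a) \<odot>\<^bsub>M\<^esub> x)"
      using smult_comm assms Suc.prems(1) by simp_all
    then have k: "(s [^] b) \<odot>\<^bsub>M\<^esub> (r \<odot>\<^bsub>M\<^esub> x) = \<zero>\<^bsub>M\<^esub>" "(r [^] a) \<odot>\<^bsub>M\<^esub> (s \<odot>\<^bsub>M\<^esub> x) = \<zero>\<^bsub>M\<^esub>"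
      using Suc.prems assms by simp_all
    have k': "(r [^] a') \<odot>\<^bsub>M\<^esub> (r \<odot>\<^bsub>M\<^esub> x) = \<zero>\<^bsub>M\<^esub>" "(s [^] b') \<odot>\<^bsub>M\<^esub> (s \<odot>\<^bsub>M\<^esub> x) = \<zero>\<^bsub>M\<^esub>"
      using Suc.prems(2,3) smult_pow_Suc(1)[OF assms(1) Suc.prems(1)] smult_pow_Suc(1)[OF assms(2) Suc.prems(1)]
      unfolding ab by metis+
    have n: "n = a' + b" "n = a + b'" using Suc.hyps(2) ab by auto
    have rs: "r \<odot>\<^bsub>M\<^esub> x \<in> carrier M" "s \<odot>\<^bsub>M\<^esub> x \<in> carrier M" using assms Suc.prems(1) by auto
    have "((r \<oplus> s) [^] n) \<odot>\<^bsub>M\<^esub> (r \<odot>\<^bsub>M\<^esub> x) = \<zero>\<^bsub>M\<^esub>"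
      using Suc.hyps(1)[OF n(1) rs(1) k'(1) k(1)] n(1) by metis
    moreover have "((r \<oplus> s) [^] n) \<odot>\<^bsub>M\<^esub> (s \<odot>\<^bsub>M\<^esub> x) = \<zero>\<^bsub>M\<^esub>"
      using Suc.hyps(1)[OF n(2) rs(2) k(2) k'(2)] n(2) by metis
    moreover have "((r \<oplus> s) [^] (a + b)) \<odot>\<^bsub>M\<^esub> x = ((r \<oplus> s) [^] n) \<odot>\<^bsub>M\<^esub> (r \<odot>\<^bsub>M\<^esub> x \<oplus>\<^bsub>M\<^esub> s \<odot>\<^bsub>M\<^esub> x)"
      using smult_pow_Suc(1)[of "r \<oplus> s" x n] Suc.hyps(2)[symmetric] Suc.prems(1) assms by (simp add: smult_l_distr)
    ultimately show ?thesis using assms Suc.prems(1) by (simp add: smult_r_distr)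
  qed
qed

lemma ideal_power_annihilators:
  assumes x: "x \<in> carrier M"
  shows "ideal {r \<in> carrier R. \<exists>n::nat. (r [^] n) \<odot>\<^bsub>M\<^esub> x = \<zero>\<^bsub>M\<^esub>} R"
proof -
  interpret RR: module R "regular_module R" by (rule regular_module) (rule is_cring)
  have "submodule {r \<in> carrier R. \<exists>n::nat. (r [^] n) \<odot>\<^bsub>M\<^esub> x = \<zero>\<^bsub>M\<^esub>} R (regular_module R)"
  proof (rule RR.submoduleI')
    show "\<zero>\<^bsub>regular_module R\<^esub> \<in> {r \<in> carrier R. \<exists>n::nat. (r [^] n) \<odot>\<^bsub>M\<^esub> x = \<zero>\<^bsub>M\<^esub>}"
      using x by (auto simp: regular_module_def intro!: exI[of _ 1])
    fix r s assume "r \<in> {r \<in> carrier R. \<exists>n::nat. (r [^] n) \<odot>\<^bsub>M\<^esub> x = \<zero>\<^bsub>M\<^esub>}"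
      "s \<in> {r \<in> carrier R. \<exists>n::nat. (r [^] n) \<odot>\<^bsub>M\<^esub> x = \<zero>\<^bsub>M\<^esub>}"
    then show "r \<oplus>\<^bsub>regular_module R\<^esub> s \<in> {r \<in> carrier R. \<exists>n::nat. (r [^] n) \<odot>\<^bsub>M\<^esub> x = \<zero>\<^bsub>M\<^esub>}"
      using smult_pow_sum_zero[of r s x] x by (auto simp: regular_module_def)
  next
    fix a r assume a: "a \<in> carrier R" and "r \<in> {r \<in> carrier R. \<exists>n::nat. (r [^] n) \<odot>\<^bsub>M\<^esub> x = \<zero>\<^bsub>M\<^esub>}"
    then obtain n :: nat where n: "r \<in> carrier R" "(r [^] n) \<odot>\<^bsub>M\<^esub> x = \<zero>\<^bsub>M\<^esub>" by blast
    have "((a \<otimes> r) [^] n) \<odot>\<^bsub>M\<^esub> x = \<zero>\<^bsub>M\<^esub>" using n a x by (simp add: R.nat_pow_distrib smult_assoc1)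
    then show "a \<odot>\<^bsub>regular_module R\<^esub> r \<in> {r \<in> carrier R. \<exists>n::nat. (r [^] n) \<odot>\<^bsub>M\<^esub> x = \<zero>\<^bsub>M\<^esub>}"
      using a n by (auto simp: regular_module_def)
  qed (auto simp: regular_module_def)
  then show ?thesis using submodule_regular_module_iff[OF is_cring] by blast
qed

lemma tors_genideal:
  assumes "S \<subseteq> carrier R"
  shows "tors R (Idl S) M = tors R S M"
proof -
  have "\<forall>s\<in>Idl S. \<exists>n::nat. (s [^] n) \<odot>\<^bsub>M\<^esub> x = \<zero>\<^bsub>M\<^esub>"
    if "x \<in> carrier M" "\<forall>s\<in>S. \<exists>n::nat. (s [^] n) \<odot>\<^bsub>M\<^esub> x = \<zero>\<^bsub>M\<^esub>" for x
    using genideal_minimal[OF ideal_power_annihilators[OF that(1)], of S] that(2) assms by blast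
  then show ?thesis using genideal_self[OF assms] unfolding tors_def by blast
qed

text \<open>Finitely many exponents, one for each generator, yield a single power of the ideal. The
  induction runs on the sum of the exponents: it drops when x is replaced by s x, so one power kills
  all s x and the next power kills x.\<close>

lemma torsion_part_eq_tors:
  assumes S: "finite S" "S \<subseteq> carrier R"
  shows "torsion_part R (Idl S) M = tors R S M"
proof -
  interpret RR: module R "regular_module R" by (rule regular_module) (rule is_cring)
  interpret mI: comm_monoid "ideals_set R" by (rule ideals_set_is_comm_monoid)
  let ?b = "Idl S"
  have b: "ideal ?b R" by (rule genideal_ideal[OF S(2)])
  have pow0: "?b [^]\<^bsub>ideals_set R\<^esub> (0::nat) = carrier R" by (simp add: ideals_set_def nat_pow_def)
  have powS: "?b [^]\<^bsub>ideals_set R\<^esub> Suc n = (?b [^]\<^bsub>ideals_set R\<^esub> n) \<cdot> ?b" for n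
    by (simp add: ideals_set_def nat_pow_def)
  have powc: "?b [^]\<^bsub>ideals_set R\<^esub> n \<subseteq> carrier R" for n :: nat
    using mI.nat_pow_closed[of ?b n] b ideal.Icarr by (auto simp: ideals_set_def)
  have pow_mem: "s [^] n \<in> ?b [^]\<^bsub>ideals_set R\<^esub> n" if "s \<in> ?b" for s and n :: nat
  proof (induction n)
    case 0
    then show ?case unfolding pow0 by simp
  next
    case (Suc n)
    then show ?case unfolding powS using that by (simp add: ideal_prod.prod)
  qed
  \<comment> \<open>The exponent \<open>Suc n\<close> covers empty \<open>S\<close>: the sum is then
    0, but the power with exponent 0 is the whole ring and need not kill x.\<close>
  have kill: "\<forall>w\<in>?b [^]\<^bsub>ideals_set R\<^esub> Suc n. w \<odot>\<^bsub>M\<^esub> x = \<zero>\<^bsub>M\<^esub>"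
    if "x \<in> carrier M" "\<forall>s\<in>S. (s [^] (f s :: nat)) \<odot>\<^bsub>M\<^esub> x = \<zero>\<^bsub>M\<^esub>" "sum f S \<le> n" for n f x
    using that
  proof (induction n arbitrary: f x)
    case 0
    have "Idl S \<subseteq> {r \<in> carrier R. r \<odot>\<^bsub>M\<^esub> x \<in> {\<zero>\<^bsub>M\<^esub>}}"
    proof (rule genideal_minimal[OF ideal_colon[OF zero_submodule 0(1)]])
      show "S \<subseteq> {r \<in> carrier R. r \<odot>\<^bsub>M\<^esub> x \<in> {\<zero>\<^bsub>M\<^esub>}}"
      proof
        fix s assume s: "s \<in> S"
        then have "f s = 0" using 0 S(1) by simp
        then have "x = \<zero>\<^bsub>M\<^esub>" using 0 s by (metis nat_pow_0 smult_one)
        then show "s \<in> {r \<in> carrier R. r \<odot>\<^bsub>M\<^esub> x \<in> {\<zero>\<^bsub>M\<^esub>}}" using s S by auto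
      qed
    qed
    moreover have "?b [^]\<^bsub>ideals_set R\<^esub> Suc 0 \<subseteq> ?b"
      unfolding powS pow0 using ideal_prod_inter[OF oneideal b] by blast
    ultimately show ?case by blast
  next
    case (Suc n)
    let ?J = "{r \<in> carrier R. \<forall>u\<in>?b [^]\<^bsub>ideals_set R\<^esub> Suc n. u \<odot>\<^bsub>M\<^esub> (r \<odot>\<^bsub>M\<^esub> x) = \<zero>\<^bsub>M\<^esub>}"
    note pc = subsetD[OF powc[of "Suc n"]]
    have "submodule ?J R (regular_module R)"
    proof (rule RR.submoduleI')
      show "\<zero>\<^bsub>regular_module R\<^esub> \<in> ?J" using Suc.prems(1) pc by (auto simp: regular_module_def)
      show "r \<oplus>\<^bsub>regular_module R\<^esub> s \<in> ?J" if "r \<in> ?J" "s \<in> ?J" for r s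
        using that Suc.prems(1) pc by (auto simp: regular_module_def smult_l_distr smult_r_distr)
      show "a \<odot>\<^bsub>regular_module R\<^esub> r \<in> ?J" if a: "a \<in> carrier R" and r: "r \<in> ?J" for a r
      proof -
        have "u \<odot>\<^bsub>M\<^esub> ((a \<otimes> r) \<odot>\<^bsub>M\<^esub> x) = a \<odot>\<^bsub>M\<^esub> (u \<odot>\<^bsub>M\<^esub> (r \<odot>\<^bsub>M\<^esub> x))" if "u \<in> carrier R" for u
          using a r that Suc.prems(1) smult_comm[of u a] by (simp add: smult_assoc1)
        then show ?thesis using a r pc by (auto simp: regular_module_def)
      qed
    qed (auto simp: regular_module_def)
    then have J: "ideal ?J R" using submodule_regular_module_iff[OF is_cring] by blast
    have "S \<subseteq> ?J"
    proof
      fix s assume s: "s \<in> S"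
      then have sc: "s \<in> carrier R" using S by auto
      have "\<forall>u\<in>?b [^]\<^bsub>ideals_set R\<^esub> Suc n. u \<odot>\<^bsub>M\<^esub> (s \<odot>\<^bsub>M\<^esub> x) = \<zero>\<^bsub>M\<^esub>"
      proof (cases "f s")
        case 0
        then have "x = \<zero>\<^bsub>M\<^esub>" using Suc.prems s by (metis nat_pow_0 smult_one)
        then show ?thesis using sc pc by auto
      next
        case (Suc k)
        have kill': "(t [^] ((f(s := k)) t)) \<odot>\<^bsub>M\<^esub> (s \<odot>\<^bsub>M\<^esub> x) = \<zero>\<^bsub>M\<^esub>" if t: "t \<in> S" for t
        proof (cases "t = s")
          case True
          have "(s [^] Suc k) \<odot>\<^bsub>M\<^esub> x = \<zero>\<^bsub>M\<^esub>" using Suc.prems(2) s Suc by metis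
          then show ?thesis using True smult_pow_Suc(1)[OF sc Suc.prems(1), of k] by simp
        next
          case False
          have tc: "t [^] f t \<in> carrier R" using t S by auto
          have "(t [^] f t) \<odot>\<^bsub>M\<^esub> (s \<odot>\<^bsub>M\<^esub> x) = s \<odot>\<^bsub>M\<^esub> ((t [^] f t) \<odot>\<^bsub>M\<^esub> x)"
            by (rule smult_comm[OF tc sc Suc.prems(1)])
          then show ?thesis using False Suc.prems(2) t sc by simp
        qed
        have "sum f S = f s + sum f (S - {s})" "sum (f(s := k)) S = k + sum (f(s := k)) (S - {s})"
          using s S(1) by (simp_all add: sum.remove)
        moreover have "sum (f(s := k)) (S - {s}) = sum f (S - {s})" by (rule sum.cong) auto
        ultimately have "sum (f(s := k)) S \<le> n" using Suc Suc.prems(3) by simp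
        then show ?thesis using Suc.IH[of "s \<odot>\<^bsub>M\<^esub> x" "f(s := k)"] kill' sc Suc.prems(1) by blast
      qed
      then show "s \<in> ?J" using sc by blast
    qed
    then have bJ: "?b \<subseteq> ?J" by (rule genideal_minimal[OF J])
    show ?case
    proof
      fix w assume "w \<in> ?b [^]\<^bsub>ideals_set R\<^esub> Suc (Suc n)"
      then have "w \<in> (?b [^]\<^bsub>ideals_set R\<^esub> Suc n) \<cdot> ?b" unfolding powS[of "Suc n"] .
      then have "w \<in> carrier R \<and> w \<odot>\<^bsub>M\<^esub> x = \<zero>\<^bsub>M\<^esub>"
      proof (induction w rule: ideal_prod.induct)
        case (prod u r)
        then show ?case using bJ pc Suc.prems(1) by (auto simp: smult_assoc1)
      next
        case (sum u r)
        then show ?case using Suc.prems(1) by (simp add: smult_l_distr)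
      qed
      then show "w \<odot>\<^bsub>M\<^esub> x = \<zero>\<^bsub>M\<^esub>" ..
    qed
  qed
  show ?thesis
  proof
    show "torsion_part R ?b M \<subseteq> tors R S M"
      using pow_mem genideal_self[OF S(2)] unfolding torsion_part_def tors_def by blast
    show "tors R S M \<subseteq> torsion_part R ?b M"
    proof
      fix x assume x: "x \<in> tors R S M"
      then obtain f where "\<forall>s\<in>S. (s [^] (f s :: nat)) \<odot>\<^bsub>M\<^esub> x = \<zero>\<^bsub>M\<^esub>" unfolding tors_def by (auto simp: bchoice_iff)
      moreover have "x \<in> carrier M" using x by (simp add: tors_def)
      ultimately show "x \<in> torsion_part R ?b M" using kill[of x f "sum f S"] unfolding torsion_part_def by blast
    qed
  qed
qed

end

section \<open>Local cohomology in terms of complexes indexed by the integers\<close>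

text \<open>Negative degrees reuse the operations and the zero of degree 0, as the definition of
  \<open>cohomology\<close> does, so that \<open>cohomology_eq\<close> is an equality of records and
  not just an isomorphism.\<close>

definition int_mod :: "('a, 'e) cochain_complex \<Rightarrow> int \<Rightarrow> ('a, 'e) module" where
  "int_mod E n = (if n < 0 then (cmod E 0)\<lparr>carrier := {\<zero>\<^bsub>cmod E 0\<^esub>}\<rparr> else cmod E (nat n))"

definition int_diff :: "('a, 'e) cochain_complex \<Rightarrow> int \<Rightarrow> 'e \<Rightarrow> 'e" where
  "int_diff E n = (if n < 0 then (\<lambda>_. \<zero>\<^bsub>cmod E 0\<^esub>) else cdiff E (nat n))"

lemma nat_Suc_int: "n \<ge> 0 \<Longrightarrow> nat (n + 1) = Suc (nat n)"
  by simp

lemma cohomology_eq: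
  "cohomology E i = module_quotient ((int_mod E i)\<lparr>carrier := cyc (int_mod E) (int_diff E) i\<rparr>) (bnd (int_mod E) (int_diff E) i)"
proof (cases "i < 0")
  case True
  have "\<zero>\<^bsub>int_mod E (i + 1)\<^esub> = \<zero>\<^bsub>cmod E 0\<^esub>" using True by (simp add: int_mod_def)
  then have "cyc (int_mod E) (int_diff E) i = {\<zero>\<^bsub>cmod E 0\<^esub>}" using True by (auto simp: cyc_def int_mod_def int_diff_def)
  moreover have "bnd (int_mod E) (int_diff E) i = {\<zero>\<^bsub>cmod E 0\<^esub>}" using True by (auto simp: bnd_def int_mod_def int_diff_def)
  ultimately show ?thesis using True by (simp add: cohomology_def int_mod_def)
next
  case False
  have "cyc (int_mod E) (int_diff E) i = cocycles E (nat i)"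
    using False by (auto simp: cyc_def cocycles_def a_kernel_def' int_mod_def int_diff_def nat_Suc_int)
  moreover have "bnd (int_mod E) (int_diff E) i = coboundaries E (nat i)"
  proof (cases "i = 0")
    case True
    then show ?thesis by (auto simp: bnd_def int_mod_def int_diff_def)
  next
    case False
    then obtain j where j: "i = 1 + int j" using \<open>\<not> i < 0\<close> zle_iff_zadd[of 1 i] by auto
    then show ?thesis by (simp add: bnd_def int_mod_def int_diff_def nat_add_distrib)
  qed
  ultimately show ?thesis using False by (simp add: cohomology_def int_mod_def)
qed

lemma injective_zero_module:
  assumes "module R V" "carrier V = {\<zero>\<^bsub>V\<^esub>}"
  shows "injective_module R V"
  unfolding injective_module_def
proof (intro conjI allI impI)
  interpret V: module R V by fact
  fix B :: "('a, 'a) module" and N g assume a: "module R B \<and> submodule N R B \<and> g \<in> mod_hom R (B\<lparr>carrier := N\<rparr>) V"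
  have h: "(\<lambda>_. \<zero>\<^bsub>V\<^esub>) \<in> mod_hom R B V" by (rule mod_homI) auto
  have "\<forall>x\<in>N. \<zero>\<^bsub>V\<^esub> = g x" using mod_homD(1)[of g R "B\<lparr>carrier := N\<rparr>" V] a assms(2) by auto
  then show "\<exists>h\<in>mod_hom R B V. \<forall>x\<in>N. h x = g x" by (rule bexI[OF _ h])
qed (rule assms)

lemma injective_resolution_int:
  assumes E: "injective_resolution R M \<epsilon> E"
  shows "int_complex R (int_mod E) (int_diff E)" "\<And>n. injective_module R (int_mod E n)"
    "\<And>n. n < 0 \<Longrightarrow> carrier (int_mod E n) = {\<zero>\<^bsub>int_mod E n\<^esub>}"
    "\<And>n. n > 0 \<Longrightarrow> cyc (int_mod E) (int_diff E) n \<subseteq> bnd (int_mod E) (int_diff E) n"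
    "cyc (int_mod E) (int_diff E) 0 = cocycles E 0"
proof -
  have inj: "injective_module R (cmod E n)" and hom: "cdiff E n \<in> mod_hom R (cmod E n) (cmod E (Suc n))"
    and ex: "coboundaries E (Suc n) = cocycles E (Suc n)" for n
    using E unfolding injective_resolution_def by auto
  have m: "module R (cmod E n)" for n using inj by (simp add: injective_module_def)
  have z: "module R ((cmod E 0)\<lparr>carrier := {\<zero>\<^bsub>cmod E 0\<^esub>}\<rparr>)"
    using submodule.submodule_is_module[OF module.zero_submodule[OF m] m] .
  have im: "module R (int_mod E n)" for n using m z by (simp add: int_mod_def)
  have zero: "\<zero>\<^bsub>int_mod E n\<^esub> = \<zero>\<^bsub>cmod E (nat n)\<^esub>" for n by (simp add: int_mod_def)
  show "carrier (int_mod E n) = {\<zero>\<^bsub>int_mod E n\<^esub>}" if "n < 0" for n using that by (simp add: int_mod_def)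
  show "injective_module R (int_mod E n)" for n using inj injective_zero_module[OF z] by (simp add: int_mod_def)
  have d0: "cdiff E n \<zero>\<^bsub>cmod E n\<^esub> = \<zero>\<^bsub>cmod E (Suc n)\<^esub>" for n by (rule mod_hom_zero[OF m m hom])
  have dd0: "cdiff E 0 x = \<zero>\<^bsub>cmod E (Suc 0)\<^esub>" if "x \<in> cocycles E 0" for x using that by (simp add: cocycles_def a_kernel_def')
  show "int_complex R (int_mod E) (int_diff E)"
  proof (rule int_complex.intro)
    show "module R (int_mod E n)" for n by (rule im)
    show "int_diff E n \<in> mod_hom R (int_mod E n) (int_mod E (n + 1))" for n
    proof (cases "n < 0")
      case True
      interpret V: module R "int_mod E (n + 1)" by (rule im)
      have "(\<lambda>_. \<zero>\<^bsub>int_mod E (n + 1)\<^esub>) \<in> mod_hom R (int_mod E n) (int_mod E (n + 1))" by (rule mod_homI) auto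
      then show ?thesis using True by (simp add: int_diff_def zero)
    next
      case False
      then show ?thesis using hom[of "nat n"] by (simp add: int_mod_def int_diff_def nat_Suc_int)
    qed
    show "int_diff E (n + 1) (int_diff E n x) = \<zero>\<^bsub>int_mod E (n + 2)\<^esub>" if x: "x \<in> carrier (int_mod E n)" for n x
    proof (cases "n < 0")
      case True
      then have "n = -1 \<or> n + 2 \<le> 0" by linarith
      then show ?thesis using d0[of 0] True by (auto simp: int_diff_def zero)
    next
      case False
      then have "cdiff E (nat n) x \<in> cocycles E (Suc (nat n))"
        using x ex[of "nat n"] by (auto simp: int_mod_def)
      then show ?thesis using False
        by (simp add: int_diff_def zero nat_Suc_int cocycles_def a_kernel_def' nat_add_distrib)
    qed
  qed
  show "cyc (int_mod E) (int_diff E) n \<subseteq> bnd (int_mod E) (int_diff E) n" if "n > 0" for n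
  proof -
    obtain j where j: "n = 1 + int j" using \<open>n > 0\<close> zle_iff_zadd[of 1 n] by auto
    have "nat (1 + int j + 1) = Suc (Suc j)" "nat (1 + int j) = Suc j" by auto
    then show ?thesis using ex[of j] unfolding j
      by (auto simp: bnd_def cyc_def int_mod_def int_diff_def cocycles_def a_kernel_def')
  qed
  show "cyc (int_mod E) (int_diff E) 0 = cocycles E 0"
    by (auto simp: cyc_def int_mod_def int_diff_def cocycles_def a_kernel_def')
qed

lemma local_cohomology_eq:
  fixes E :: "('a, 'e) cochain_complex"
  assumes E: "injective_resolution R M \<epsilon> E" and S: "S \<subseteq> carrier R"
    and tors: "\<And>V :: ('a, 'e) module. module R V \<Longrightarrow> torsion_part R \<bb> V = tors R S V"
  shows "local_cohomology R \<bb> E i = module_quotient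
    ((tors_mod R S (int_mod E i))\<lparr>carrier := cyc (\<lambda>n. tors_mod R S (int_mod E n)) (int_diff E) i\<rparr>)
    (bnd (\<lambda>n. tors_mod R S (int_mod E n)) (int_diff E) i)"
proof -
  have m: "module R (cmod E n)" for n using E by (simp add: injective_resolution_def injective_module_def)
  have z: "module R ((cmod E 0)\<lparr>carrier := {\<zero>\<^bsub>cmod E 0\<^esub>}\<rparr>)"
    using submodule.submodule_is_module[OF module.zero_submodule[OF m] m] .
  have "int_mod (torsion_complex R \<bb> E) = (\<lambda>n. tors_mod R S (int_mod E n))"
  proof (rule ext)
    fix n
    show "int_mod (torsion_complex R \<bb> E) n = tors_mod R S (int_mod E n)"
    proof (cases "n < 0")
      case True
      have "tors R S ((cmod E 0)\<lparr>carrier := {\<zero>\<^bsub>cmod E 0\<^esub>}\<rparr>) = {\<zero>\<^bsub>cmod E 0\<^esub>}"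
        using submodule_memD(3)[OF module.tors_submodule[OF z S]] tors_subset[of R S "(cmod E 0)\<lparr>carrier := {\<zero>\<^bsub>cmod E 0\<^esub>}\<rparr>"]
        by auto
      then show ?thesis using True by (simp add: int_mod_def torsion_complex_def tors_mod_def)
    next
      case False
      then show ?thesis using tors[OF m] by (simp add: int_mod_def torsion_complex_def tors_mod_def)
    qed
  qed
  moreover have "int_diff (torsion_complex R \<bb> E) = int_diff E"
    by (auto simp: int_diff_def torsion_complex_def fun_eq_iff)
  ultimately show ?thesis unfolding local_cohomology_def cohomology_eq by (simp only:)
qed

lemma (in int_complex) cohomology_module:
  "module R ((P i)\<lparr>carrier := cyc P D i\<rparr>)" "submodule (bnd P D i) R ((P i)\<lparr>carrier := cyc P D i\<rparr>)"
proof -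
  interpret Pi: module R "P i" by (rule cx_module)
  show "module R ((P i)\<lparr>carrier := cyc P D i\<rparr>)"
    using submodule.submodule_is_module[OF cyc_submodule cx_module] .
  show "submodule (bnd P D i) R ((P i)\<lparr>carrier := cyc P D i\<rparr>)"
    by (rule Pi.submodule_restrict[OF cyc_submodule bnd_submodule bnd_subset_cyc])
qed

lemma (in int_complex) artinian_cohomology_iff:
  "artinian_module R (module_quotient ((P i)\<lparr>carrier := cyc P D i\<rparr>) (bnd P D i)) \<longleftrightarrow>
    chain_cond False R (P i) (bnd P D i) (cyc P D i)"
proof -
  interpret Pi: module R "P i" by (rule cx_module)
  interpret W: module R "(P i)\<lparr>carrier := cyc P D i\<rparr>" by (rule cohomology_module)
  show ?thesis
    using W.artinian_module_quotient_iff[OF cohomology_module(2)]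
      Pi.chain_cond_restrict_iff[OF cyc_submodule bnd_submodule bnd_subset_cyc] by simp
qed

lemma (in int_complex) coset_zero_iff:
  assumes "z \<in> cyc P D i"
  defines "W \<equiv> (P i)\<lparr>carrier := cyc P D i\<rparr>"
  shows "bnd P D i +>\<^bsub>W\<^esub> z = \<zero>\<^bsub>module_quotient W (bnd P D i)\<^esub> \<longleftrightarrow> z \<in> bnd P D i"
proof -
  interpret W: module R W unfolding W_def by (rule cohomology_module)
  have B: "submodule (bnd P D i) R W" unfolding W_def by (rule cohomology_module)
  have z: "z \<in> carrier W" using assms by simp
  show ?thesis
    using W.coset_eq_iff[OF B z W.M.zero_closed] z
      mod_hom_zero[OF W.module_axioms W.module_module_quotient[OF B] W.mod_hom_coset[OF B]] by simp
qed

lemma (in int_complex) trivial_cohomology_iff: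
  defines "H \<equiv> \<lambda>i. module_quotient ((P i)\<lparr>carrier := cyc P D i\<rparr>) (bnd P D i)"
  shows "carrier (H i) = {\<zero>\<^bsub>H i\<^esub>} \<longleftrightarrow> cyc P D i \<subseteq> bnd P D i"
proof -
  have car: "carrier (H i) = (\<lambda>z. bnd P D i +>\<^bsub>(P i)\<lparr>carrier := cyc P D i\<rparr>\<^esub> z) ` cyc P D i"
    by (auto simp: H_def module_quotient_def A_RCOSETS_def')
  have "cyc P D i \<noteq> {}" using submodule_memD(3)[OF cyc_submodule] by blast
  then show ?thesis unfolding car using coset_zero_iff[of _ i] unfolding H_def by (auto simp: image_subset_iff)
qed

section \<open>Graded rings\<close>

context
  fixes R (structure) and A
  assumes gr: "graded_ring R A"
begin

interpretation cring R using gr by (simp add: graded_ring_def)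

lemma graded_component:
  "A n \<subseteq> carrier R" "\<zero> \<in> A n" "a \<in> A n \<Longrightarrow> b \<in> A n \<Longrightarrow> a \<oplus> b \<in> A n"
proof -
  have "additive_subgroup (A n) R" using gr by (simp add: graded_ring_def internal_direct_sum_def)
  then interpret additive_subgroup "A n" R .
  show "A n \<subseteq> carrier R" "\<zero> \<in> A n" "a \<in> A n \<Longrightarrow> b \<in> A n \<Longrightarrow> a \<oplus> b \<in> A n"
    by (auto simp: a_subset)
qed

lemma graded_mult: "a \<in> A i \<Longrightarrow> b \<in> A j \<Longrightarrow> a \<otimes> b \<in> A (i + j)"
  using gr by (simp add: graded_ring_def)

lemma irrelevant_idealE:
  assumes "x \<in> irrelevant_ideal R A"
  obtains f J where "x = finsum R f J" "finite J" "0 \<notin> J" "\<And>n. n \<in> J \<Longrightarrow> f n \<in> A n"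
  using assms unfolding irrelevant_ideal_def by blast

lemma irrelevant_ideal_add_component:
  assumes x: "x \<in> irrelevant_ideal R A" and a: "a \<in> A n" "n \<noteq> 0"
  shows "x \<oplus> a \<in> irrelevant_ideal R A"
proof -
  obtain f J where f: "x = finsum R f J" "finite J" "0 \<notin> J" "\<And>n. n \<in> J \<Longrightarrow> f n \<in> A n"
    by (rule irrelevant_idealE[OF x]) (rule that)
  have c: "f m \<in> carrier R" if "m \<in> J" for m using f(4)[OF that] graded_component(1) by blast
  have ac: "a \<in> carrier R" using a graded_component(1) by blast
  define b where "b = (if n \<in> J then f n \<oplus> a else a)"
  have b: "b \<in> A n" using f a graded_component(3) by (auto simp: b_def)
  then have bc: "b \<in> carrier R" using graded_component(1) by blast
  have rest: "finsum R (f(n := b)) (J - {n}) = finsum R f (J - {n})"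
    by (rule finsum_cong') (use c in auto)
  have "finsum R (f(n := b)) (insert n (J - {n})) = b \<oplus> finsum R f (J - {n})"
    using f(2) c bc by (subst finsum_insert) (auto simp: rest)
  also have "\<dots> = x \<oplus> a"
  proof (cases "n \<in> J")
    case True
    then have "x = f n \<oplus> finsum R f (J - {n})"
      unfolding f(1) using f(2) c finsum_insert[of "J - {n}" n f] by (auto simp: insert_absorb)
    moreover have "finsum R f (J - {n}) \<in> carrier R" using c by (intro finsum_closed) auto
    ultimately show ?thesis using True c ac by (simp add: b_def a_ac)
  next
    case False
    moreover have "finsum R f J \<in> carrier R" using c by (intro finsum_closed) auto
    ultimately show ?thesis using f(1) ac by (simp add: b_def a_comm)
  qed
  finally have "x \<oplus> a = finsum R (f(n := b)) (insert n (J - {n}))" by simp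
  moreover have "(f(n := b)) m \<in> A m" if "m \<in> insert n (J - {n})" for m using that f(4) b by auto
  ultimately show ?thesis unfolding irrelevant_ideal_def using f(2,3) a(2) by blast
qed

lemma irrelevant_ideal_zero: "\<zero> \<in> irrelevant_ideal R A"
  unfolding irrelevant_ideal_def by (auto intro!: exI[of _ "{}"])

lemma irrelevant_ideal_add:
  assumes x: "x \<in> irrelevant_ideal R A" and y: "y \<in> irrelevant_ideal R A"
  shows "x \<oplus> y \<in> irrelevant_ideal R A"
proof -
  have xc: "z \<in> carrier R" if "z \<in> irrelevant_ideal R A" for z
    using that graded_component(1) by (elim irrelevant_idealE) (auto intro!: finsum_closed)
  obtain g K where g: "y = finsum R g K" "finite K" "0 \<notin> K" "\<And>n. n \<in> K \<Longrightarrow> g n \<in> A n"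
    by (rule irrelevant_idealE[OF y]) (rule that)
  have "x \<oplus> finsum R g K \<in> irrelevant_ideal R A"
    using g(2-4)
  proof (induction K rule: finite_induct)
    case empty
    then show ?case using x xc by simp
  next
    case (insert n K)
    have c: "g m \<in> carrier R" if "m \<in> insert n K" for m using insert.prems(2)[OF that] graded_component(1) by blast
    then have Kc: "finsum R g K \<in> carrier R" by (intro finsum_closed) auto
    have "x \<oplus> finsum R g (insert n K) = (x \<oplus> finsum R g K) \<oplus> g n"
      using insert.hyps c xc[OF x] Kc by (subst finsum_insert) (auto simp: a_ac)
    then show ?case using irrelevant_ideal_add_component[of "x \<oplus> finsum R g K" "g n" n] insert by auto
  qed
  then show ?thesis using g(1) by simp
qed

lemma graded_decomposition:
  assumes "r \<in> carrier R"
  obtains f J where "r = finsum R f J" "finite J" "\<And>n. f n \<in> A n"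
proof -
  have "\<exists>f. (\<forall>i. f i \<in> A i) \<and> finite {i. f i \<noteq> \<zero>} \<and> r = finsum R f {i. f i \<noteq> \<zero>}"
    using gr assms unfolding graded_ring_def internal_direct_sum_def by blast
  then show thesis using that by blast
qed

text \<open>A homogeneous multiple of a component of positive degree again has positive degree, and
  an arbitrary multiplier is the sum of its homogeneous components.\<close>

lemma irrelevant_ideal: "ideal (irrelevant_ideal R A) R"
proof -
  interpret RR: module R "regular_module R" by (rule regular_module) (rule is_cring)
  let ?I = "irrelevant_ideal R A"
  have Ic: "?I \<subseteq> carrier R"
    using graded_component(1) by (auto elim!: irrelevant_idealE intro!: finsum_closed)
  have hom: "s \<otimes> x \<in> ?I" if s: "s \<in> A j" and x: "x \<in> ?I" for s x j
  proof -
    have sc: "s \<in> carrier R" using s graded_component(1) by blast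
    obtain f J where f: "x = finsum R f J" "finite J" "0 \<notin> J" "\<And>n. n \<in> J \<Longrightarrow> f n \<in> A n"
      by (rule irrelevant_idealE[OF x]) (rule that)
    have "s \<otimes> finsum R f J \<in> ?I" using f(2-4)
    proof (induction J rule: finite_induct)
      case empty
      then show ?case using sc irrelevant_ideal_zero by simp
    next
      case (insert n J)
      have c: "f m \<in> carrier R" if "m \<in> insert n J" for m using insert.prems(2)[OF that] graded_component(1) by blast
      then have "finsum R f J \<in> carrier R" by (intro finsum_closed) auto
      then have "s \<otimes> finsum R f (insert n J) = s \<otimes> finsum R f J \<oplus> s \<otimes> f n"
        using insert.hyps c sc by (subst finsum_insert) (auto simp: r_distr a_comm)
      then show ?case using irrelevant_ideal_add_component[of "s \<otimes> finsum R f J" "s \<otimes> f n" "j + n"]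
          graded_mult[OF s] insert by auto
    qed
    then show ?thesis using f(1) by simp
  qed
  have "r \<otimes> x \<in> ?I" if r: "r \<in> carrier R" and x: "x \<in> ?I" for r x
  proof -
    have xc: "x \<in> carrier R" using x Ic by blast
    obtain f J where f: "r = finsum R f J" "finite J" "\<And>n. f n \<in> A n" by (rule graded_decomposition[OF r]) (rule that)
    have c: "f n \<in> carrier R" for n using f(3) graded_component(1) by blast
    have "finsum R f J \<otimes> x \<in> ?I" using f(2)
    proof (induction J rule: finite_induct)
      case empty
      then show ?case using xc irrelevant_ideal_zero by simp
    next
      case (insert n J)
      have "finsum R f J \<in> carrier R" using c by (intro finsum_closed) auto
      then have "finsum R f (insert n J) \<otimes> x = f n \<otimes> x \<oplus> finsum R f J \<otimes> x"
        using insert.hyps c xc by (subst finsum_insert) (auto simp: l_distr)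
      then show ?case using irrelevant_ideal_add hom[OF f(3) x] insert by auto
    qed
    then show ?thesis using f(1) by simp
  qed
  then have "submodule ?I R (regular_module R)"
    using Ic irrelevant_ideal_zero irrelevant_ideal_add
    by (intro RR.submoduleI') (auto simp: regular_module_def)
  then show ?thesis using submodule_regular_module_iff[OF is_cring] by blast
qed

lemma degree_zero_decomposition:
  assumes r: "r \<in> carrier R"
  obtains a i where "a \<in> A 0" "i \<in> irrelevant_ideal R A" "r = a \<oplus> i"
proof -
  obtain f J where f: "r = finsum R f J" "finite J" "\<And>n. f n \<in> A n" by (rule graded_decomposition[OF r]) (rule that)
  have c: "f n \<in> carrier R" for n using f(3) graded_component(1) by blast
  have "finsum R f (J - {0}) \<in> irrelevant_ideal R A"
    unfolding irrelevant_ideal_def using f(2,3) by blast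
  moreover have "finsum R f (J - {0}) \<in> carrier R" using c by (intro finsum_closed) auto
  then have "r = (if 0 \<in> J then f 0 else \<zero>) \<oplus> finsum R f (J - {0})"
    unfolding f(1) using f(2) c finsum_insert[of "J - {0}" 0 f] by (auto simp: insert_absorb)
  moreover have "(if 0 \<in> J then f 0 else \<zero>) \<in> A 0" using f(3) graded_component(2) by auto
  ultimately show thesis using that by blast
qed

end

text \<open>Modulo \<open>I\<close> only the degree-zero part a of r remains. If a lies outside the
  maximal ideal of \<open>A 0\<close>, it is a unit there, and its inverse inverts r modulo
  \<open>I\<close>.\<close>

lemma graded_local_residue_field:
  fixes R (structure)
  assumes gr: "graded_ring R A" and loc: "noetherian_local_ring (R\<lparr>carrier := A 0\<rparr>) \<mm>"
    and I: "ideal I R" "\<mm> \<subseteq> I" "irrelevant_ideal R A \<subseteq> I" and r: "r \<in> carrier R"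
  shows "r \<in> I \<or> (\<exists>u\<in>carrier R. u \<otimes> r \<ominus> \<one> \<in> I)"
proof -
  interpret cring R using gr by (simp add: graded_ring_def)
  interpret I: ideal I R by fact
  interpret L: noetherian_local_ring "R\<lparr>carrier := A 0\<rparr>" \<mm> by fact
  obtain a i where ai: "a \<in> A 0" "i \<in> irrelevant_ideal R A" "r = a \<oplus> i"
    using degree_zero_decomposition[OF gr r] .
  have A0: "A 0 \<subseteq> carrier R" using graded_component(1)[OF gr] .
  have i: "i \<in> I" "i \<in> carrier R" using ai(2) I(3) I.Icarr by auto
  show ?thesis
  proof (cases "a \<in> \<mm>")
    case True
    then show ?thesis using ai(3) I(2) i by auto
  next
    case False
    let ?J = "L.add_multiples {\<zero>} a"
    have z: "ideal {\<zero>} (R\<lparr>carrier := A 0\<rparr>)" using L.zeroideal by simp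
    have J: "ideal ?J (R\<lparr>carrier := A 0\<rparr>)" "a \<in> ?J" using L.add_multiples(1,3)[OF z] ai(1) by auto
    then have "\<one> \<in> ?J" using L.proper_ideal_subset[OF J(1)] False by auto
    then obtain u where u: "u \<in> A 0" "\<one> = \<zero> \<oplus> u \<otimes> a" by (auto simp: L.add_multiples_def)
    have c: "u \<in> carrier R" "a \<in> carrier R" using u ai A0 by auto
    have one: "\<one> = u \<otimes> a" using u(2) c by simp
    have "u \<otimes> r \<ominus> \<one> = u \<otimes> i"
      unfolding ai(3) one using c i a_lcomm[of "u \<otimes> a" "u \<otimes> i" "\<ominus> (u \<otimes> a)"] by (simp add: r_distr minus_eq a_assoc r_neg)
    then have "u \<otimes> r \<ominus> \<one> \<in> I" using I.I_l_closed[OF i(1) c(1)] by simp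
    then show ?thesis using c by blast
  qed
qed

text \<open>The ring elements with a power killing x form a radical ideal. Its trace on the
  degree-zero ring is an ideal containing \<open>Y\<close>, hence a power of every element of \<mm>,
  hence \<mm>. So a small set of parameters defines the same torsion as \<mm>.\<close>

lemma (in module) tors_parameters:
  assumes A0: "noetherian_cring (R\<lparr>carrier := A\<^sub>0\<rparr>)" "A\<^sub>0 \<subseteq> carrier R"
    and Y: "Y \<subseteq> \<mm>" "\<mm> \<subseteq> A\<^sub>0" "\<And>a. a \<in> \<mm> \<Longrightarrow> \<exists>k::nat. a [^] k \<in> Idl\<^bsub>R\<lparr>carrier := A\<^sub>0\<rparr>\<^esub> Y"
  shows "tors R Y M = tors R (Idl \<mm>) M"
proof
  interpret L: noetherian_cring "R\<lparr>carrier := A\<^sub>0\<rparr>" by fact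
  have mc: "\<mm> \<subseteq> carrier R" using Y A0 by blast
  show "tors R (Idl \<mm>) M \<subseteq> tors R Y M" using genideal_self[OF mc] Y(1) unfolding tors_def by blast
  show "tors R Y M \<subseteq> tors R (Idl \<mm>) M"
  proof
    fix x assume x: "x \<in> tors R Y M"
    then have xc: "x \<in> carrier M" by (simp add: tors_def)
    define N where "N = {r \<in> carrier R. \<exists>n::nat. (r [^] n) \<odot>\<^bsub>M\<^esub> x = \<zero>\<^bsub>M\<^esub>}"
    have N: "ideal N R" unfolding N_def by (rule ideal_power_annihilators[OF xc])
    interpret N: ideal N R by (rule N)
    have "ideal (N \<inter> A\<^sub>0) (R\<lparr>carrier := A\<^sub>0\<rparr>)"
    proof (rule L.idealI')
      show "\<zero>\<^bsub>R\<lparr>carrier := A\<^sub>0\<rparr>\<^esub> \<in> N \<inter> A\<^sub>0" using L.zero_closed by simp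
      show "a \<oplus>\<^bsub>R\<lparr>carrier := A\<^sub>0\<rparr>\<^esub> b \<in> N \<inter> A\<^sub>0" if "a \<in> N \<inter> A\<^sub>0" "b \<in> N \<inter> A\<^sub>0" for a b
        using that L.a_closed[of a b] by simp
      show "a \<otimes>\<^bsub>R\<lparr>carrier := A\<^sub>0\<rparr>\<^esub> b \<in> N \<inter> A\<^sub>0" if "a \<in> carrier (R\<lparr>carrier := A\<^sub>0\<rparr>)" "b \<in> N \<inter> A\<^sub>0" for a b
        using that L.m_closed[of a b] N.I_l_closed[of b a] A0(2) by auto
    qed simp
    then have IY: "Idl\<^bsub>R\<lparr>carrier := A\<^sub>0\<rparr>\<^esub> Y \<subseteq> N \<inter> A\<^sub>0"
    proof (rule L.genideal_minimal)
      show "Y \<subseteq> N \<inter> A\<^sub>0" using x Y(1,2) mc unfolding N_def tors_def by blast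
    qed
    have "\<mm> \<subseteq> N"
    proof
      fix a assume a: "a \<in> \<mm>"
      then have ac: "a \<in> carrier R" using mc by blast
      obtain k :: nat where "a [^] k \<in> N" using Y(3)[OF a] IY by blast
      then obtain n :: nat where "((a [^] k) [^] n) \<odot>\<^bsub>M\<^esub> x = \<zero>\<^bsub>M\<^esub>" unfolding N_def by blast
      then have "(a [^] (k * n)) \<odot>\<^bsub>M\<^esub> x = \<zero>\<^bsub>M\<^esub>" using R.nat_pow_pow[OF ac] by simp
      then show "a \<in> N" using ac unfolding N_def by blast
    qed
    then have "Idl \<mm> \<subseteq> N" by (rule genideal_minimal[OF N])
    then show "x \<in> tors R (Idl \<mm>) M" using xc unfolding tors_def N_def by blast
  qed
qed

text \<open>The only cohomology is in degree 0, where it is the image of the Noetherian module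
  \<open>M\<close>.\<close>

lemma injective_resolution_noetherian:
  assumes noeth: "noetherian_ring R" and fg: "finitely_generated_module R M" and E: "injective_resolution R M \<epsilon> E"
  shows "chain_cond True R (int_mod E n) (bnd (int_mod E) (int_diff E) n) (cyc (int_mod E) (int_diff E) n)"
proof -
  note I = injective_resolution_int[OF E]
  interpret C: int_complex R "int_mod E" "int_diff E" by (rule I(1))
  interpret M: module R M using E by (simp add: injective_resolution_def)
  consider "n < 0" | "n = 0" | "n > 0" by linarith
  then show ?thesis
  proof cases
    case 1
    have "cyc (int_mod E) (int_diff E) n \<subseteq> bnd (int_mod E) (int_diff E) n"
      using C.cycD(1) I(3)[OF 1] submodule_memD(3)[OF C.bnd_submodule] by fastforce
    then show ?thesis by (rule chain_cond_trivial)
  next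
    case 2
    have e: "\<epsilon> \<in> mod_hom R M (int_mod E 0)" and im: "\<epsilon> ` carrier M = cyc (int_mod E) (int_diff E) 0"
      using E I(5) by (auto simp: injective_resolution_def int_mod_def)
    show ?thesis unfolding 2
    proof (rule chain_cond_image[OF M.module_axioms C.cx_module e M.carrier_is_submodule C.cyc_submodule _ _ _
          M.finitely_generated_noetherian[OF noeth fg]])
      show "\<epsilon> x \<in> bnd (int_mod E) (int_diff E) 0" if "x \<in> {\<zero>\<^bsub>M\<^esub>}" for x
        using that mod_hom_zero[OF M.module_axioms C.cx_module e] submodule_memD(3)[OF C.bnd_submodule] by auto
      show "\<exists>y\<in>carrier M. \<exists>b\<in>bnd (int_mod E) (int_diff E) 0. z = \<epsilon> y \<oplus>\<^bsub>int_mod E 0\<^esub> b"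
        if z: "z \<in> cyc (int_mod E) (int_diff E) 0" for z
      proof -
        obtain y where y: "y \<in> carrier M" "z = \<epsilon> y" using z unfolding im[symmetric] by blast
        interpret E0: module R "int_mod E 0" by (rule C.cx_module)
        have "z = \<epsilon> y \<oplus>\<^bsub>int_mod E 0\<^esub> \<zero>\<^bsub>int_mod E 0\<^esub>" using y C.cycD(1)[OF z] by simp
        then show ?thesis using y(1) submodule_memD(3)[OF C.bnd_submodule] by blast
      qed
    qed simp
  next
    case 3
    then show ?thesis using I(4) chain_cond_trivial by blast
  qed
qed

text \<open>Composing the augmentation with the coset map turns a map on H^q P into one on
  cocycles.\<close>

lemma injective_resolution_resolves:
  assumes P: "int_complex R P D"
    and F: "injective_resolution R (module_quotient ((P q)\<lparr>carrier := cyc P D q\<rparr>) (bnd P D q)) \<eta> F"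
  shows "\<exists>h. resolves R P D q (int_mod F) (int_diff F) h"
proof -
  interpret P: int_complex R P D by fact
  let ?W = "(P q)\<lparr>carrier := cyc P D q\<rparr>"
  let ?H = "module_quotient ?W (bnd P D q)"
  note I = injective_resolution_int[OF F]
  interpret C: int_complex R "int_mod F" "int_diff F" by (rule I(1))
  interpret W: module R ?W by (rule P.cohomology_module)
  note B = P.cohomology_module(2)[of q]
  interpret H: module R ?H by (rule W.module_module_quotient[OF B])
  let ?pi = "\<lambda>z. bnd P D q +>\<^bsub>?W\<^esub> z"
  have e: "\<eta> \<in> mod_hom R ?H (int_mod F 0)" and im: "\<eta> ` carrier ?H = cyc (int_mod F) (int_diff F) 0"
    and inj: "inj_on \<eta> (carrier ?H)"
    using F I(5) by (auto simp: injective_resolution_def int_mod_def)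
  note pi = W.mod_hom_coset[OF B]
  have e0: "\<eta> w = \<zero>\<^bsub>int_mod F 0\<^esub> \<longleftrightarrow> w = \<zero>\<^bsub>?H\<^esub>" if "w \<in> carrier ?H" for w
    using inj_onD[OF inj _ that H.M.zero_closed] mod_hom_zero[OF H.module_axioms C.cx_module e] by auto
  have "carrier ?H = ?pi ` cyc P D q" by (auto simp: module_quotient_def A_RCOSETS_def')
  then have "(\<lambda>z. \<eta> (?pi z)) ` cyc P D q = cyc (int_mod F) (int_diff F) 0" using im by (metis image_image)
  moreover have "{z \<in> cyc P D q. \<eta> (?pi z) = \<zero>\<^bsub>int_mod F 0\<^esub>} = bnd P D q"
  proof -
    have "\<eta> (?pi z) = \<zero>\<^bsub>int_mod F 0\<^esub> \<longleftrightarrow> z \<in> bnd P D q" if "z \<in> cyc P D q" for z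
      using e0[OF mod_homD(1)[OF pi]] P.coset_zero_iff[OF that] that by simp
    then show ?thesis using P.bnd_subset_cyc[of q] by blast
  qed
  ultimately have "resolves R P D q (int_mod F) (int_diff F) (\<lambda>z. \<eta> (?pi z))"
    unfolding resolves_def using I mod_hom_compose[OF pi e] by blast
  then show ?thesis by blast
qed

section \<open>Transfer to local cohomology of graded modules\<close>

theorem theorem2p10:
  fixes R :: "('a, 'r) ring_scheme" and A :: "nat \<Rightarrow> 'a set" and \<mm>\<^sub>0 :: "'a set"
    and M :: "('a, 'm, 'k) module_scheme" and G :: "int \<Rightarrow> 'm set"
    and \<epsilon> :: "'m \<Rightarrow> 'e" and E :: "('a, 'e) cochain_complex"
    and \<eta> :: "int \<Rightarrow> 'e set \<Rightarrow> 'f" and F :: "int \<Rightarrow> ('a, 'f) cochain_complex"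
    and c d :: int and H :: "int \<Rightarrow> int \<Rightarrow> ('a, 'f set) module"
  assumes "graded_ring R A" and "noetherian_ring R"
    and "noetherian_ring (R\<lparr>carrier := A 0\<rparr>)" and "local_ring (R\<lparr>carrier := A 0\<rparr>) \<mm>\<^sub>0"
    and "\<exists>S. finite S \<and> S \<subseteq> A 1 \<and> generate_ring R (A 0 \<union> S) = carrier R"
    and "graded_module R A M G" and "finitely_generated_module R M"
    and "carrier M \<noteq> {\<zero>\<^bsub>M\<^esub>}"
    and "injective_resolution R M \<epsilon> E"
    and "\<And>q. injective_resolution R (local_cohomology R (irrelevant_ideal R A) E q) (\<eta> q) (F q)"
    and "\<And>p q. H p q = local_cohomology R (Idl\<^bsub>R\<^esub> \<mm>\<^sub>0) (F q) p"
    and "c = int (cohomological_dim R (irrelevant_ideal R A) E)"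
    and "d = int (the_enat (krull_dim (R\<lparr>carrier := A 0\<rparr>)))"
  shows "(artinian_module R (H d c) \<and> artinian_module R (H (d - 1) c)) \<and>
    (artinian_module R (H (d - 3) c) \<and> artinian_module R (H (d - 2) (c - 1)) \<longrightarrow>
       artinian_module R (H d (c - 2)) \<and> artinian_module R (H (d - 1) (c - 1))) \<and>
    (artinian_module R (H (d - 3) c) \<longrightarrow> artinian_module R (H (d - 1) (c - 1))) \<and>
    (artinian_module R (H d (c - 2)) \<and> artinian_module R (H (d - 1) (c - 1)) \<longrightarrow>
       artinian_module R (H (d - 3) c)) \<and>
    (artinian_module R (H (d - 2) c) \<longleftrightarrow> artinian_module R (H d (c - 1)))"
proof -
  let ?A0 = "R\<lparr>carrier := A 0\<rparr>" and ?I = "irrelevant_ideal R A"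
  note gr = assms(1) and noeth = assms(2) and E = assms(9)
  interpret cring R using gr by (simp add: graded_ring_def)
  interpret noetherian_ring R by fact
  have "noetherian_local_ring ?A0 \<mm>\<^sub>0"
    using assms(3,4) by (simp add: noetherian_local_ring_def noetherian_local_ring_axioms_def noetherian_cring_def local_ring_def)
  then interpret L: noetherian_local_ring ?A0 \<mm>\<^sub>0 .
  have A0: "A 0 \<subseteq> carrier R" using graded_component(1)[OF gr] .
  have mA: "\<mm>\<^sub>0 \<subseteq> A 0" using L.idealD(1)[OF L.maximal(2)] by auto
  have mR: "\<mm>\<^sub>0 \<subseteq> carrier R" using mA A0 by blast
  obtain d0 where d0: "krull_dim ?A0 = enat d0" "\<And>n P. L.prime_chain n P \<Longrightarrow> n \<le> d0" using L.krull_dim_finite by blast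
  have "\<exists>Y. finite Y \<and> card Y \<le> d0 \<and> Y \<subseteq> \<mm>\<^sub>0 \<and> (\<forall>a\<in>\<mm>\<^sub>0. \<exists>k::nat. a [^]\<^bsub>?A0\<^esub> k \<in> Idl\<^bsub>?A0\<^esub> Y)"
    by (rule L.exists_parameters) (rule d0(2))
  then obtain Y where Y: "finite Y" "card Y \<le> d0" "Y \<subseteq> \<mm>\<^sub>0" "\<forall>a\<in>\<mm>\<^sub>0. \<exists>k::nat. a [^]\<^bsub>?A0\<^esub> k \<in> Idl\<^bsub>?A0\<^esub> Y"
    by (elim exE conjE)
  have YR: "Y \<subseteq> carrier R" using Y(3) mR by blast
  have pow: "a [^]\<^bsub>?A0\<^esub> (k::nat) = a [^]\<^bsub>R\<^esub> k" for a k by (simp add: nat_pow_def)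
  \<comment> \<open>\<open>Y\<close> and \<open>Sa\<close> define the same torsion for different
    purposes: \<open>Y\<close> has at most d elements, which bounds the degrees, while
    \<open>Sa\<close> generates the extension of the maximal ideal, as the residue field argument
    requires.\<close>
  obtain Sa where Sa: "Sa \<subseteq> carrier R" "finite Sa" "Idl\<^bsub>R\<^esub> \<mm>\<^sub>0 = Idl\<^bsub>R\<^esub> Sa"
    using finetely_gen[OF genideal_ideal[OF mR]] by blast
  obtain Sb where Sb: "Sb \<subseteq> carrier R" "finite Sb" "?I = Idl\<^bsub>R\<^esub> Sb"
    using finetely_gen[OF irrelevant_ideal[OF gr]] by blast
  have tY: "tors R Y V = tors R Sa V" if "module R V" for V :: "('a, 'v) module"
  proof -
    interpret V: module R V by fact
    have "tors R Y V = tors R (Idl\<^bsub>R\<^esub> \<mm>\<^sub>0) V"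
      by (rule V.tors_parameters[OF L.noetherian_cring_axioms A0 Y(3) mA Y(4)[unfolded pow, rule_format]])
    then show ?thesis using V.tors_genideal[OF Sa(1)] Sa(3) by simp
  qed
  have ta: "torsion_part R (Idl\<^bsub>R\<^esub> \<mm>\<^sub>0) V = tors R Y V" if "module R V" for V :: "('a, 'v) module"
    using module.torsion_part_eq_tors[OF that Sa(2,1)] tY[OF that] Sa(3) by simp
  have tb: "torsion_part R ?I V = tors R Sb V" if "module R V" for V :: "('a, 'v) module"
    using module.torsion_part_eq_tors[OF that Sb(2,1)] Sb(3) by simp
  note IE = injective_resolution_int[OF E]
  interpret E: int_complex R "int_mod E" "int_diff E" by (rule IE(1))
  have Eb: "baer_module R (int_mod E n)" for n by (rule injective_imp_baer_module[OF IE(2)])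
  let ?P = "\<lambda>n. tors_mod R Sb (int_mod E n)" and ?D = "int_diff E"
  interpret P: int_complex R ?P ?D by (rule E.tors_complex[OF Sb(1)])
  have Pb: "baer_module R (?P n)" for n by (rule baer_module_tors[OF noeth Eb Sb(2,1)])
  have LC: "local_cohomology R ?I E i = module_quotient ((?P i)\<lparr>carrier := cyc ?P ?D i\<rparr>) (bnd ?P ?D i)" for i
    by (rule local_cohomology_eq[OF E Sb(1) tb])
  \<comment> \<open>The resolution of \<open>M\<close> is exact in positive degrees, so each
    generator of R_+ raises the top degree by at most one. This bounds the set over which the
    \<open>GREATEST\<close> in \<open>cohomological_dim\<close> ranges.\<close>
  have bound: "cyc ?P ?D q \<subseteq> bnd ?P ?D q" if "q > int (card Sb)" for q
    using E.tors_vanishing[OF noeth Eb Sb(2,1) IE(4), of 0 q] that by simp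
  \<comment> \<open>A non-vanishing degree q above c would make that bounded set contain q, so its
    greatest element c would be at least q.\<close>
  have van: "cyc ?P ?D q \<subseteq> bnd ?P ?D q" if q: "q > c" for q
  proof (rule ccontr)
    assume ne: "\<not> cyc ?P ?D q \<subseteq> bnd ?P ?D q"
    have "q \<ge> 0" using q assms(12) by simp
    define nz where "nz i \<longleftrightarrow> carrier (local_cohomology R ?I E (int i)) \<noteq> {\<zero>\<^bsub>local_cohomology R ?I E (int i)\<^esub>}" for i
    have nz: "nz i \<longleftrightarrow> \<not> cyc ?P ?D (int i) \<subseteq> bnd ?P ?D (int i)" for i
      unfolding nz_def LC using P.trivial_cohomology_iff by blast
    have "nz (nat q)" using ne \<open>q \<ge> 0\<close> nz by simp
    then have "nat q \<le> Greatest nz"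
      by (rule Greatest_le_nat) (use nz bound in \<open>force simp: not_less[symmetric]\<close>)
    then show False using q assms(12) unfolding cohomological_dim_def nz_def by simp
  qed
  have "\<exists>h. resolves R ?P ?D q (int_mod (F q)) (int_diff (F q)) h" for q
    using injective_resolution_resolves[OF P.int_complex_axioms] assms(10)[of q] unfolding LC by blast
  then obtain h where res: "\<And>q. resolves R ?P ?D q (int_mod (F q)) (int_diff (F q)) (h q)" by metis
  \<comment> \<open>The Y-torsion of the R_+-torsion is the torsion for \<open>Sa\<close> and
    \<open>Sb\<close> together, whose ideal satisfies the residue field condition.\<close>
  have art: "tors_artinian R Y ?P ?D n" for n
  proof -
    have "tors_artinian R (Sa \<union> Sb) (int_mod E) ?D n"
    proof (rule tors_cohomology_artinian[OF noeth _ _ _ E.int_complex_axioms Eb injective_resolution_noetherian[OF noeth assms(7) E]])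
      have S: "Sa \<union> Sb \<subseteq> carrier R" using Sa Sb by simp
      show "finite (Sa \<union> Sb)" "Sa \<union> Sb \<subseteq> carrier R" using Sa Sb by auto
      have J: "ideal (Idl\<^bsub>R\<^esub> (Sa \<union> Sb)) R" by (rule genideal_ideal[OF S])
      have "Idl\<^bsub>R\<^esub> Sa \<subseteq> Idl\<^bsub>R\<^esub> (Sa \<union> Sb)" "Idl\<^bsub>R\<^esub> Sb \<subseteq> Idl\<^bsub>R\<^esub> (Sa \<union> Sb)"
        using genideal_self[OF S] by (auto intro!: genideal_minimal[OF J])
      then show "a \<in> Idl\<^bsub>R\<^esub> (Sa \<union> Sb) \<or> (\<exists>u\<in>carrier R. u \<otimes>\<^bsub>R\<^esub> a \<ominus>\<^bsub>R\<^esub> \<one>\<^bsub>R\<^esub> \<in> Idl\<^bsub>R\<^esub> (Sa \<union> Sb))"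
        if "a \<in> carrier R" for a
        using graded_local_residue_field[OF gr L.noetherian_local_ring_axioms J _ _ that] genideal_self[OF mR] Sa(3) Sb(3)
        by blast
    qed
    moreover have "tors_mod R Y (?P n) = tors_mod R (Sa \<union> Sb) (int_mod E n)" for n
      using tY[OF P.cx_module[of n]] by (simp add: tors_mod_def tors_Un(1)[unfolded tors_mod_def])
    ultimately show ?thesis by simp
  qed
  have H: "artinian_module R (H p q) \<longleftrightarrow> tors_artinian R Y (int_mod (F q)) (int_diff (F q)) p" for p q
  proof -
    note IF = injective_resolution_int[OF assms(10)[of q]]
    interpret F: int_complex R "\<lambda>n. tors_mod R Y (int_mod (F q) n)" "int_diff (F q)"
      by (rule int_complex.tors_complex[OF IF(1) YR])
    have "H p q = module_quotient ((tors_mod R Y (int_mod (F q) p))\<lparr>carrier :=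
        cyc (\<lambda>n. tors_mod R Y (int_mod (F q) n)) (int_diff (F q)) p\<rparr>)
      (bnd (\<lambda>n. tors_mod R Y (int_mod (F q) n)) (int_diff (F q)) p)"
      unfolding assms(11) by (rule local_cohomology_eq[OF assms(10) YR ta])
    then show ?thesis using F.artinian_cohomology_iff by simp
  qed
  have "int (card Y) \<le> d" using assms(13) d0(1) Y(2) by simp
  from iterated_torsion_artinian[OF noeth P.int_complex_axioms Pb van res Y(1) YR this art]
  show ?thesis unfolding H .
qed

end
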